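(* There is a (randomized) algorithm that decides an instance $(U,\omega,\nu,t,b)$ of Knapsack in $\mathcal{O}^*(S)$ expected time and $\mathcal{O}^*(1)$ space, where $S=|\{ (\omega(X),\nu(X)): X \subseteq U \}|$.
   Context: Knapsack: given a set $U=\{1,\ldots,n\}$, weight functions $\omega,\nu : U \rightarrow \{1,\ldots,N\}$ and integers $t,b$, decide whether there exists $X \subseteq U$ with $\nu(X) \leq b$ and $\omega(X) \geq t$. Here $\omega(X)=\sum_{e\in X}\omega(e)$, and $\mathcal{O}^*(\cdot)$ suppresses factors polynomial in the input size of the given instance (integers encoded in binary). *)

theory Defs
  imports
    "HOL-Probability.Probability"
    "HOL-Library.Log_Nat"
    "HOL-Computational_Algebra.Polynomial"
begin

text \<open>
  The model of computation is a structured form of the random access machine under the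
  logarithmic cost criterion, extended by fair coin flips.  The memory consists of finitely many
  named integer arrays (a scalar is an array that is used at index 0 only).  A program is a fixed
  piece of text that mentions finitely many names; it must work for inputs of every size.
\<close>

text \<open>Length of the binary encoding, including a sign bit.\<close>

definition int_size :: "int \<Rightarrow> nat" where
  "int_size k = nat (bitlen \<bar>k\<bar>) + 1"

type_synonym vname = string
type_synonym mem = "vname \<Rightarrow> int \<Rightarrow> int"

datatype binop = Plus | Minus | Times | Div | Mod | Less | Eq

datatype expr =
    Const int
  | Read vname expr
  | Bin binop expr expr

datatype com =
    Skip
  | Assign vname expr expr
  | Flip vname expr
  | Seq com com
  | Cond expr com com
  | While expr com

fun apply_binop :: "binop \<Rightarrow> int \<Rightarrow> int \<Rightarrow> int" where
  "apply_binop Plus a b = a + b"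
| "apply_binop Minus a b = a - b"
| "apply_binop Times a b = a * b"
| "apply_binop Div a b = a div b"
| "apply_binop Mod a b = a mod b"
| "apply_binop Less a b = of_bool (a < b)"
| "apply_binop Eq a b = of_bool (a = b)"

primrec eval_expr :: "mem \<Rightarrow> expr \<Rightarrow> int" where
  "eval_expr m (Const k) = k"
| "eval_expr m (Read x e) = m x (eval_expr m e)"
| "eval_expr m (Bin f e1 e2) = apply_binop f (eval_expr m e1) (eval_expr m e2)"

text \<open>
  Every node of an expression is charged the length of its value, so that a read is charged for
  its address and its result, and an operation for its operands and its result.
\<close>

primrec expr_cost :: "mem \<Rightarrow> expr \<Rightarrow> nat" where
  "expr_cost m (Const k) = int_size k"
| "expr_cost m (Read x e) = expr_cost m e + int_size (m x (eval_expr m e))"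
| "expr_cost m (Bin f e1 e2) =
     expr_cost m e1 + expr_cost m e2 +
     int_size (apply_binop f (eval_expr m e1) (eval_expr m e2))"

definition update :: "mem \<Rightarrow> vname \<Rightarrow> int \<Rightarrow> int \<Rightarrow> mem" where
  "update m x i k = m(x := (m x)(i := k))"

text \<open>
  A configuration consists of the commands still to be executed and the memory.  The former is a
  list of subterms of the program whose length is bounded by the program, that is, finite control.
\<close>

type_synonym config = "com list \<times> mem"

text \<open>One fair coin is supplied to every step; only \<open>Flip\<close> looks at it.\<close>

fun step :: "bool \<Rightarrow> config \<Rightarrow> config" where
  "step r ([], m) = ([], m)"
| "step r (Skip # cs, m) = (cs, m)"
| "step r (Assign x i e # cs, m) = (cs, update m x (eval_expr m i) (eval_expr m e))"
| "step r (Flip x i # cs, m) = (cs, update m x (eval_expr m i) (of_bool r))"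
| "step r (Seq c1 c2 # cs, m) = (c1 # c2 # cs, m)"
| "step r (Cond e c1 c2 # cs, m) = ((if eval_expr m e \<noteq> 0 then c1 else c2) # cs, m)"
| "step r (While e c # cs, m) = (if eval_expr m e \<noteq> 0 then c # While e c # cs else cs, m)"

definition halted :: "config \<Rightarrow> bool" where
  "halted \<sigma> \<longleftrightarrow> fst \<sigma> = []"

fun step_cost :: "config \<Rightarrow> nat" where
  "step_cost ([], m) = 0"
| "step_cost (Skip # cs, m) = 1"
| "step_cost (Assign x i e # cs, m) = 1 + expr_cost m i + expr_cost m e"
| "step_cost (Flip x i # cs, m) = 1 + expr_cost m i"
| "step_cost (Seq c1 c2 # cs, m) = 1"
| "step_cost (Cond e c1 c2 # cs, m) = 1 + expr_cost m e"
| "step_cost (While e c # cs, m) = 1 + expr_cost m e"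

text \<open>
  Only nonzero cells occupy space; each of them is charged for its address and its content.
  The set summed over is finite in every reachable configuration (see
  \<open>finite_cells_run\<close> and \<open>finite_cells_input\<close> below).
\<close>

definition cells :: "mem \<Rightarrow> (vname \<times> int) set" where
  "cells m = {(x, i). m x i \<noteq> 0}"

definition mem_size :: "mem \<Rightarrow> nat" where
  "mem_size m = (\<Sum>(x, i)\<in>cells m. int_size i + int_size (m x i))"

text \<open>
  The intermediate values of the step about to be executed are held in addition to the memory;
  their total length is at most the cost of that step.
\<close>

definition config_space :: "config \<Rightarrow> nat" where
  "config_space \<sigma> = mem_size (snd \<sigma>) + step_cost \<sigma>"

primrec run :: "nat \<Rightarrow> bool stream \<Rightarrow> config \<Rightarrow> config" where
  "run 0 \<rho> \<sigma> = \<sigma>"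
| "run (Suc k) \<rho> \<sigma> = run k (stl \<rho>) (step (shd \<rho>) \<sigma>)"

definition coin_space :: "bool stream measure" where
  "coin_space = stream_space (measure_pmf (bernoulli_pmf (1/2)))"

text \<open>
  Halted configurations cost nothing and every other step costs at least 1, so the sum is the total
  cost of a halting run, and infinite for a run that does not halt.
\<close>

definition running_time :: "config \<Rightarrow> bool stream \<Rightarrow> ennreal" where
  "running_time \<sigma> \<rho> = (\<Sum>k. of_nat (step_cost (run k \<rho> \<sigma>)))"

definition expected_time :: "config \<Rightarrow> ennreal" where
  "expected_time \<sigma> = (\<integral>\<^sup>+ \<rho>. running_time \<sigma> \<rho> \<partial>coin_space)"

text \<open>Zero-error decision: with probability 1 the run halts and its answer is correct.\<close>

definition decides :: "config \<Rightarrow> bool \<Rightarrow> bool" where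
  "decides \<sigma> answer \<longleftrightarrow>
     (AE \<rho> in coin_space. \<exists>k. halted (run k \<rho> \<sigma>) \<and>
        (snd (run k \<rho> \<sigma>) ''out'' 0 \<noteq> 0 \<longleftrightarrow> answer))"

text \<open>
  The universe is \<open>{1..num K}\<close>.  The fields \<open>omega\<close> and \<open>nu\<close> are the weight functions
  \<open>\<omega>\<close> and \<open>\<nu>\<close>; \<open>target\<close> is the lower bound \<open>t\<close> on \<open>\<omega>\<close>, and \<open>budget\<close> the
  upper bound \<open>b\<close> on \<open>\<nu>\<close>.
\<close>

record knapsack =
  num :: nat
  omega :: "nat \<Rightarrow> nat"
  nu :: "nat \<Rightarrow> nat"
  target :: int
  budget :: int

definition universe :: "knapsack \<Rightarrow> nat set" where
  "universe K = {1..num K}"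

definition knapsack_instance :: "nat \<Rightarrow> knapsack \<Rightarrow> bool" where
  "knapsack_instance N K \<longleftrightarrow>
     omega K \<in> universe K \<rightarrow> {1..N} \<and> nu K \<in> universe K \<rightarrow> {1..N}"

definition solvable :: "knapsack \<Rightarrow> bool" where
  "solvable K \<longleftrightarrow>
     (\<exists>X\<subseteq>universe K. int (\<Sum>e\<in>X. nu K e) \<le> budget K \<and> int (\<Sum>e\<in>X. omega K e) \<ge> target K)"

definition num_weight_pairs :: "knapsack \<Rightarrow> nat" where
  "num_weight_pairs K = card {(\<Sum>e\<in>X. omega K e, \<Sum>e\<in>X. nu K e) | X. X \<subseteq> universe K}"

definition input_size :: "knapsack \<Rightarrow> nat" where
  "input_size K =
     (\<Sum>e\<in>universe K. int_size (int (omega K e)) + int_size (int (nu K e))) +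
     int_size (target K) + int_size (budget K)"

definition input_mem :: "knapsack \<Rightarrow> mem" where
  "input_mem K = (\<lambda>x i.
     if x = ''n'' \<and> i = 0 then int (num K)
     else if x = ''t'' \<and> i = 0 then target K
     else if x = ''b'' \<and> i = 0 then budget K
     else if x = ''omega'' \<and> 1 \<le> i \<and> i \<le> int (num K) then int (omega K (nat i))
     else if x = ''nu'' \<and> 1 \<le> i \<and> i \<le> int (num K) then int (nu K (nat i))
     else 0)"

definition start :: "com \<Rightarrow> knapsack \<Rightarrow> config" where
  "start P K = ([P], input_mem K)"

lemma finite_cells_update:
  assumes "finite (cells m)"
  shows "finite (cells (update m x i k))"
proof (rule finite_subset)
  show "cells (update m x i k) \<subseteq> insert (x, i) (cells m)"
    by (auto simp: cells_def update_def split: if_splits)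
qed (use assms in simp)

lemma finite_cells_step:
  "finite (cells (snd \<sigma>)) \<Longrightarrow> finite (cells (snd (step r \<sigma>)))"
  by (cases "(r, \<sigma>)" rule: step.cases) (auto intro: finite_cells_update)

lemma finite_cells_run:
  "finite (cells (snd \<sigma>)) \<Longrightarrow> finite (cells (snd (run k \<rho> \<sigma>)))"
  by (induction k arbitrary: \<rho> \<sigma>) (simp_all add: finite_cells_step)

lemma finite_cells_input: "finite (cells (snd (start P K)))"
proof (rule finite_subset)
  show "cells (snd (start P K)) \<subseteq>
          {''n'', ''t'', ''b'', ''omega'', ''nu''} \<times> {0..int (num K)}"
    by (auto simp: cells_def start_def input_mem_def split: if_splits)
qed simp

lemma step_cost_eq_0_iff: "step_cost \<sigma> = 0 \<longleftrightarrow> halted \<sigma>"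
  by (cases \<sigma> rule: step_cost.cases) (auto simp: halted_def)

lemma run_halted: "halted \<sigma> \<Longrightarrow> run k \<rho> \<sigma> = \<sigma>"
proof (induction k arbitrary: \<rho>)
  case (Suc k)
  have "step (shd \<rho>) \<sigma> = \<sigma>"
    using Suc.prems by (cases \<sigma>) (simp add: halted_def)
  then show ?case using Suc by simp
qed simp

lemma measurable_run: "(\<lambda>\<rho>. run k \<rho> \<sigma>) \<in> coin_space \<rightarrow>\<^sub>M count_space UNIV"
proof (induction k arbitrary: \<sigma>)
  case 0
  show ?case by simp
next
  case (Suc k)
  have [measurable]: "stl \<in> coin_space \<rightarrow>\<^sub>M coin_space"
    "Measurable.pred coin_space shd"
    unfolding coin_space_def by measurable
  have [measurable]: "(\<lambda>\<rho>. run k (stl \<rho>) (step r \<sigma>)) \<in> coin_space \<rightarrow>\<^sub>M count_space UNIV" for r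
    by (rule measurable_compose[OF _ Suc]) measurable
  have "(\<lambda>\<rho>. run (Suc k) \<rho> \<sigma>) =
      (\<lambda>\<rho>. if shd \<rho> then run k (stl \<rho>) (step True \<sigma>) else run k (stl \<rho>) (step False \<sigma>))"
    by (auto simp: fun_eq_iff)
  then show ?case by simp
qed

lemma measurable_running_time: "running_time \<sigma> \<in> borel_measurable coin_space"
proof -
  have [measurable]:
    "(\<lambda>\<rho>. of_nat (step_cost (run k \<rho> \<sigma>)) :: ennreal) \<in> borel_measurable coin_space" for k
    by (rule measurable_compose[OF measurable_run]) simp
  show ?thesis
    unfolding running_time_def by measurable
qed

end

theory Submission
  imports Defs "HOL-Number_Theory.Number_Theory"
begin

text \<open>
  Rounding the weights to multiples of powers of two turns the two inequalities into polynomially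
  many pairs of equations, which a large multiplier packs into single equations
  \<open>\<Sum>e\<in>X. a e = v\<close>; the rounding increases the number of distinct sums only by a polynomial
  factor.

  Let \<open>q\<close> be a prime.  The sets \<open>X\<close> for which the sum of the residues \<open>a e mod q\<close> lies in a given
  class modulo \<open>q - 1\<close> can be counted exactly in \<open>O*(q)\<close> steps and small space: sum a product over
  the \<open>(q - 1)\<close>-th roots of unity modulo \<open>q ^ J\<close>, which are the powers \<open>x ^ (q ^ (J - 1))\<close> for
  \<open>0 < x < q\<close>.  The second moment of \<open>(\<Sum>e\<in>X. a e) - v\<close> over the class is obtained in the same way.
  An empty class shows that the equation has no solution (with a given carry), and a vanishing
  moment on a nonempty class shows that it has one.  Both outcomes fail only if \<open>q\<close> divides one of
  \<open>O*(S)\<close> nonzero numbers, each of polynomial length.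

  An attempt draws \<open>q\<close> from the numbers below \<open>2 ^ d\<close> with probability about \<open>2 ^ (-d)\<close>.  Its expected
  time is polynomial, and by Chebyshev's lower bound on the number of primes it is conclusive with
  probability at least \<open>1 / O*(S)\<close>.  So repeating attempts until one is conclusive takes \<open>O*(S)\<close>
  expected time, although \<open>S\<close> is unknown.
\<close>

subsection \<open>Primes and roots of unity\<close>

text \<open>Storing the sums would take space \<open>S\<close>, so classes are counted
  algebraically. Classes modulo \<open>q\<close> would call for \<open>q\<close>-th roots of unity,
  that is, for a second prime congruent to 1 modulo \<open>q\<close>. Classes modulo
  \<open>q - 1\<close> need only the nonzero residues modulo \<open>q\<close>, without a search for
  a primitive root. These alone would give a count modulo \<open>q\<close>; the power
  \<open>q ^ (J - 1)\<close> lifts them so that the count is known modulo \<open>q ^ J\<close>,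
  which exceeds it. The price is the carry: reducing the summands separately changes the reduced sum
  by \<open>r * q\<close>, which is \<open>r\<close> modulo \<open>q - 1\<close>, for an unknown
  \<open>r\<close> of at most \<open>n\<close>. All values of \<open>r\<close> are tried. A count
  cannot tell a solution from a collision. The second moment is a sum of squares of integers, so if
  it vanishes, every member of the class is a solution. Hence a conclusive attempt is never wrong,
  and bad choices of \<open>q\<close> cost only time. The time of an attempt grows like
  \<open>2 ^ d\<close> and the length \<open>d\<close> occurs with probability about
  \<open>2 ^ (-d)\<close>; so all lengths contribute about equally, and no estimate of
  \<open>S\<close> is made.\<close>

lemma mult_binomial_dvd_Lcm:
  assumes "1 \<le> m" "m \<le> N"
  shows "m * (N choose m) dvd Lcm {1..N}"
  using assms
proof (induction N arbitrary: m)
  case (Suc N)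
  show ?case
    using Suc.prems
  proof (induction m rule: dec_induct)
    case base
    show ?case by (simp add: dvd_Lcm)
  next
    case (step m)
    define L where "L = Lcm {1..Suc N}"
    have L0: "L \<noteq> 0" unfolding L_def by (subst Lcm_0_iff) auto
    have "m * (N choose m) dvd Lcm {1..N}" using step Suc.IH[of m] by auto
    also have "Lcm {1..N} dvd L" unfolding L_def by (intro Lcm_subset) auto
    finally obtain x where x: "L = m * (N choose m) * x" by (elim dvdE)
    have "m * (Suc N choose m) dvd L" using step by (auto simp: L_def)
    then obtain y where y: "L = m * (Suc N choose m) * y" by (elim dvdE)
    have e1: "Suc m * (Suc N choose Suc m) = Suc N * (N choose m)"
      by (rule Suc_times_binomial)
    have e2: "(Suc N - m) * (Suc N choose m) = Suc N * (N choose m)"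
      using binomial_absorb_comp[of "Suc N" m] by simp
    define c where "c = int (N choose m)"
    define d where "d = int (Suc N choose m)"
    have cd: "(int (Suc N) - int m) * d = int (Suc N) * c"
      using arg_cong[OF e2, of int] step unfolding c_def d_def
      by (simp only: of_nat_mult of_nat_diff[of m "Suc N"])
    have xi: "int L = int m * c * int x" and yi: "int L = int m * d * int y"
      unfolding c_def d_def using arg_cong[OF x, of int] arg_cong[OF y, of int]
      by (simp_all only: of_nat_mult)
    have pos: "int m \<noteq> 0" "c \<noteq> 0" "d \<noteq> 0" using step by (auto simp: c_def d_def)
    \<comment> \<open>The reciprocals of \<open>m * (N choose m)\<close> form Leibniz's harmonic
      triangle: the entries with the quotients \<open>x\<close> and \<open>y\<close> differ by the
      entry for \<open>Suc m\<close> in row \<open>Suc N\<close>, whose quotient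
      \<open>x - y\<close> is therefore an integer.\<close>
    have "int m * (int (Suc N) * c * (int x - int y)) = int m * int L"
    proof -
      have "int m * (int (Suc N) * c * (int x - int y))
          = int (Suc N) * (int m * c * int x) - int (Suc N) * c * int y * int m"
        by (simp add: algebra_simps)
      also have "\<dots> = int (Suc N) * int L - (int (Suc N) - int m) * d * int y * int m"
        by (simp only: xi cd)
      also have "\<dots> = int (Suc N) * int L - (int (Suc N) - int m) * int L"
        by (subst (2) yi) (simp add: algebra_simps)
      finally show ?thesis by (simp add: algebra_simps)
    qed
    hence "int L = (int (Suc N) * c) * (int x - int y)" using pos by simp
    hence "int (Suc N) * c dvd int L" by (rule dvdI)
    hence "int (Suc N * (N choose m)) dvd int L" by (simp only: c_def of_nat_mult)
    hence "Suc N * (N choose m) dvd L" by (simp only: of_nat_dvd_iff)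
    thus ?case by (simp only: e1 L_def)
  qed
qed simp

text \<open>The multiplicity of a prime in an lcm is a maximum, so a prime power dividing the lcm
  divides one of the numbers.\<close>

lemma prime_power_dvd_Lcm_atLeastAtMost:
  fixes p :: nat
  assumes "prime p" "p ^ k dvd Lcm {1..N}" "k > 0"
  shows "p ^ k \<le> N"
  using assms(2)
proof (induction N)
  case (Suc N)
  have 1: "{1..Suc N} = insert (Suc N) {1..N}" by auto
  have "Lcm {1..Suc N} = lcm (Suc N) (Lcm {1..N})" unfolding 1 by simp
  moreover have "Lcm {1..N} \<noteq> 0" by (subst Lcm_0_iff) auto
  ultimately have "multiplicity p (Lcm {1..Suc N}) = max (multiplicity p (Suc N)) (multiplicity p (Lcm {1..N}))"
    using multiplicity_lcm[of "Suc N" "Lcm {1..N}" p] assms(1) by simp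
  moreover have "k \<le> multiplicity p (Lcm {1..Suc N})"
    using Suc.prems assms(1) \<open>Lcm {1..Suc N} = _\<close> \<open>Lcm {1..N} \<noteq> 0\<close>
    by (intro multiplicity_geI) (auto simp: not_prime_unit lcm_eq_0_iff)
  ultimately have "p ^ k dvd Suc N \<or> p ^ k dvd Lcm {1..N}"
    by (metis max_def multiplicity_dvd')
  thus ?case
  proof
    assume "p ^ k dvd Suc N"
    thus ?thesis by (intro dvd_imp_le) auto
  next
    assume "p ^ k dvd Lcm {1..N}"
    from Suc.IH[OF this] show ?thesis by simp
  qed
qed (use assms in \<open>auto simp: prime_gt_1_nat\<close>)

text \<open>By the previous lemma, the power of each prime in the factorization contributes a factor
  of at most \<open>N\<close>.\<close>

lemma Lcm_atLeastAtMost_le: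
  "Lcm {1..N} \<le> N ^ card {p::nat. prime p \<and> p \<le> N}"
proof -
  define L where "L = Lcm {1..N}"
  have L0: "L \<noteq> 0" unfolding L_def by (subst Lcm_0_iff) auto
  have "L = (\<Prod>p\<in>prime_factors L. p ^ multiplicity p L)"
    using prod_prime_factors[OF L0] by simp
  also have "\<dots> \<le> (\<Prod>p\<in>prime_factors L. N)"
  proof (rule prod_mono, safe)
    fix p assume p: "p \<in> prime_factors L"
    show "p ^ multiplicity p L \<le> N"
      using p unfolding L_def
      by (intro prime_power_dvd_Lcm_atLeastAtMost)
         (auto simp: multiplicity_dvd prime_factors_multiplicity in_prime_factors_iff prime_multiplicity_gt_zero_iff)
  qed
  also have "\<dots> = N ^ card (prime_factors L)" by simp
  also have "\<dots> \<le> N ^ card {p. prime p \<and> p \<le> N}"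
  proof (cases "N = 0")
    case True
    hence "L = 1" and "card {p. prime p \<and> p \<le> N} = 0" by (auto simp: L_def)
    thus ?thesis by (simp only: prime_factorization_1 set_mset_empty card.empty power_0 le_refl)
  next
    case False
    have "prime_factors L \<subseteq> {p. prime p \<and> p \<le> N}"
    proof safe
      fix p assume p: "p \<in> prime_factors L"
      thus "prime p" by auto
      show "p \<le> N" using prime_power_dvd_Lcm_atLeastAtMost[of p 1 N] p
        by (auto simp: L_def)
    qed
    hence "card (prime_factors L) \<le> card {p. prime p \<and> p \<le> N}"
      by (intro card_mono) auto
    thus ?thesis using False by (intro power_increasing) auto
  qed
  finally show ?thesis unfolding L_def .
qed

text \<open>Nair's proof of Chebyshev's bound: the lcm is a multiple of
  \<open>N * ((2 * N) choose N)\<close>, hence large, but it would be small if primes were few. With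
  \<open>2 * N = 2 ^ d\<close> both estimates are powers of two, so their exponents can be
  compared.\<close>

lemma card_primes_less_power_2:
  assumes "d \<ge> 2"
  shows "2 ^ d \<le> 2 * d * card {p::nat. prime p \<and> p < 2 ^ d}"
proof -
  define N where "N = (2::nat) ^ (d - 1)"
  define c where "c = card {p::nat. prime p \<and> p < 2 ^ d}"
  have N: "2 ^ d = 2 * N" "N > 0" unfolding N_def using assms
    by (auto simp flip: power_Suc)
  have "{p::nat. prime p \<and> p \<le> 2 ^ d} = {p. prime p \<and> p < 2 ^ d}"
    using assms prime_power_iff[of "2::nat" d] by (auto simp: le_less)
  hence c: "c = card {p::nat. prime p \<and> p \<le> 2 * N}" unfolding c_def N(1) by simp
  have "4 ^ N / (2 * real N) \<le> real ((2 * N) choose N)"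
    using central_binomial_lower_bound[of N] N by simp
  hence "(4::real) ^ N \<le> real (2 * (N * ((2 * N) choose N)))"
    using N by (simp add: field_simps)
  hence "(4::nat) ^ N \<le> 2 * (N * ((2 * N) choose N))"
    by (metis of_nat_le_iff of_nat_numeral of_nat_power)
  also have "N * ((2 * N) choose N) \<le> Lcm {1..2 * N}"
  proof (rule dvd_imp_le)
    show "N * ((2 * N) choose N) dvd Lcm {1..2 * N}" using N by (intro mult_binomial_dvd_Lcm) auto
    have "Lcm {1..2 * N} \<noteq> 0" by (subst Lcm_0_iff) auto
    thus "0 < Lcm {1..2 * N}" by blast
  qed
  also have "\<dots> \<le> (2 * N) ^ c" unfolding c by (rule Lcm_atLeastAtMost_le)
  also have "\<dots> = 2 ^ (d * c)" by (simp only: N(1)[symmetric] power_mult)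
  finally have "(2::nat) ^ (2 * N) \<le> 2 ^ Suc (d * c)" by (simp add: power_mult)
  hence "2 * N \<le> Suc (d * c)" by (subst (asm) power_increasing_iff) auto
  moreover have "d * c \<ge> 1" using calculation N(2) by linarith
  ultimately show ?thesis using N unfolding c_def by simp
qed

section \<open>Lifting congruences to prime powers; Teichmueller representatives\<close>

lemma cong_power_prime_power:
  fixes a b :: int
  assumes "[a = b] (mod int q)"
  shows "[a ^ (q ^ j) = b ^ (q ^ j)] (mod int q ^ Suc j)"
proof (induction j)
  case (Suc j)
  define x where "x = a ^ (q ^ j)"
  define y where "y = b ^ (q ^ j)"
  have xy: "int q ^ Suc j dvd x - y" using Suc by (simp add: x_def y_def cong_iff_dvd_diff)
  hence "[x = y] (mod int q)" 
    by (metis cong_iff_dvd_diff dvd_mult_left power_Suc)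
  \<comment> \<open>The cofactor of \<open>x - y\<close> in \<open>x ^ q - y ^ q\<close> is
    congruent to a sum of \<open>q\<close> equal terms, hence divisible by \<open>q\<close>: every
    \<open>q\<close>-th power gains one factor \<open>q\<close>.\<close>
  hence "[(\<Sum>i<q. y ^ (q - Suc i) * x ^ i) = (\<Sum>i<q. y ^ (q - Suc i) * y ^ i)] (mod int q)"
    by (intro cong_sum cong_mult cong_pow) auto
  also have "(\<Sum>i<q. y ^ (q - Suc i) * y ^ i) = (\<Sum>i<q. y ^ (q - 1))"
    by (intro sum.cong) (auto simp flip: power_add)
  also have "[\<dots> = 0] (mod int q)" by (simp add: cong_0_iff)
  finally have "int q dvd (\<Sum>i<q. y ^ (q - Suc i) * x ^ i)" by (simp add: cong_0_iff)
  hence "int q ^ Suc j * int q dvd (x - y) * (\<Sum>i<q. y ^ (q - Suc i) * x ^ i)"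
    using xy by (intro mult_dvd_mono)
  hence "int q ^ Suc (Suc j) dvd x ^ q - y ^ q"
    by (simp add: power_diff_sumr2 mult.commute)
  thus ?case by (simp add: x_def y_def cong_iff_dvd_diff power_mult mult.commute flip: power_mult)
qed (use assms in simp)

text \<open>Orthogonality of roots of unity: the \<open>w x\<close> are the Teichmueller
  representatives, all the \<open>(q - 1)\<close>-th roots of unity modulo \<open>q ^ Suc J\<close>.
  If \<open>q - 1\<close> does not divide \<open>k\<close>, multiplication by a primitive root
  \<open>g\<close> permutes the summands, so the sum equals \<open>w g ^ k\<close> times
  itself.\<close>

lemma sum_teichmueller_powers:
  fixes q J k :: nat
  assumes "prime q"
  defines "w \<equiv> \<lambda>x. int x ^ (q ^ J)"
  shows "[(\<Sum>x\<in>{1..<q}. w x ^ k) = (if (q - 1) dvd k then int q - 1 else 0)] (mod int q ^ Suc J)"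
proof (cases "(q - 1) dvd k")
  case True
  then obtain l where l: "k = (q - 1) * l" by (elim dvdE)
  have q: "q > 1" using assms prime_gt_1_nat by simp
  have "[w x ^ k = 1] (mod int q ^ Suc J)" if x: "x \<in> {1..<q}" for x
  proof -
    have "[x ^ (q - 1) = 1] (mod q)"
      using assms x by (intro fermat_theorem) (auto dest: dvd_imp_le)
    hence "[(x ^ (q - 1)) ^ l = 1 ^ l] (mod q)" by (rule cong_pow)
    hence "[int x ^ k = 1] (mod int q)"
      unfolding l by (metis cong_int_iff of_nat_1 of_nat_power power_mult power_one)
    from cong_power_prime_power[OF this, of J] show ?thesis
      by (simp add: w_def mult.commute flip: power_mult)
  qed
  hence "[(\<Sum>x\<in>{1..<q}. w x ^ k) = (\<Sum>x\<in>{1..<q}. 1)] (mod int q ^ Suc J)"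
    by (rule cong_sum)
  thus ?thesis using True q by (simp add: of_nat_diff)
next
  case False
  have q: "q > 1" using assms prime_gt_1_nat by simp
  obtain g where "residue_primroot q g" using prime_primitive_root_exists[OF q assms(1)] by blast
  hence g: "coprime q g" "ord q g = q - 1"
    by (auto simp: residue_primroot_def totient_prime assms)
  define S where "S = (\<Sum>x\<in>{1..<q}. w x ^ k)"
  have nd: "\<not> q dvd g" using g assms by (metis coprime_absorb_left not_prime_unit)
  have bij: "bij_betw (\<lambda>x. (g * x) mod q) {1..<q} {1..<q}"
  proof -
    have inj: "inj_on (\<lambda>x. (g * x) mod q) {1..<q}"
    proof
      fix x y assume xy: "x \<in> {1..<q}" "y \<in> {1..<q}" "(g * x) mod q = (g * y) mod q"
      hence "[g * x = g * y] (mod q)" by (simp add: cong_def)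
      hence "[x = y] (mod q)" using g by (simp add: cong_mult_lcancel_nat coprime_commute)
      thus "x = y" using xy by (simp add: cong_def)
    qed
    have "(\<lambda>x. (g * x) mod q) ` {1..<q} \<subseteq> {1..<q}"
    proof safe
      fix x assume "x \<in> {1..<q}"
      hence "\<not> q dvd x" by (auto dest: dvd_imp_le)
      hence "\<not> q dvd g * x" using nd assms by (simp add: prime_dvd_mult_iff)
      hence "(g * x) mod q \<noteq> 0" by (simp add: dvd_eq_mod_eq_0)
      thus "(g * x) mod q \<in> {1..<q}" using q by simp
    qed
    thus ?thesis using inj endo_inj_surj[of "{1..<q}"] by (auto simp: bij_betw_def)
  qed
  have "S = (\<Sum>x\<in>{1..<q}. w ((g * x) mod q) ^ k)"
    unfolding S_def by (rule sum.reindex_bij_betw[OF bij, symmetric])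
  also have "[\<dots> = (\<Sum>x\<in>{1..<q}. (w g * w x) ^ k)] (mod int q ^ Suc J)"
  proof (intro cong_sum cong_pow)
    fix x
    have "[int ((g * x) mod q) = int g * int x] (mod int q)"
      by (simp add: cong_def zmod_int)
    from cong_power_prime_power[OF this, of J]
    show "[w ((g * x) mod q) = w g * w x] (mod int q ^ Suc J)"
      by (simp add: w_def power_mult_distrib)
  qed
  also have "(\<Sum>x\<in>{1..<q}. (w g * w x) ^ k) = w g ^ k * S"
    by (simp add: S_def power_mult_distrib sum_distrib_left)
  finally have "int q ^ Suc J dvd S - w g ^ k * S" by (simp add: cong_iff_dvd_diff)
  also have "S - w g ^ k * S = (1 - w g ^ k) * S" by (simp add: algebra_simps)
  finally have d: "int q ^ Suc J dvd (1 - w g ^ k) * S" .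
  have fer: "[int g ^ (q ^ i) = int g] (mod int q)" for i
  proof (induction i)
    case (Suc i)
    have "[g ^ (q - 1) = 1] (mod q)" using assms nd by (intro fermat_theorem) auto
    hence "[g ^ (q - 1) * g = 1 * g] (mod q)" by (intro cong_mult) auto
    hence "[g ^ q = g] (mod q)" using q by (metis One_nat_def Suc_pred less_trans mult_1 power_Suc2 zero_less_one)
    hence "[int g ^ q = int g] (mod int q)" by (metis cong_int_iff of_nat_power)
    moreover have "[(int g ^ (q ^ i)) ^ q = int g ^ q] (mod int q)" using Suc by (rule cong_pow)
    ultimately show ?case by (simp add: power_mult mult.commute[of q] cong_trans)
  qed simp
  \<comment> \<open>Modulo a prime power, \<open>1 - w g ^ k\<close> has to be a unit and not merely
    nonzero. Units are recognized modulo \<open>q\<close>, where \<open>w g\<close> reduces to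
    \<open>g\<close>.\<close>
  have "[w g ^ k = int g ^ k] (mod int q)" unfolding w_def by (intro cong_pow fer)
  moreover have "\<not> [int g ^ k = 1] (mod int q)"
    using False g ord_divides[of g k q] by (metis cong_int_iff of_nat_1 of_nat_power)
  ultimately have "\<not> [w g ^ k = 1] (mod int q)" by (metis cong_sym cong_trans)
  hence "\<not> int q dvd 1 - w g ^ k" by (metis cong_iff_dvd_diff cong_sym_eq)
  hence "coprime (int q) (1 - w g ^ k)" using assms by (intro prime_imp_coprime) auto
  hence "coprime (int q ^ Suc J) (1 - w g ^ k)" by (rule coprime_power_left_iff[THEN iffD2, OF disjI1])
  with d have "int q ^ Suc J dvd S" by (simp add: coprime_dvd_mult_right_iff)
  thus ?thesis using False by (simp add: S_def cong_0_iff)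
qed

lemma run_add: "run (a + b) \<rho> \<sigma> = run b (sdrop a \<rho>) (run a \<rho> \<sigma>)"
  by (induction a arbitrary: \<rho> \<sigma>) simp_all

subsection \<open>Deterministic program fragments\<close>

text \<open>The step count and the final memory are fixed before the continuation \<open>cs\<close>
  and the coins \<open>\<rho>\<close>, so the fragment behaves the same inside every randomized run.
  The safety predicate \<open>G\<close> is required strictly before the end only; the final memory
  is the first one of the next fragment.\<close>

definition wp :: "(mem \<Rightarrow> bool) \<Rightarrow> com \<Rightarrow> nat \<Rightarrow> (mem \<Rightarrow> bool) \<Rightarrow> mem \<Rightarrow> bool" where
  "wp G c T Q m \<longleftrightarrow>
     (\<exists>t m'. t \<le> T \<and> Q m' \<and>
        (\<forall>cs \<rho>. run t \<rho> (c # cs, m) = (cs, m') \<and> (\<forall>k<t. G (snd (run k \<rho> (c # cs, m))))))"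

lemma wpI:
  assumes "t \<le> T" "Q m'" "\<And>cs \<rho>. run t \<rho> (c # cs, m) = (cs, m')"
    "\<And>cs \<rho> k. k < t \<Longrightarrow> G (snd (run k \<rho> (c # cs, m)))"
  shows "wp G c T Q m"
  using assms unfolding wp_def by blast

lemma wp_mono:
  assumes "wp G c T Q m" "T \<le> T'" "\<And>m'. Q m' \<Longrightarrow> Q' m'"
  shows "wp G c T' Q' m"
  using assms unfolding wp_def by (meson order_trans)

lemma wp_Skip: "G m \<Longrightarrow> Q m \<Longrightarrow> wp G Skip 1 Q m"
  by (rule wpI[where t = 1 and m' = m]) simp_all

lemma wp_Assign:
  "G m \<Longrightarrow> Q (update m x (eval_expr m i) (eval_expr m e)) \<Longrightarrow> wp G (Assign x i e) 1 Q m"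
  by (rule wpI[where t = 1 and m' = "update m x (eval_expr m i) (eval_expr m e)"]) simp_all

lemma wp_Seq:
  assumes "G m" "wp G c1 T1 (wp G c2 T2 Q) m"
  shows "wp G (Seq c1 c2) (1 + T1 + T2) Q m"
proof -
  from assms(2) obtain t1 m1 where 1: "t1 \<le> T1" "wp G c2 T2 Q m1"
    "\<And>cs \<rho>. run t1 \<rho> (c1 # cs, m) = (cs, m1)"
    "\<And>cs \<rho> k. k < t1 \<Longrightarrow> G (snd (run k \<rho> (c1 # cs, m)))"
    unfolding wp_def by blast
  from 1(2) obtain t2 m2 where 2: "t2 \<le> T2" "Q m2"
    "\<And>cs \<rho>. run t2 \<rho> (c2 # cs, m1) = (cs, m2)"
    "\<And>cs \<rho> k. k < t2 \<Longrightarrow> G (snd (run k \<rho> (c2 # cs, m1)))"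
    unfolding wp_def by blast
  show ?thesis
  proof (rule wpI[where t = "Suc (t1 + t2)" and m' = m2])
    fix cs \<rho> k assume k: "k < Suc (t1 + t2)"
    show "G (snd (run k \<rho> (Seq c1 c2 # cs, m)))"
    proof (cases k)
      case (Suc k')
      show ?thesis
      proof (cases "k' < t1")
        case False
        then obtain k'' where "k' = t1 + k''" using le_Suc_ex[of t1 k'] by auto
        with k Suc 1 2 show ?thesis by (simp add: run_add)
      qed (use Suc 1 in simp)
    qed (use assms in simp)
  qed (use 1 2 in \<open>simp_all add: run_add\<close>)
qed

lemma wp_Cond:
  assumes "G m" "eval_expr m e \<noteq> 0 \<Longrightarrow> wp G c1 T Q m" "eval_expr m e = 0 \<Longrightarrow> wp G c2 T Q m"
  shows "wp G (Cond e c1 c2) (1 + T) Q m"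
proof -
  define c where "c = (if eval_expr m e \<noteq> 0 then c1 else c2)"
  have "wp G c T Q m" using assms by (simp add: c_def)
  then obtain t m' where 1: "t \<le> T" "Q m'"
    "\<And>cs \<rho>. run t \<rho> (c # cs, m) = (cs, m')"
    "\<And>cs \<rho> k. k < t \<Longrightarrow> G (snd (run k \<rho> (c # cs, m)))"
    unfolding wp_def by blast
  have st: "step r (Cond e c1 c2 # cs, m) = (c # cs, m)" for r cs by (simp add: c_def)
  show ?thesis
  proof (rule wpI[where t = "Suc t" and m' = m'])
    fix cs \<rho> k assume k: "k < Suc t"
    show "G (snd (run k \<rho> (Cond e c1 c2 # cs, m)))"
      using k assms 1 by (cases k) (simp_all del: step.simps add: st)
  qed (use 1 in \<open>simp_all del: step.simps add: st\<close>)
qed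

section \<open>Frame rules and counted loops\<close>

primrec mods :: "com \<Rightarrow> vname set" where
  "mods Skip = {}"
| "mods (Assign x i e) = {x}"
| "mods (Flip x i) = {x}"
| "mods (Seq c1 c2) = mods c1 \<union> mods c2"
| "mods (Cond e c1 c2) = mods c1 \<union> mods c2"
| "mods (While e c) = mods c"

lemma step_mods:
  "step r (cs, m) = (cs', m') \<Longrightarrow>
   (\<Union>c\<in>set cs'. mods c) \<subseteq> (\<Union>c\<in>set cs. mods c) \<and> (\<forall>x. x \<notin> (\<Union>c\<in>set cs. mods c) \<longrightarrow> m' x = m x)"
  by (cases "(r, (cs, m))" rule: step.cases) (auto simp: update_def split: if_splits)

lemma run_mods:
  "run k \<rho> (cs, m) = (cs', m') \<Longrightarrow> x \<notin> (\<Union>c\<in>set cs. mods c) \<Longrightarrow> m' x = m x"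
proof (induction k arbitrary: \<rho> cs m)
  case (Suc k)
  obtain cs1 m1 where 1: "step (shd \<rho>) (cs, m) = (cs1, m1)" by fastforce
  from step_mods[OF 1] Suc.prems(2) have "x \<notin> (\<Union>c\<in>set cs1. mods c)" "m1 x = m x" by blast+
  moreover have "run k (stl \<rho>) (cs1, m1) = (cs', m')" using Suc.prems 1 by simp
  ultimately show ?case using Suc.IH by metis
qed simp

lemma wp_frame:
  assumes "wp G c T Q m"
  shows "wp G c T (\<lambda>m'. Q m' \<and> (\<forall>x. x \<notin> mods c \<longrightarrow> m' x = m x)) m"
proof -
  from assms obtain t m' where 1: "t \<le> T" "Q m'"
    "\<And>cs \<rho>. run t \<rho> (c # cs, m) = (cs, m')"
    "\<And>cs \<rho> k. k < t \<Longrightarrow> G (snd (run k \<rho> (c # cs, m)))"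
    unfolding wp_def by blast
  from 1(3)[of undefined "[]"] have "\<forall>x. x \<notin> mods c \<longrightarrow> m' x = m x"
    by (auto dest: run_mods)
  with 1 show ?thesis by (intro wpI[where t = t and m' = m']) simp_all
qed

lemma wp_use:
  assumes "wp G c T Q m" "T \<le> T'"
    and "\<And>m'. Q m' \<Longrightarrow> (\<And>x. x \<notin> mods c \<Longrightarrow> m' x = m x) \<Longrightarrow> Q' m'"
  shows "wp G c T' Q' m"
  using wp_frame[OF assms(1)] assms(2,3) by (rule wp_mono) auto

lemma wp_While_aux:
  assumes "\<And>i m. i < N \<Longrightarrow> I i m \<Longrightarrow> G m \<and> eval_expr m g \<noteq> 0 \<and> wp G c T (I (Suc i)) m"
    and "\<And>m. I N m \<Longrightarrow> G m \<and> eval_expr m g = 0 \<and> Q m"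
    and "i \<le> N" "I i m"
  shows "wp G (While g c) ((N - i) * (T + 1) + 1) Q m"
  using assms(3,4)
proof (induction i arbitrary: m rule: inc_induct)
  case base
  with assms(2)[OF base] show ?case by (intro wpI[where t = 1 and m' = m]) simp_all
next
  case (step i)
  from assms(1)[OF step.hyps(2) step.prems]
  have G: "G m" and e: "eval_expr m g \<noteq> 0" and w: "wp G c T (I (Suc i)) m" by auto
  from w obtain t1 m1 where 1: "t1 \<le> T" "I (Suc i) m1"
    "\<And>cs \<rho>. run t1 \<rho> (c # cs, m) = (cs, m1)"
    "\<And>cs \<rho> k. k < t1 \<Longrightarrow> G (snd (run k \<rho> (c # cs, m)))"
    unfolding wp_def by blast
  from step.IH[OF 1(2)] obtain t2 m2 where 2: "t2 \<le> (N - Suc i) * (T + 1) + 1" "Q m2"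
    "\<And>cs \<rho>. run t2 \<rho> (While g c # cs, m1) = (cs, m2)"
    "\<And>cs \<rho> k. k < t2 \<Longrightarrow> G (snd (run k \<rho> (While g c # cs, m1)))"
    unfolding wp_def by blast
  show ?case
  proof (rule wpI[where t = "Suc (t1 + t2)" and m' = m2])
    have "N - i = Suc (N - Suc i)" using step.hyps by simp
    thus "Suc (t1 + t2) \<le> (N - i) * (T + 1) + 1" using 1(1) 2(1) by simp
  next
    fix cs \<rho> k assume k: "k < Suc (t1 + t2)"
    show "G (snd (run k \<rho> (While g c # cs, m)))"
    proof (cases k)
      case (Suc k')
      show ?thesis
      proof (cases "k' < t1")
        case False
        then obtain k'' where "k' = t1 + k''" using le_Suc_ex[of t1 k'] by auto
        with k Suc e 1 2 show ?thesis by (simp add: run_add)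
      qed (use Suc 1 e in simp)
    qed (use G in simp)
  qed (use e 1 2 in \<open>simp_all add: run_add\<close>)
qed

text \<open>The invariant carries the round number, so that the loop makes exactly \<open>N\<close>
  rounds and termination needs no measure. What the body leaves unmodified is added to the invariant
  here once and for all.\<close>

lemma wp_While:
  assumes "I 0 m0"
    and "\<And>i m. i < N \<Longrightarrow> I i m \<Longrightarrow> (\<And>x. x \<notin> mods c \<Longrightarrow> m x = m0 x) \<Longrightarrow>
           G m \<and> eval_expr m g \<noteq> 0 \<and> wp G c T (I (Suc i)) m"
    and "\<And>m. I N m \<Longrightarrow> (\<And>x. x \<notin> mods c \<Longrightarrow> m x = m0 x) \<Longrightarrow> G m \<and> eval_expr m g = 0 \<and> Q m"
  shows "wp G (While g c) (N * (T + 1) + 1) Q m0"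
proof -
  define J where "J = (\<lambda>i m. I i m \<and> (\<forall>x. x \<notin> mods c \<longrightarrow> m x = m0 x))"
  have "wp G (While g c) ((N - 0) * (T + 1) + 1) Q m0"
  proof (rule wp_While_aux[where I = J])
    fix i m assume i: "i < N" "J i m"
    with assms(2)[of i m] have "G m" "eval_expr m g \<noteq> 0" and w: "wp G c T (I (Suc i)) m"
      by (auto simp: J_def)
    moreover have "wp G c T (J (Suc i)) m"
      using i by (intro wp_mono[OF wp_frame[OF w]]) (auto simp: J_def)
    ultimately show "G m \<and> eval_expr m g \<noteq> 0 \<and> wp G c T (J (Suc i)) m" by simp
  qed (use assms in \<open>auto simp: J_def\<close>)
  thus ?thesis by simp
qed

subsection \<open>Expected number of steps\<close>

text \<open>
  The reward \<open>w\<close> is collected on halting: a large reward for wrong answers turns a bound on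
  this quantity that is uniform in the reward into almost sure correctness.
\<close>

primrec steps_upto :: "(config \<Rightarrow> real) \<Rightarrow> nat \<Rightarrow> config \<Rightarrow> real" where
  "steps_upto w 0 \<sigma> = (if halted \<sigma> then w \<sigma> else 0)"
| "steps_upto w (Suc N) \<sigma> = (if halted \<sigma> then w \<sigma> else
     1 + (steps_upto w N (step True \<sigma>) + steps_upto w N (step False \<sigma>)) / 2)"

lemma steps_upto_nonneg: "(\<And>\<sigma>. w \<sigma> \<ge> 0) \<Longrightarrow> steps_upto w N \<sigma> \<ge> 0"
  by (induction N arbitrary: \<sigma>) (simp_all add: add_nonneg_nonneg)

lemma steps_upto_Suc:
  assumes "\<And>\<sigma>. w \<sigma> \<ge> 0"
  shows "steps_upto w N \<sigma> \<le> steps_upto w (Suc N) \<sigma>"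
proof (induction N arbitrary: \<sigma>)
  case 0
  show ?case using assms by (simp add: add_nonneg_nonneg)
next
  case (Suc N)
  show ?case using Suc[of "step True \<sigma>"] Suc[of "step False \<sigma>"] by (simp add: divide_right_mono add_mono)
qed

lemma steps_upto_step:
  assumes "\<And>\<sigma>. w \<sigma> \<ge> 0" "\<not> halted \<sigma>"
  shows "steps_upto w N \<sigma> \<le> 1 + (steps_upto w N (step True \<sigma>) + steps_upto w N (step False \<sigma>)) / 2"
  using steps_upto_Suc[where w = w and N = N and \<sigma> = \<sigma>, OF assms(1)] assms(2) by simp

lemma steps_upto_run:
  assumes "\<And>\<sigma>. w \<sigma> \<ge> 0" "\<And>\<rho>. run t \<rho> \<sigma> = \<sigma>'"
  shows "steps_upto w N \<sigma> \<le> t + steps_upto w N \<sigma>'"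
  using assms(2)
proof (induction t arbitrary: \<sigma>)
  case (Suc t)
  show ?case
  proof (cases "halted \<sigma>")
    case True
    thus ?thesis using Suc.prems[of undefined] run_halted[OF True, of "Suc t"] by simp
  next
    case False
    have "steps_upto w N (step b \<sigma>) \<le> t + steps_upto w N \<sigma>'" for b
      using Suc.prems[of "b ## _"] by (intro Suc.IH) simp
    from this[of True] this[of False] steps_upto_step[where w = w and N = N, OF assms(1) False]
    show ?thesis unfolding of_nat_Suc by argo
  qed
qed simp

lemma steps_upto_wp:
  assumes "\<And>\<sigma>. w \<sigma> \<ge> 0" "wp G c T Q m"
  obtains m' where "Q m'" "steps_upto w N (c # cs, m) \<le> T + steps_upto w N (cs, m')"
proof -
  from assms(2) obtain t m' where 1: "t \<le> T" "Q m'" "\<And>cs \<rho>. run t \<rho> (c # cs, m) = (cs, m')"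
    unfolding wp_def by blast
  from steps_upto_run[where w = w and N = N, OF assms(1) 1(3), of cs] 1(1)
  have "steps_upto w N (c # cs, m) \<le> T + steps_upto w N (cs, m')" by simp
  with 1(2) that show ?thesis by blast
qed

lemma steps_upto_det:
  assumes "\<And>\<sigma>. w \<sigma> \<ge> 0" "\<And>r. step r (c # cs, m) = \<sigma>"
  shows "steps_upto w N (c # cs, m) \<le> 1 + steps_upto w N \<sigma>"
  using steps_upto_step[where w = w and N = N and \<sigma> = "(c # cs, m)", OF assms(1)] assms(2) by (simp add: halted_def)

lemma steps_upto_Flip:
  assumes "\<And>\<sigma>. w \<sigma> \<ge> 0"
  shows "steps_upto w N (Flip x i # cs, m) \<le>
    1 + (steps_upto w N (cs, update m x (eval_expr m i) 1) + steps_upto w N (cs, update m x (eval_expr m i) 0)) / 2"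
  using steps_upto_step[where w = w and N = N and \<sigma> = "(Flip x i # cs, m)", OF assms] by (simp add: halted_def)

section \<open>From the recursion to expectations over coin sequences\<close>

lemma nn_integral_coin_space:
  assumes "f \<in> borel_measurable coin_space"
  shows "(\<integral>\<^sup>+\<rho>. f \<rho> \<partial>coin_space) =
    ((\<integral>\<^sup>+\<rho>. f (True ## \<rho>) \<partial>coin_space) + (\<integral>\<^sup>+\<rho>. f (False ## \<rho>) \<partial>coin_space)) / 2"
proof -
  have "(\<integral>\<^sup>+\<rho>. f \<rho> \<partial>coin_space) =
      (\<integral>\<^sup>+x. (\<integral>\<^sup>+\<rho>. f (x ## \<rho>) \<partial>coin_space) \<partial>measure_pmf (bernoulli_pmf (1/2)))"
    using assms unfolding coin_space_def by (rule prob_space.nn_integral_stream_space[OF prob_space_measure_pmf])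
  also have "\<dots> = (\<integral>\<^sup>+\<rho>. f (True ## \<rho>) \<partial>coin_space) * ennreal (1/2)
      + (\<integral>\<^sup>+\<rho>. f (False ## \<rho>) \<partial>coin_space) * ennreal (1 - 1/2)"
    by (subst nn_integral_bernoulli_pmf) auto
  also have "\<dots> = ((\<integral>\<^sup>+\<rho>. f (True ## \<rho>) \<partial>coin_space) + (\<integral>\<^sup>+\<rho>. f (False ## \<rho>) \<partial>coin_space)) / 2"
  proof -
    have "ennreal (1/2) = inverse 2" "ennreal (1 - 1/2) = inverse 2"
      using inverse_ennreal[of 2] by (simp_all add: inverse_eq_divide[of "2::real"])
    thus ?thesis by (simp only: divide_ennreal_def distrib_right)
  qed
  finally show ?thesis .
qed

lemma measurable_comp_run: "(\<lambda>\<rho>. f (run k \<rho> \<sigma>)) \<in> borel_measurable coin_space"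
  by (rule measurable_compose[OF measurable_run]) simp

text \<open>\<open>steps_upto\<close> recurses over the two outcomes of the first coin, and
  \<open>nn_integral_coin_space\<close> splits the integral in the same way.\<close>

lemma nn_integral_steps:
  assumes "\<And>\<sigma>. w \<sigma> \<ge> 0"
  shows "(\<integral>\<^sup>+\<rho>. (\<Sum>k<N. of_bool (\<not> halted (run k \<rho> \<sigma>))) +
       ennreal (if halted (run N \<rho> \<sigma>) then w (run N \<rho> \<sigma>) else 0) \<partial>coin_space) =
     ennreal (steps_upto w N \<sigma>)"
proof -
  interpret prob_space coin_space
    unfolding coin_space_def by (rule prob_space.prob_space_stream_space[OF prob_space_measure_pmf])
  note m = borel_measurable_add[OF borel_measurable_sum measurable_comp_run]
  show ?thesis
  proof (induction N arbitrary: \<sigma>)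
    case 0
    show ?case by (simp add: emeasure_space_1)
  next
    case (Suc N)
    show ?case
    proof (cases "halted \<sigma>")
      case True
      have "run k \<rho> \<sigma> = \<sigma>" for k \<rho> by (rule run_halted[OF True])
      thus ?thesis using True by (simp add: emeasure_space_1 del: run.simps)
    next
      case False
      define f where "f = (\<lambda>N \<rho> \<sigma>. (\<Sum>k<N. of_bool (\<not> halted (run k \<rho> \<sigma>)) :: ennreal) +
        ennreal (if halted (run N \<rho> \<sigma>) then w (run N \<rho> \<sigma>) else 0))"
      have fm: "(\<lambda>\<rho>. f N \<rho> \<sigma>) \<in> borel_measurable coin_space" for N \<sigma>
        unfolding f_def by (intro borel_measurable_add borel_measurable_sum) (rule measurable_comp_run)+
      have fS: "f (Suc N) (b ## \<rho>) \<sigma> = 1 + f N \<rho> (step b \<sigma>)" for b \<rho>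
        unfolding f_def using False by (subst sum.lessThan_Suc_shift) (simp add: add.assoc)
      have IH: "(\<integral>\<^sup>+\<rho>. f N \<rho> \<sigma> \<partial>coin_space) = ennreal (steps_upto w N \<sigma>)" for \<sigma>
        unfolding f_def by (rule Suc)
      have intb: "(\<integral>\<^sup>+\<rho>. f (Suc N) (b ## \<rho>) \<sigma> \<partial>coin_space) = 1 + ennreal (steps_upto w N (step b \<sigma>))" for b
        unfolding fS by (subst nn_integral_add) (simp_all add: fm IH emeasure_space_1)
      have "(\<integral>\<^sup>+\<rho>. f (Suc N) \<rho> \<sigma> \<partial>coin_space) =
          ((\<integral>\<^sup>+\<rho>. f (Suc N) (True ## \<rho>) \<sigma> \<partial>coin_space) + (\<integral>\<^sup>+\<rho>. f (Suc N) (False ## \<rho>) \<sigma> \<partial>coin_space)) / 2"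
        by (rule nn_integral_coin_space[OF fm])
      also have "\<dots> = (1 + ennreal (steps_upto w N (step True \<sigma>)) + (1 + ennreal (steps_upto w N (step False \<sigma>)))) / 2"
        by (simp only: intb)
      also have "\<dots> = ennreal ((1 + steps_upto w N (step True \<sigma>) + (1 + steps_upto w N (step False \<sigma>))) / 2)"
        using steps_upto_nonneg[of w, OF assms]
      proof -
        have e: "1 + ennreal x + (1 + ennreal y) = ennreal (1 + x + (1 + y))" if "x \<ge> 0" "y \<ge> 0" for x y
          using that by (simp only: ennreal_plus ennreal_1 add_nonneg_nonneg zero_le_one)
        have d: "ennreal z / 2 = ennreal (z / 2)" if "z \<ge> 0" for z
          using divide_ennreal[of z 2] that by simp
        note nn = steps_upto_nonneg[where w = w, OF assms]
        show ?thesis unfolding e[OF nn nn]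
          by (intro d add_nonneg_nonneg nn zero_le_one)
      qed
      also have "\<dots> = ennreal (steps_upto w (Suc N) \<sigma>)" using False by (simp add: field_simps)
      finally show ?thesis unfolding f_def .
    qed
  qed
qed

text \<open>\<open>V\<close> bounds the expected number of steps. It is finite, so almost every run
  halts; and each step costs at most \<open>C\<close>. Correctness comes from the freedom in the
  reward \<open>B\<close>.\<close>

lemma decides_and_expected_time:
  assumes bnd: "\<And>B N. B \<ge> 0 \<Longrightarrow>
      steps_upto (\<lambda>\<sigma>. if snd \<sigma> ''out'' 0 \<noteq> 0 \<longleftrightarrow> answer then 0 else B) N \<sigma> \<le> V"
    and cost: "\<And>k \<rho>. step_cost (run k \<rho> \<sigma>) \<le> C"
  shows "decides \<sigma> answer" "expected_time \<sigma> \<le> ennreal (real C * V)"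
proof -
  interpret prob_space coin_space
    unfolding coin_space_def by (rule prob_space.prob_space_stream_space[OF prob_space_measure_pmf])
  define w where "w = (\<lambda>B (\<sigma>::config). if snd \<sigma> ''out'' 0 \<noteq> 0 \<longleftrightarrow> answer then 0 else B :: real)"
  define nh where "nh = (\<lambda>k \<rho>. of_bool (\<not> halted (run k \<rho> \<sigma>)) :: ennreal)"
  have nhm [measurable]: "nh k \<in> borel_measurable coin_space" for k
    unfolding nh_def by (rule measurable_comp_run)
  have w0: "B \<ge> 0 \<Longrightarrow> w B \<sigma> \<ge> 0" for B \<sigma> by (simp add: w_def)
  have V0: "V \<ge> 0" using steps_upto_nonneg[of "w 0" 0 \<sigma>] bnd[of 0 0] by (simp add: w_def)
  have part: "(\<integral>\<^sup>+\<rho>. (\<Sum>k<N. nh k \<rho>) + ennreal (if halted (run N \<rho> \<sigma>) then w B (run N \<rho> \<sigma>) else 0) \<partial>coin_space)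
      \<le> ennreal V" if "B \<ge> 0" for B N
    unfolding nh_def using nn_integral_steps[where w = "w B" and N = N and \<sigma> = \<sigma>] w0[OF that] bnd[OF that, of N] 
    by (simp add: w_def ennreal_leI)
  have fin: "(\<integral>\<^sup>+\<rho>. (\<Sum>k<N. nh k \<rho>) \<partial>coin_space) \<le> ennreal V" for N
    by (rule order_trans[OF nn_integral_mono part[of 0 N]]) simp_all
  have "(\<integral>\<^sup>+\<rho>. (\<Sum>k. nh k \<rho>) \<partial>coin_space) = (\<Sum>k. \<integral>\<^sup>+\<rho>. nh k \<rho> \<partial>coin_space)"
    by (rule nn_integral_suminf) simp
  also have "\<dots> = (SUP N. \<Sum>k<N. \<integral>\<^sup>+\<rho>. nh k \<rho> \<partial>coin_space)" by (rule suminf_eq_SUP)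
  also have "\<dots> \<le> ennreal V"
    by (rule SUP_least) (use fin in \<open>simp add: nn_integral_sum\<close>)
  finally have tot: "(\<integral>\<^sup>+\<rho>. (\<Sum>k. nh k \<rho>) \<partial>coin_space) \<le> ennreal V" .
  have "expected_time \<sigma> \<le> (\<integral>\<^sup>+\<rho>. of_nat C * (\<Sum>k. nh k \<rho>) \<partial>coin_space)"
    unfolding expected_time_def
  proof (rule nn_integral_mono)
    fix \<rho>
    have "running_time \<sigma> \<rho> \<le> (\<Sum>k. of_nat C * nh k \<rho>)"
      unfolding running_time_def
    proof (rule suminf_le)
      fix k show "of_nat (step_cost (run k \<rho> \<sigma>)) \<le> of_nat C * nh k \<rho>"
        using cost[of k \<rho>] step_cost_eq_0_iff[of "run k \<rho> \<sigma>"] by (auto simp: nh_def)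
    qed auto
    thus "running_time \<sigma> \<rho> \<le> of_nat C * (\<Sum>k. nh k \<rho>)" by simp
  qed
  also have "\<dots> = of_nat C * (\<integral>\<^sup>+\<rho>. (\<Sum>k. nh k \<rho>) \<partial>coin_space)"
    by (rule nn_integral_cmult) simp
  also have "\<dots> \<le> of_nat C * ennreal V" by (rule mult_left_mono[OF tot]) simp
  also have "\<dots> = ennreal (real C * V)" using V0 by (simp add: ennreal_mult ennreal_of_nat_eq_real_of_nat)
  finally show "expected_time \<sigma> \<le> ennreal (real C * V)" .
  have halts: "AE \<rho> in coin_space. \<exists>k. halted (run k \<rho> \<sigma>)"
  proof -
    have "AE \<rho> in coin_space. (\<Sum>k. nh k \<rho>) \<noteq> \<infinity>"
      by (rule nn_integral_PInf_AE) (use tot in \<open>auto simp: top_unique\<close>)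
    thus ?thesis
    proof (rule AE_mp, intro AE_I2 impI)
      fix \<rho> assume f: "(\<Sum>k. nh k \<rho>) \<noteq> \<infinity>"
      show "\<exists>k. halted (run k \<rho> \<sigma>)"
      proof (rule ccontr)
        assume "\<nexists>k. halted (run k \<rho> \<sigma>)"
        hence "nh k \<rho> = 1" for k by (simp add: nh_def)
        hence "(\<Sum>k. nh k \<rho>) = (SUP N. of_nat N)" by (simp add: suminf_eq_SUP)
        also have "\<dots> = \<infinity>" by (simp add: ennreal_SUP_of_nat_eq_top)
        finally show False using f by simp
      qed
    qed
  qed
  have right: "AE \<rho> in coin_space. halted (run N \<rho> \<sigma>) \<longrightarrow> (snd (run N \<rho> \<sigma>) ''out'' 0 \<noteq> 0 \<longleftrightarrow> answer)" for N
  proof -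
    define bad where "bad = (\<lambda>\<rho>. of_bool (halted (run N \<rho> \<sigma>) \<and> w 1 (run N \<rho> \<sigma>) \<noteq> 0) :: ennreal)"
    have badm [measurable]: "bad \<in> borel_measurable coin_space"
      unfolding bad_def by (rule measurable_comp_run)
    define x where "x = (\<integral>\<^sup>+\<rho>. bad \<rho> \<partial>coin_space)"
    \<comment> \<open>Here \<open>x\<close> is the probability of having halted with a wrong answer
      by time \<open>N\<close>. The reward \<open>n\<close> for such answers contributes
      \<open>n * x\<close>, and \<open>V\<close> does not depend on \<open>n\<close>.\<close>
    have B: "of_nat n * x \<le> ennreal V" for n
    proof -
      have "of_nat n * x = (\<integral>\<^sup>+\<rho>. of_nat n * bad \<rho> \<partial>coin_space)"
        unfolding x_def by (rule nn_integral_cmult[symmetric]) simp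
      also have "\<dots> \<le> (\<integral>\<^sup>+\<rho>. (\<Sum>k<N. nh k \<rho>) + ennreal (if halted (run N \<rho> \<sigma>) then w (real n) (run N \<rho> \<sigma>) else 0) \<partial>coin_space)"
        by (rule nn_integral_mono)
           (auto simp: bad_def w_def ennreal_of_nat_eq_real_of_nat intro: add_increasing)
      also have "\<dots> \<le> ennreal V" by (rule part) simp
      finally show ?thesis .
    qed
    have "x = 0"
    proof (rule ccontr)
      assume "x \<noteq> 0"
      have "x \<noteq> \<infinity>" using B[of 1] by (auto simp: top_unique)
      then obtain y where y: "x = ennreal y" "y > 0"
        using \<open>x \<noteq> 0\<close> by (cases x) (auto simp: ennreal_eq_0_iff not_le)
      obtain n where "V / y < real n" using reals_Archimedean2 by blast
      hence "V < real n * y" using y by (simp add: field_simps)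
      moreover have "ennreal (real n * y) \<le> ennreal V"
        using B[of n] y by (simp add: ennreal_mult ennreal_of_nat_eq_real_of_nat)
      ultimately show False using V0 by (simp add: ennreal_le_iff)
    qed
    hence "AE \<rho> in coin_space. bad \<rho> = 0" unfolding x_def by (subst (asm) nn_integral_0_iff_AE) auto
    thus ?thesis by (rule AE_mp) (auto simp: bad_def w_def)
  qed
  hence "AE \<rho> in coin_space. \<forall>N. halted (run N \<rho> \<sigma>) \<longrightarrow> (snd (run N \<rho> \<sigma>) ''out'' 0 \<noteq> 0 \<longleftrightarrow> answer)"
    by (subst AE_all_countable) blast
  with halts show "decides \<sigma> answer"
    unfolding decides_def by eventually_elim blast
qed

subsection \<open>Sizes and space\<close>

lemma int_size_le_Suc_iff: "int_size x \<le> Suc k \<longleftrightarrow> \<bar>x\<bar> < 2 ^ k"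
  using bitlen_le_iff_power[of "\<bar>x\<bar>" "int k"] by (simp add: int_size_def nat_le_iff)

lemma int_size_ge_1: "1 \<le> int_size x"
  by (simp add: int_size_def)

lemma abs_less_int_size: "\<bar>x\<bar> < 2 ^ (int_size x - 1)"
  using int_size_le_Suc_iff[of x "int_size x - 1"] int_size_ge_1[of x] by simp

lemma int_size_mono: "\<bar>x\<bar> \<le> \<bar>y\<bar> \<Longrightarrow> int_size x \<le> int_size y"
  using int_size_le_Suc_iff[of x "int_size y - 1"] int_size_ge_1[of y] abs_less_int_size[of y] by simp

lemma int_size_of_bool: "int_size (of_bool P) \<le> 2"
  using int_size_le_Suc_iff[of "of_bool P" 1] by (cases P) (simp_all add: numeral_2_eq_2)

text \<open>Weaker than the maximum plus one, but of the same form as the bound for products, so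
  that \<open>int_size_binop\<close> can treat all operators alike.\<close>

lemma int_size_add: "int_size (a + b) \<le> int_size a + int_size b"
proof -
  define i j where "i = int_size a - 1" and "j = int_size b - 1"
  have ij: "int_size a = Suc i" "int_size b = Suc j" 
    using int_size_ge_1[of a] int_size_ge_1[of b] by (simp_all add: i_def j_def)
  have "\<bar>a\<bar> < 2 ^ i" "\<bar>b\<bar> < 2 ^ j" using abs_less_int_size by (simp_all add: i_def j_def)
  hence "\<bar>a\<bar> + 1 \<le> 2 ^ i" "\<bar>b\<bar> + 1 \<le> 2 ^ j" by simp_all
  hence "(\<bar>a\<bar> + 1) * (\<bar>b\<bar> + 1) \<le> 2 ^ i * 2 ^ j" by (intro mult_mono) auto
  moreover have "\<bar>a + b\<bar> < (\<bar>a\<bar> + 1) * (\<bar>b\<bar> + 1)"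
  proof -
    have "(\<bar>a\<bar> + 1) * (\<bar>b\<bar> + 1) = \<bar>a\<bar> * \<bar>b\<bar> + \<bar>a\<bar> + \<bar>b\<bar> + 1" by (simp add: algebra_simps)
    thus ?thesis using abs_triangle_ineq[of a b] mult_nonneg_nonneg[of "\<bar>a\<bar>" "\<bar>b\<bar>"] by linarith
  qed
  ultimately have "\<bar>a + b\<bar> < 2 ^ (i + j)" unfolding power_add by (rule less_le_trans[rotated])
  hence "int_size (a + b) \<le> Suc (i + j)" by (simp add: int_size_le_Suc_iff)
  thus ?thesis by (simp add: ij)
qed

lemma int_size_mult: "int_size (a * b) \<le> int_size a + int_size b"
proof -
  define i j where "i = int_size a - 1" and "j = int_size b - 1"
  have ij: "int_size a = Suc i" "int_size b = Suc j" 
    using int_size_ge_1[of a] int_size_ge_1[of b] by (simp_all add: i_def j_def)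
  have "\<bar>a\<bar> < 2 ^ i" "\<bar>b\<bar> < 2 ^ j" using abs_less_int_size by (simp_all add: i_def j_def)
  hence "\<bar>a\<bar> * \<bar>b\<bar> < 2 ^ i * 2 ^ j" by (intro mult_strict_mono') auto
  hence "\<bar>a * b\<bar> < 2 ^ (i + j)" by (simp add: abs_mult power_add)
  hence "int_size (a * b) \<le> Suc (i + j)" by (simp add: int_size_le_Suc_iff)
  thus ?thesis by (simp add: ij)
qed

lemma abs_div_le: "\<bar>a div b\<bar> \<le> \<bar>a :: int\<bar>"
proof (cases "b = 0")
  case False
  have "\<bar>a div b\<bar> \<le> \<bar>a\<bar>" if "b > 0" for a b :: int
  proof (cases "a \<ge> 0")
    case True
    have "a div b \<le> a" using True that zdiv_mono2[of a 1 b] by simp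
    thus ?thesis using True that by (simp add: pos_imp_zdiv_nonneg_iff)
  next
    case False
    have "a * b \<le> a" using False that mult_left_mono_neg[of 1 b a] by simp
    hence "a * b div b \<le> a div b" using that by (intro zdiv_mono1)
    moreover have "a div b \<le> 0" using False that div_nonpos_pos_le0[of a b] by simp
    ultimately show ?thesis using that by simp
  qed
  from this[of b a] this[of "-b" "-a"] False show ?thesis
    by (cases "b > 0") auto
qed simp

text \<open>The maximum covers \<open>b = 0\<close>, where \<open>a mod 0 = a\<close>.\<close>

lemma abs_mod_le: "\<bar>a mod b\<bar> \<le> max \<bar>a\<bar> \<bar>b :: int\<bar>"
proof (cases "b = 0")
  case False
  thus ?thesis using abs_mod_less[of b a] by simp
qed simp

lemma int_size_binop: "int_size (apply_binop f a b) \<le> int_size a + int_size b"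
proof (cases f)
  case Minus
  thus ?thesis using int_size_add[of a "-b"] int_size_mono[of "-b" b] by simp
next
  case Div
  thus ?thesis using int_size_mono[OF abs_div_le[of a b]] by simp
next
  case Mod
  have "int_size (a mod b) \<le> max (int_size a) (int_size b)"
    using abs_mod_le[of a b] int_size_mono[of "a mod b" a] int_size_mono[of "a mod b" b]
    by (auto simp: max_def split: if_splits)
  thus ?thesis using Mod by simp
next
  case Less
  have "int_size (of_bool (a < b)) \<le> int_size a + int_size b"
    using int_size_of_bool[of "a < b"] int_size_ge_1[of a] int_size_ge_1[of b] by linarith
  thus ?thesis using Less by simp
next
  case Eq
  have "int_size (of_bool (a = b)) \<le> int_size a + int_size b"
    using int_size_of_bool[of "a = b"] int_size_ge_1[of a] int_size_ge_1[of b] by linarith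
  thus ?thesis using Eq by simp
qed (simp_all add: int_size_add int_size_mult)

text \<open>Multiplied by the cell length \<open>W\<close>, this bounds the length of the value of
  an expression. The cost adds such lengths over all nodes, which leads to the square in
  \<open>expr_cost_le\<close>.\<close>

primrec expr_weight :: "expr \<Rightarrow> nat" where
  "expr_weight (Const k) = int_size k"
| "expr_weight (Read x e) = Suc (expr_weight e)"
| "expr_weight (Bin f e1 e2) = Suc (expr_weight e1 + expr_weight e2)"

lemma int_size_eval_le:
  assumes "\<And>x i. int_size (m x i) \<le> W"
  shows "int_size (eval_expr m e) \<le> expr_weight e * W"
proof (induction e)
  case (Const k)
  have "1 \<le> W" using assms[of undefined undefined] int_size_ge_1 order_trans by blast
  thus ?case by simp
next
  case (Read x e)
  thus ?case using assms[of x "eval_expr m e"] by (simp add: trans_le_add1)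
next
  case (Bin f e1 e2)
  thus ?case using int_size_binop[of f "eval_expr m e1" "eval_expr m e2"] by (simp add: algebra_simps)
qed

lemma expr_cost_le:
  assumes "\<And>x i. int_size (m x i) \<le> W"
  shows "expr_cost m e \<le> expr_weight e ^ 2 * W"
proof (induction e)
  case (Const k)
  have "1 \<le> W" using assms[of undefined undefined] int_size_ge_1 order_trans by blast
  hence "int_size k * 1 * 1 \<le> int_size k * int_size k * W" using int_size_ge_1[of k]
    by (intro mult_mono) auto
  thus ?case by (simp add: power2_eq_square)
next
  case (Read x e)
  have "expr_cost m (Read x e) \<le> expr_weight e ^ 2 * W + W"
    using Read assms[of x "eval_expr m e"] by simp
  also have "\<dots> \<le> (Suc (expr_weight e)) ^ 2 * W" by (simp add: power2_eq_square algebra_simps)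
  finally show ?case by simp
next
  case (Bin f e1 e2)
  have "int_size (apply_binop f (eval_expr m e1) (eval_expr m e2)) \<le> (expr_weight e1 + expr_weight e2) * W"
    using int_size_binop[of f "eval_expr m e1" "eval_expr m e2"]
      int_size_eval_le[where m = m and e = e1, OF assms] int_size_eval_le[where m = m and e = e2, OF assms] by (simp add: algebra_simps)
  hence "expr_cost m (Bin f e1 e2) \<le>
      expr_weight e1 ^ 2 * W + expr_weight e2 ^ 2 * W + (expr_weight e1 + expr_weight e2) * W"
    using Bin by simp
  also have "\<dots> \<le> (Suc (expr_weight e1 + expr_weight e2)) ^ 2 * W"
    by (simp add: power2_eq_square algebra_simps)
  finally show ?case by simp
qed

text \<open>Monotone under subterms. Every command still to be executed is a subterm of the program,
  so the weight of the program bounds the expressions of every step.\<close>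

primrec com_weight :: "com \<Rightarrow> nat" where
  "com_weight Skip = 0"
| "com_weight (Assign x i e) = expr_weight i + expr_weight e"
| "com_weight (Flip x i) = expr_weight i"
| "com_weight (Seq c1 c2) = com_weight c1 + com_weight c2"
| "com_weight (Cond e c1 c2) = expr_weight e + com_weight c1 + com_weight c2"
| "com_weight (While e c) = expr_weight e + com_weight c"

lemma step_com_weight:
  "\<forall>c\<in>set cs. com_weight c \<le> Z \<Longrightarrow> \<forall>c\<in>set (fst (step r (cs, m))). com_weight c \<le> Z"
  by (cases "(r, (cs, m))" rule: step.cases) auto

lemma run_com_weight:
  "\<forall>c\<in>set cs. com_weight c \<le> Z \<Longrightarrow> \<forall>c\<in>set (fst (run k \<rho> (cs, m))). com_weight c \<le> Z"
proof (induction k arbitrary: \<rho> cs m)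
  case (Suc k)
  obtain cs' m' where e: "step (shd \<rho>) (cs, m) = (cs', m')" by fastforce
  with step_com_weight[OF Suc.prems, of "shd \<rho>" m] have "\<forall>c\<in>set cs'. com_weight c \<le> Z" by simp
  from Suc.IH[OF this] show ?case using e by simp
qed simp

definition small_mem :: "nat \<Rightarrow> (vname \<times> int) set \<Rightarrow> mem \<Rightarrow> bool" where
  "small_mem W A m \<longleftrightarrow> (\<forall>x i. int_size (m x i) \<le> W \<and> (m x i \<noteq> 0 \<longrightarrow> (x, i) \<in> A))"

lemma small_mem_update:
  "small_mem W A m \<Longrightarrow> int_size v \<le> W \<Longrightarrow> (x, i) \<in> A \<Longrightarrow> small_mem W A (update m x i v)"
  by (auto simp: small_mem_def update_def)

lemma mem_size_le:
  assumes "small_mem W A m" "finite A" "\<And>x i. (x, i) \<in> A \<Longrightarrow> int_size i \<le> W"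
  shows "mem_size m \<le> card A * (2 * W)"
proof -
  have sub: "cells m \<subseteq> A" using assms by (auto simp: cells_def small_mem_def)
  have "mem_size m \<le> (\<Sum>(x, i)\<in>cells m. 2 * W)"
    unfolding mem_size_def
  proof (rule sum_mono, clarify)
    fix x i assume "(x, i) \<in> cells m"
    hence "int_size i \<le> W" using sub assms by auto
    moreover have "int_size (m x i) \<le> W" using assms by (auto simp: small_mem_def)
    ultimately show "int_size i + int_size (m x i) \<le> 2 * W" by simp
  qed
  also have "\<dots> = card (cells m) * (2 * W)" by (simp add: split_def)
  also have "\<dots> \<le> card A * (2 * W)" using sub assms by (intro mult_right_mono card_mono) auto
  finally show ?thesis .
qed

lemma step_cost_le:
  assumes "small_mem W A m" "\<forall>c\<in>set cs. com_weight c \<le> Z"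
  shows "step_cost (cs, m) \<le> 1 + Z ^ 2 * W"
proof -
  have c: "expr_cost m e \<le> expr_weight e ^ 2 * W" for e
    using assms(1) by (intro expr_cost_le) (auto simp: small_mem_def)
  have le: "expr_cost m e \<le> Z ^ 2 * W" if "expr_weight e \<le> Z" for e
  proof -
    have "expr_weight e ^ 2 * W \<le> Z ^ 2 * W" using that by (intro mult_right_mono power_mono) auto
    thus ?thesis using c[of e] by linarith
  qed
  have le2: "expr_cost m e + expr_cost m e' \<le> Z ^ 2 * W" if "expr_weight e + expr_weight e' \<le> Z" for e e'
  proof -
    have "(expr_weight e) ^ 2 + expr_weight e' ^ 2 \<le> (expr_weight e + expr_weight e') ^ 2"
      by (simp add: power2_sum)
    also have "\<dots> \<le> Z ^ 2" using that by (intro power_mono) auto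
    finally have "((expr_weight e) ^ 2 + expr_weight e' ^ 2) * W \<le> Z ^ 2 * W" by (rule mult_right_mono) simp
    thus ?thesis using c[of e] c[of e'] by (simp add: distrib_right)
  qed
  show ?thesis using assms(2)
    by (cases "(cs, m)" rule: step_cost.cases) (auto intro: le le2 simp: add.assoc)
qed

text \<open>
  Assignments that reduce their value modulo the cell \<open>''G''\<close> keep the memory small, whatever the
  rest of the program does.
\<close>

primrec guarded :: "vname set \<Rightarrow> com \<Rightarrow> bool" where
  "guarded V Skip = True"
| "guarded V (Assign x i e) =
     (x \<in> V \<and> i = Const 0 \<and> (\<exists>e'. e = Bin binop.Mod e' (Read ''G'' (Const 0))))"
| "guarded V (Flip x i) = (x \<in> V \<and> i = Const 0)"
| "guarded V (Seq c1 c2) = (guarded V c1 \<and> guarded V c2)"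
| "guarded V (Cond e c1 c2) = (guarded V c1 \<and> guarded V c2)"
| "guarded V (While e c) = guarded V c"

lemma step_guarded:
  assumes "\<forall>c\<in>set cs. guarded V c" "small_mem W A m" "m ''G'' 0 > 0" "''G'' \<notin> V"
    "V \<times> {0} \<subseteq> A" "W \<ge> 2" "step r (cs, m) = (cs', m')"
  shows "(\<forall>c\<in>set cs'. guarded V c) \<and> small_mem W A m' \<and> m' ''G'' 0 > 0"
proof -
  have "int_size (m ''G'' 0) \<le> W" using assms by (auto simp: small_mem_def)
  hence "int_size (v mod m ''G'' 0) \<le> W" for v
  proof -
    have "\<bar>v mod m ''G'' 0\<bar> \<le> \<bar>m ''G'' 0\<bar>"
      using abs_mod_less[of "m ''G'' 0" v] assms(3) by linarith
    from int_size_mono[OF this] show ?thesis using \<open>int_size (m ''G'' 0) \<le> W\<close> by (rule order_trans)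
  qed
  moreover have "int_size 1 \<le> W" "int_size 0 \<le> W" using assms int_size_of_bool[of True] int_size_of_bool[of False]
    by simp_all
  ultimately show ?thesis
    using assms by (cases "(r, (cs, m))" rule: step.cases)
      (auto intro!: small_mem_update[unfolded update_def] simp: update_def split: if_splits)
qed

lemma run_guarded:
  assumes "\<forall>c\<in>set cs. guarded V c" "small_mem W A m" "m ''G'' 0 > 0" "''G'' \<notin> V"
    "V \<times> {0} \<subseteq> A" "W \<ge> 2"
  shows "small_mem W A (snd (run k \<rho> (cs, m)))"
  using assms(1-3)
proof (induction k arbitrary: \<rho> cs m)
  case (Suc k)
  obtain cs' m' where e: "step (shd \<rho>) (cs, m) = (cs', m')" by fastforce
  from step_guarded[OF Suc.prems assms(4-6) e] Suc.IH[of cs' m'] show ?case using e by simp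
qed simp

text \<open>The command \<open>c1\<close>, which computes \<open>''G''\<close>, is controlled by its
  \<open>wp\<close> proof. From then on the syntactic condition on \<open>c2\<close> suffices, also
  along runs that never halt.\<close>

lemma run_small_mem:
  assumes "wp (small_mem W A) c1 T (\<lambda>m'. small_mem W A m' \<and> m' ''G'' 0 > 0) m"
    and "small_mem W A m" "guarded V c2" "''G'' \<notin> V" "V \<times> {0} \<subseteq> A" "W \<ge> 2"
  shows "small_mem W A (snd (run k \<rho> ([Seq c1 c2], m)))"
proof (cases k)
  case (Suc k')
  from assms(1) obtain t m' where 1: "small_mem W A m'" "m' ''G'' 0 > 0"
    "\<And>cs \<rho>. run t \<rho> (c1 # cs, m) = (cs, m')"
    "\<And>cs \<rho> k. k < t \<Longrightarrow> small_mem W A (snd (run k \<rho> (c1 # cs, m)))"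
    unfolding wp_def by blast
  show ?thesis
  proof (cases "k' < t")
    case False
    then obtain k'' where "k' = t + k''" using le_Suc_ex[of t k'] by auto
    thus ?thesis using Suc run_guarded[of "[c2]", OF _ 1(1,2) assms(4-6)] assms(3)
      by (simp add: run_add 1)
  qed (use Suc 1 in simp)
qed (use assms in simp)

subsection \<open>Polynomial bounds\<close>

text \<open>Natural coefficients make these functions monotone, which allows arguments to be
  replaced by upper bounds (\<open>is_poly_mono\<close>).\<close>

definition is_poly :: "(nat \<Rightarrow> nat) \<Rightarrow> bool" where
  "is_poly f \<longleftrightarrow> (\<exists>p. \<forall>x. f x = poly p x)"

lemma is_poly_const: "is_poly (\<lambda>_. c)"
  unfolding is_poly_def by (rule exI[of _ "[:c:]"]) simp

lemma is_poly_id: "is_poly (\<lambda>x. x)"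
  unfolding is_poly_def by (rule exI[of _ "[:0, 1:]"]) simp

lemma is_poly_add: "is_poly f \<Longrightarrow> is_poly g \<Longrightarrow> is_poly (\<lambda>x. f x + g x)"
  unfolding is_poly_def by (metis poly_add)

lemma is_poly_mult: "is_poly f \<Longrightarrow> is_poly g \<Longrightarrow> is_poly (\<lambda>x. f x * g x)"
  unfolding is_poly_def by (metis poly_mult)

lemma is_poly_power: "is_poly f \<Longrightarrow> is_poly (\<lambda>x. f x ^ n)"
  unfolding is_poly_def by (metis poly_power)

lemma is_poly_Suc: "is_poly f \<Longrightarrow> is_poly (\<lambda>x. Suc (f x))"
  using is_poly_add[OF _ is_poly_const[of 1], of f] by simp

lemma is_poly_compose: "is_poly f \<Longrightarrow> is_poly g \<Longrightarrow> is_poly (\<lambda>x. f (g x))"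
  unfolding is_poly_def by (metis poly_pcompose)

lemmas is_poly_intros = is_poly_const is_poly_id is_poly_add is_poly_mult is_poly_power is_poly_Suc

subsection \<open>From inequalities to equations\<close>

lemma div_power_2_Suc: "(x :: int) div 2 ^ k \<le> 2 * (x div 2 ^ Suc k) + 1"
proof -
  have "x div 2 ^ Suc k = x div 2 ^ k div 2"
    using zdiv_zmult2_eq[of 2 x "2 ^ k"] by (simp add: mult.commute)
  moreover have "y \<le> 2 * (y div 2) + 1" for y :: int by presburger
  ultimately show ?thesis by metis
qed

text \<open>
  Rounding all weights to multiples of \<open>2 ^ k\<close>: at the largest \<open>k\<close> where the rounded sum still
  reaches the rounded bound, it exceeds that bound by at most the number of summands.
\<close>

lemma sum_ge_iff_rounded:
  fixes w :: "'a \<Rightarrow> int"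
  assumes "finite X" "card X \<le> n" "(\<Sum>x\<in>X. w x div 2 ^ L) \<le> 0" "(-T) div 2 ^ L \<le> 0"
  shows "(\<Sum>x\<in>X. w x) \<ge> T \<longleftrightarrow>
    (\<exists>k\<le>L. \<exists>j\<le>n. (\<Sum>x\<in>X. w x div 2 ^ k) = - ((-T) div 2 ^ k) + int j)"
proof
  assume "\<exists>k\<le>L. \<exists>j\<le>n. (\<Sum>x\<in>X. w x div 2 ^ k) = - ((-T) div 2 ^ k) + int j"
  then obtain k j where kj: "(\<Sum>x\<in>X. w x div 2 ^ k) = - ((-T) div 2 ^ k) + int j" by blast
  have d: "(y div 2 ^ k) * 2 ^ k \<le> y" for y :: int
  proof -
    have "0 \<le> y mod 2 ^ k" by simp
    thus ?thesis using div_mult_mod_eq[of y "2 ^ k"] by linarith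
  qed
  have "T \<le> - ((-T) div 2 ^ k) * 2 ^ k" using d[of "-T"] by simp
  also have "\<dots> \<le> (\<Sum>x\<in>X. w x div 2 ^ k) * 2 ^ k" unfolding kj by (intro mult_right_mono) auto
  also have "\<dots> = (\<Sum>x\<in>X. (w x div 2 ^ k) * 2 ^ k)" by (simp add: sum_distrib_right)
  also have "\<dots> \<le> (\<Sum>x\<in>X. w x)" by (intro sum_mono d)
  finally show "(\<Sum>x\<in>X. w x) \<ge> T" .
next
  assume ge: "(\<Sum>x\<in>X. w x) \<ge> T"
  \<comment> \<open>The sum of the weights rounded down minus the bound rounded up:
    \<open>- ((-T) div 2 ^ k)\<close> is a ceiling.\<close>
  define D where "D = (\<lambda>k. (\<Sum>x\<in>X. w x div 2 ^ k) + (-T) div 2 ^ k)"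
  define k where "k = Max {k. k \<le> L \<and> D k \<ge> 0}"
  have fin: "finite {k. k \<le> L \<and> D k \<ge> 0}" by simp
  have "0 \<in> {k. k \<le> L \<and> D k \<ge> 0}" using ge by (simp add: D_def)
  hence "k \<in> {k. k \<le> L \<and> D k \<ge> 0}" unfolding k_def by (intro Max_in[OF fin]) blast
  hence k: "k \<le> L" "D k \<ge> 0" by auto
  have "D k \<le> int n"
  proof (cases "k = L")
    case True
    thus ?thesis using assms by (simp add: D_def)
  next
    case False
    have "\<not> D (Suc k) \<ge> 0"
    proof
      assume "D (Suc k) \<ge> 0"
      hence "Suc k \<in> {k. k \<le> L \<and> D k \<ge> 0}" using False k(1) by simp
      from Max_ge[OF fin this] have "Suc k \<le> k" unfolding k_def .
      thus False by simp
    qed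
    \<comment> \<open>Refining the rounding by one bit doubles the difference up to an error of one
      per summand and one for the bound. By maximality of \<open>k\<close>, \<open>D (Suc k)\<close>
      is at most -1, so that \<open>D k \<le> n - 1\<close>.\<close>
    moreover have "D k \<le> 2 * D (Suc k) + int n + 1"
    proof -
      have "(\<Sum>x\<in>X. w x div 2 ^ k) \<le> (\<Sum>x\<in>X. 2 * (w x div 2 ^ Suc k) + 1)"
        by (intro sum_mono div_power_2_Suc)
      also have "\<dots> = 2 * (\<Sum>x\<in>X. w x div 2 ^ Suc k) + int (card X)"
        by (simp add: sum.distrib sum_distrib_left)
      finally have 1: "(\<Sum>x\<in>X. w x div 2 ^ k) \<le> 2 * (\<Sum>x\<in>X. w x div 2 ^ Suc k) + int (card X)" .
      have "a + d \<le> 2 * (b + e) + int n + 1"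
        if "a \<le> 2 * b + int c" "d \<le> 2 * e + 1" "c \<le> n" for a b d e :: int and c
      proof -
        have "int c \<le> int n" using that(3) by simp
        hence "a + d \<le> 2 * b + int n + (2 * e + 1)" using that(1,2) by (intro add_mono) simp_all
        thus ?thesis by (simp add: algebra_simps)
      qed
      from this[OF 1 div_power_2_Suc assms(2)] show ?thesis unfolding D_def .
    qed
    ultimately show ?thesis by simp
  qed
  hence "nat (D k) \<le> n" "(\<Sum>x\<in>X. w x div 2 ^ k) = - ((-T) div 2 ^ k) + int (nat (D k))"
    using k by (auto simp: D_def)
  with k show "\<exists>k\<le>L. \<exists>j\<le>n. (\<Sum>x\<in>X. w x div 2 ^ k) = - ((-T) div 2 ^ k) + int j" by blast
qed

section \<open>Carries and rounding losses of sums; counting prime divisors\<close>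

lemma sum_mod_eq:
  fixes w :: "'a \<Rightarrow> int"
  assumes "finite X" "c > 0"
  obtains r where "r \<le> card X" "(\<Sum>x\<in>X. w x mod c) = (\<Sum>x\<in>X. w x) mod c + int r * c"
proof -
  define s where "s = (\<Sum>x\<in>X. w x mod c)"
  have s0: "0 \<le> s" unfolding s_def using assms by (intro sum_nonneg) auto
  have "s \<le> (\<Sum>x\<in>X. c)" unfolding s_def using assms by (intro sum_mono) (simp add: less_imp_le)
  hence "s \<le> int (card X) * c" by simp
  hence "s div c \<le> int (card X)" using assms zdiv_mono1[of s "int (card X) * c" c] by simp
  moreover have "s div c \<ge> 0" using s0 assms by (simp add: pos_imp_zdiv_nonneg_iff)
  moreover have "s mod c = (\<Sum>x\<in>X. w x) mod c" unfolding s_def by (rule mod_sum_eq)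
  hence "s = (\<Sum>x\<in>X. w x) mod c + (s div c) * c" by (metis add.commute div_mult_mod_eq)
  ultimately show ?thesis by (intro that[of "nat (s div c)"]) (auto simp: s_def)
qed

text \<open>What rounding each summand loses against rounding the sum is the carry of the residues
  in \<open>sum_mod_eq\<close>.\<close>

lemma sum_div_eq:
  fixes w :: "'a \<Rightarrow> int"
  assumes "finite X" "c > 0"
  obtains r where "r \<le> card X" "(\<Sum>x\<in>X. w x div c) = (\<Sum>x\<in>X. w x) div c - int r"
proof -
  from sum_mod_eq[OF assms, of w] obtain r where r: "r \<le> card X"
    "(\<Sum>x\<in>X. w x mod c) = (\<Sum>x\<in>X. w x) mod c + int r * c" .
  have "c * (\<Sum>x\<in>X. w x div c) = (\<Sum>x\<in>X. w x) - (\<Sum>x\<in>X. w x mod c)"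
    by (simp add: sum_distrib_left minus_mod_eq_mult_div flip: sum_subtractf)
  also have "\<dots> = c * ((\<Sum>x\<in>X. w x) div c) - int r * c"
    unfolding r minus_mod_eq_mult_div[symmetric] by simp
  finally have "c * (\<Sum>x\<in>X. w x div c) = c * ((\<Sum>x\<in>X. w x) div c - int r)" by (simp add: algebra_simps)
  thus ?thesis using assms r(1) by (intro that[of r]) simp_all
qed

text \<open>The distinct prime divisors are at least 2 each, and their product is at most
  \<open>\<bar>x\<bar>\<close>.\<close>

lemma card_prime_divisors_le:
  fixes x :: int
  assumes "x \<noteq> 0" "\<bar>x\<bar> < 2 ^ L"
  shows "finite {q :: nat. prime q \<and> int q dvd x}" "card {q :: nat. prime q \<and> int q dvd x} \<le> L"
proof -
  define y where "y = nat \<bar>x\<bar>"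
  have y: "y \<noteq> 0" "y < 2 ^ L" using assms by (auto simp: y_def nat_less_iff)
  have e: "{q :: nat. prime q \<and> int q dvd x} = prime_factors y"
    using y by (auto simp: y_def in_prime_factors_iff nat_dvd_iff int_dvd_int_iff nat_abs_dvd_iff[symmetric])
  thus "finite {q :: nat. prime q \<and> int q dvd x}" by simp
  have "2 ^ card (prime_factors y) = (\<Prod>q\<in>prime_factors y. (2::nat))" by simp
  also have "\<dots> \<le> (\<Prod>q\<in>prime_factors y. q ^ multiplicity q y)"
  proof (rule prod_mono, safe)
    fix q assume q: "q \<in> prime_factors y"
    hence "multiplicity q y > 0" "prime q" using y by (auto simp: prime_factors_multiplicity)
    hence "q \<ge> 2" by (simp add: prime_ge_2_nat)
    moreover from this have "q \<le> q ^ multiplicity q y"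
      using power_increasing[of 1 "multiplicity q y" q] \<open>multiplicity q y > 0\<close> by simp
    ultimately show "2 \<le> q ^ multiplicity q y" by (rule order_trans)
  qed
  also have "\<dots> = y" using prod_prime_factors[OF y(1)] by simp
  also note y(2)
  finally show "card {q :: nat. prime q \<and> int q dvd x} \<le> L" unfolding e
    by (subst (asm) power_strict_increasing_iff) auto
qed

subsection \<open>Extracting coefficients\<close>

text \<open>Discrete Fourier extraction: after exchanging the sums, orthogonality removes every
  exponent not divisible by \<open>q - 1\<close>.\<close>

lemma sum_teichmueller_coeffs:
  fixes F :: "'a \<Rightarrow> int" and ex :: "'a \<Rightarrow> nat"
  assumes "prime q" "finite A"
  shows "[(\<Sum>x\<in>{1..<q}. \<Sum>X\<in>A. F X * (int x ^ (q ^ J)) ^ ex X) =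
    (int q - 1) * (\<Sum>X | X \<in> A \<and> (q - 1) dvd ex X. F X)] (mod int q ^ Suc J)"
proof -
  have "(\<Sum>x\<in>{1..<q}. \<Sum>X\<in>A. F X * (int x ^ (q ^ J)) ^ ex X) =
      (\<Sum>X\<in>A. F X * (\<Sum>x\<in>{1..<q}. (int x ^ (q ^ J)) ^ ex X))"
    by (subst sum.swap) (simp add: sum_distrib_left)
  also have "[\<dots> = (\<Sum>X\<in>A. F X * (if (q - 1) dvd ex X then int q - 1 else 0))] (mod int q ^ Suc J)"
    by (intro cong_sum cong_mult sum_teichmueller_powers assms) simp
  also have "(\<Sum>X\<in>A. F X * (if (q - 1) dvd ex X then int q - 1 else 0)) =
      (\<Sum>X\<in>A. if (q - 1) dvd ex X then F X * (int q - 1) else 0)" by (intro sum.cong) auto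
  also have "\<dots> = (int q - 1) * (\<Sum>X | X \<in> A \<and> (q - 1) dvd ex X. F X)"
    using assms(2) by (simp add: sum.inter_filter[symmetric] sum_distrib_left mult.commute)
  finally show ?thesis .
qed

text \<open>A generating function in \<open>w\<close> of powers of the deviation from
  \<open>v\<close>, with the sum of residues as exponent. The offset \<open>s\<close> moves the
  class to be extracted to the exponents divisible by \<open>q - 1\<close>.\<close>

definition moment :: "nat \<Rightarrow> int \<Rightarrow> (nat \<Rightarrow> int) \<Rightarrow> int \<Rightarrow> nat \<Rightarrow> nat \<Rightarrow> nat set \<Rightarrow> int" where
  "moment c w a v s q A =
     (\<Sum>X\<in>Pow A. ((\<Sum>e\<in>X. a e) - v) ^ c * w ^ (s + (\<Sum>e\<in>X. nat (a e mod int q))))"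

lemma moment_empty: "moment c w a v s q {} = (-v) ^ c * w ^ s"
  by (simp add: moment_def)

lemma sum_Pow_insert:
  assumes "finite A" "x \<notin> A"
  shows "(\<Sum>X\<in>Pow (insert x A). f X) = (\<Sum>X\<in>Pow A. f X) + (\<Sum>X\<in>Pow A. f (insert x X))"
proof -
  have "inj_on (insert x) (Pow A)" using assms by (auto simp: inj_on_def)
  moreover have "Pow A \<inter> insert x ` Pow A = {}" using assms by auto
  ultimately show ?thesis using assms
    by (simp add: Pow_insert sum.union_disjoint sum.reindex)
qed

text \<open>Adding \<open>x\<close> to a set shifts its deviation by \<open>a x\<close> and
  multiplies its weight by \<open>y\<close>; the rest is the binomial expansion. Order 2 draws on
  order 1, which is why the program keeps three values; with them a sum over all subsets takes one
  update per item.\<close>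

lemma moment_insert:
  fixes a :: "nat \<Rightarrow> int" and w :: int and q :: nat
  assumes "finite A" "x \<notin> A"
  defines "y \<equiv> w ^ nat (a x mod int q)"
  shows "moment 0 w a v s q (insert x A) = moment 0 w a v s q A + y * moment 0 w a v s q A"
    and "moment 1 w a v s q (insert x A) = moment 1 w a v s q A +
           y * (moment 1 w a v s q A + a x * moment 0 w a v s q A)"
    and "moment 2 w a v s q (insert x A) = moment 2 w a v s q A +
           y * (moment 2 w a v s q A + 2 * a x * moment 1 w a v s q A + a x * a x * moment 0 w a v s q A)"
proof -
  have i: "(\<Sum>e\<in>insert x X. f e) = f x + (\<Sum>e\<in>X. f e)" if "X \<in> Pow A" for X and f :: "nat \<Rightarrow> 'b::comm_monoid_add"
    using that assms by (subst sum.insert) (auto intro: finite_subset)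
  define U where "U = (\<lambda>X. (\<Sum>e\<in>X. a e) - v)"
  define W where "W = (\<lambda>X. w ^ (s + (\<Sum>e\<in>X. nat (a e mod int q))))"
  have U: "U (insert x X) = a x + U X" and W: "W (insert x X) = y * W X" if "X \<in> Pow A" for X
    by (simp_all only: U_def W_def i[OF that]) (simp_all add: y_def power_add algebra_simps)
  have m: "moment c w a v s q A = (\<Sum>X\<in>Pow A. U X ^ c * W X)" for c
    by (simp add: moment_def U_def W_def)
  have "moment c w a v s q (insert x A) =
      moment c w a v s q A + (\<Sum>X\<in>Pow A. U (insert x X) ^ c * W (insert x X))" for c
    unfolding moment_def U_def W_def by (rule sum_Pow_insert[OF assms(1,2)])
  also have "(\<Sum>X\<in>Pow A. U (insert x X) ^ c * W (insert x X)) =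
      y * (\<Sum>X\<in>Pow A. (a x + U X) ^ c * W X)" for c
    unfolding sum_distrib_left by (intro sum.cong refl) (simp add: U W)
  finally have *: "moment c w a v s q (insert x A) =
      moment c w a v s q A + y * (\<Sum>X\<in>Pow A. (a x + U X) ^ c * W X)" for c .
  show "moment 0 w a v s q (insert x A) = moment 0 w a v s q A + y * moment 0 w a v s q A"
    unfolding * m by simp
  show "moment 1 w a v s q (insert x A) = moment 1 w a v s q A +
           y * (moment 1 w a v s q A + a x * moment 0 w a v s q A)"
    unfolding * m by (simp add: sum_distrib_left sum.distrib algebra_simps)
  show "moment 2 w a v s q (insert x A) = moment 2 w a v s q A +
           y * (moment 2 w a v s q A + 2 * a x * moment 1 w a v s q A + a x * a x * moment 0 w a v s q A)"
    unfolding * m by (simp add: sum_distrib_left sum.distrib power2_eq_square algebra_simps)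
qed

lemma sum_moment:
  assumes "prime q" "finite A"
  shows "[(\<Sum>x\<in>{1..<q}. moment c (int x ^ (q ^ J)) a v s q A) =
    (int q - 1) * (\<Sum>X | X \<in> Pow A \<and> (q - 1) dvd s + (\<Sum>e\<in>X. nat (a e mod int q)). ((\<Sum>e\<in>X. a e) - v) ^ c)]
    (mod int q ^ Suc J)"
  unfolding moment_def
  using sum_teichmueller_coeffs[OF assms(1), of "Pow A" "\<lambda>X. ((\<Sum>e\<in>X. a e) - v) ^ c" J
      "\<lambda>X. s + (\<Sum>e\<in>X. nat (a e mod int q))"] assms(2) by simp

text \<open>\<open>q - 1\<close> is invertible modulo \<open>q ^ J\<close> and \<open>y\<close> is
  smaller than the modulus. So a residue computed by the program tells whether the integer behind it
  is zero.\<close>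

lemma mult_pred_mod_prime_power_eq_0_iff:
  fixes y :: int
  assumes "prime q" "0 \<le> y" "y < int q ^ J"
  shows "((int q - 1) * y) mod int q ^ J = 0 \<longleftrightarrow> y = 0"
proof
  assume "((int q - 1) * y) mod int q ^ J = 0"
  hence "int q ^ J dvd (int q - 1) * y" by auto
  moreover have "coprime (int q) (int q - 1)" 
    by simp
  hence "coprime (int q ^ J) (int q - 1)" by simp
  ultimately have "int q ^ J dvd y" by (simp add: coprime_dvd_mult_right_iff)
  thus "y = 0" using assms zdvd_not_zless[of y "int q ^ J"] by (cases "y = 0") auto
qed simp

subsection \<open>The hashed instance\<close>

lemma add_2_le_power_2: "2 \<le> m \<Longrightarrow> m + 2 \<le> (2::nat) ^ m"
  by (induction m rule: dec_induct) auto

text \<open>The squares dominate \<open>\<bar>tt\<bar>\<close> and \<open>\<bar>bb\<bar>\<close> and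
  can be computed without a case distinction on signs.\<close>

locale instance_data =
  fixes n :: nat and om nv :: "nat \<Rightarrow> nat" and tt bb :: int and l :: nat
  assumes size: "tt ^ 2 + bb ^ 2 + (\<Sum>e\<in>{1..n}. int (om e) + int (nv e)) < 2 ^ l"
begin

text \<open>A single parameter that exceeds the number of items, all bit lengths and all digits of a
  query. The slack 16 pays for estimates such as \<open>pow_l_bound\<close>, \<open>h_bound\<close>
  and \<open>16 * h \<le> h * h\<close>.\<close>

definition "h = n + l + 16"

text \<open>
  The base \<open>h\<close> digits of a query \<open>z < h ^ 5\<close> are the two rounding exponents, the excesses over the
  two rounded bounds, and the carry that occurs when residues modulo \<open>q\<close> are added.  The factor
  \<open>4 * h\<close> keeps distinct sums so far apart that a wrong carry cannot identify them.
\<close>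

definition item :: "nat \<Rightarrow> nat \<Rightarrow> int" where
  "item z e = 4 * int h * ((int (om e) div 2 ^ (z mod h)) * 2 ^ h + (- int (nv e)) div 2 ^ (z div h mod h))"

text \<open>Both constraints are lower bounds here: on the sum of \<open>om\<close> by
  \<open>tt\<close>, and on the sum of the negated \<open>nv\<close> by \<open>- bb\<close>. The
  outer minus signs in front of \<open>div\<close> produce ceilings of these bounds.\<close>

definition goal :: "nat \<Rightarrow> int" where
  "goal z = 4 * int h * ((- ((-tt) div 2 ^ (z mod h)) + int (z div h ^ 2 mod h)) * 2 ^ h +
     (- (bb div 2 ^ (z div h mod h)) + int (z div h ^ 3 mod h)))"

text \<open>Minus the class sought, which is the residue of the goal plus the guessed carry, as a
  natural exponent: a set is in the class iff the shifted sum of its residues is divisible by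
  \<open>q - 1\<close>.\<close>

definition shift :: "nat \<Rightarrow> nat \<Rightarrow> nat" where
  "shift q z = nat ((- (goal z mod int q + int (z div h ^ 4))) mod (int q - 1))"

definition bin :: "nat \<Rightarrow> nat \<Rightarrow> nat set set" where
  "bin q z = {X \<in> Pow {1..n}. (q - 1) dvd shift q z + (\<Sum>e\<in>X. nat (item z e mod int q))}"

definition accepts :: "nat \<Rightarrow> nat \<Rightarrow> bool" where
  "accepts q z \<longleftrightarrow> bin q z \<noteq> {} \<and> (\<forall>X\<in>bin q z. (\<Sum>e\<in>X. item z e) = goal z)"

definition fails :: "nat \<Rightarrow> nat \<Rightarrow> bool" where
  "fails q z \<longleftrightarrow> (\<exists>X\<in>bin q z. (\<Sum>e\<in>X. item z e) \<noteq> goal z)"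

text \<open>The program can stop for such \<open>q\<close>: an accepting query contains a solution,
  and without a failing query every bin is empty or accepting, while a solution would lie in the bin
  for its carry.\<close>

definition conclusive :: "nat \<Rightarrow> bool" where
  "conclusive q \<longleftrightarrow> prime q \<and> ((\<exists>z<h ^ 5. accepts q z) \<or> \<not> (\<exists>z<h ^ 5. fails q z))"

definition feasible :: bool where
  "feasible \<longleftrightarrow> (\<exists>X\<subseteq>{1..n}. int (\<Sum>e\<in>X. nv e) \<le> bb \<and> int (\<Sum>e\<in>X. om e) \<ge> tt)"

definition num_pairs :: nat where
  "num_pairs = card {(\<Sum>e\<in>X. om e, \<Sum>e\<in>X. nv e) | X. X \<subseteq> {1..n}}"

section \<open>The packed equation and the size of its deviations\<close>

lemma h_pos: "h > 0" by (simp add: h_def)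

lemma n_less_h: "n < h" by (simp add: h_def)

lemma pow_l_bound: "2 * 2 ^ l + int h \<le> 2 ^ (h - 1)"
proof -
  have "h \<le> 2 ^ (h - 2)" using add_2_le_power_2[of "h - 2"] by (simp add: h_def)
  hence 1: "int h \<le> 2 ^ (h - 2)" by (metis of_nat_le_iff of_nat_numeral of_nat_power)
  have "(2::int) ^ Suc l \<le> 2 ^ (h - 2)" by (intro power_increasing) (auto simp: h_def)
  moreover have "(2::int) ^ (h - 1) = 2 ^ (h - 2) + 2 ^ (h - 2)"
    by (simp add: h_def flip: power_Suc mult_2)
  moreover have "(2::int) ^ Suc l = 2 * 2 ^ l" by simp
  ultimately show ?thesis using 1 by linarith
qed

lemma h_bound: "4 * int h \<le> 2 ^ h"
proof -
  have "h - 2 + 2 \<le> 2 ^ (h - 2)" by (intro add_2_le_power_2) (simp add: h_def)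
  hence "h \<le> 2 ^ (h - 2)" by (simp add: h_def)
  hence "4 * h \<le> 2 ^ 2 * 2 ^ (h - 2)" by simp
  also have "\<dots> = 2 ^ h" unfolding power_add[symmetric] by (simp add: h_def)
  finally show ?thesis by (metis of_nat_le_iff of_nat_mult of_nat_numeral of_nat_power)
qed

lemma abs_le_square: "\<bar>x :: int\<bar> \<le> x ^ 2"
  by (cases "x = 0") (use mult_left_mono[of 1 "\<bar>x\<bar>" "\<bar>x\<bar>"] in \<open>auto simp: power2_eq_square abs_mult[symmetric]\<close>)

lemma size_bounds:
  assumes "X \<subseteq> {1..n}"
  shows "(\<Sum>e\<in>X. int (om e)) < 2 ^ l" "(\<Sum>e\<in>X. int (nv e)) < 2 ^ l" "\<bar>tt\<bar> < 2 ^ l" "\<bar>bb\<bar> < 2 ^ l"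
proof -
  have "(\<Sum>e\<in>X. int (om e)) \<le> (\<Sum>e\<in>{1..n}. int (om e))" "(\<Sum>e\<in>X. int (nv e)) \<le> (\<Sum>e\<in>{1..n}. int (nv e))"
    using assms by (auto intro!: sum_mono2)
  moreover have "0 \<le> (\<Sum>e\<in>{1..n}. int (om e))" "0 \<le> (\<Sum>e\<in>{1..n}. int (nv e))"
    by (auto intro!: sum_nonneg)
  moreover note abs_le_square[of tt] abs_le_square[of bb] size
  ultimately show "(\<Sum>e\<in>X. int (om e)) < 2 ^ l" "(\<Sum>e\<in>X. int (nv e)) < 2 ^ l" "\<bar>tt\<bar> < 2 ^ l" "\<bar>bb\<bar> < 2 ^ l"
    unfolding sum.distrib by linarith+
qed

definition excess1 :: "nat \<Rightarrow> nat set \<Rightarrow> int" where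
  "excess1 z X = (\<Sum>e\<in>X. int (om e) div 2 ^ (z mod h)) -
     (- ((-tt) div 2 ^ (z mod h)) + int (z div h ^ 2 mod h))"

definition excess2 :: "nat \<Rightarrow> nat set \<Rightarrow> int" where
  "excess2 z X = (\<Sum>e\<in>X. (- int (nv e)) div 2 ^ (z div h mod h)) -
     (- (bb div 2 ^ (z div h mod h)) + int (z div h ^ 3 mod h))"

lemma item_sum:
  "(\<Sum>e\<in>X. item z e) = 4 * int h * ((\<Sum>e\<in>X. int (om e) div 2 ^ (z mod h)) * 2 ^ h +
      (\<Sum>e\<in>X. (- int (nv e)) div 2 ^ (z div h mod h)))"
  unfolding item_def by (simp only: sum_distrib_left[symmetric] sum.distrib sum_distrib_right[symmetric])

lemma item_sum_minus_goal:
  "(\<Sum>e\<in>X. item z e) - goal z = 4 * int h * (excess1 z X * 2 ^ h + excess2 z X)"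
  unfolding item_sum goal_def excess1_def excess2_def by (simp add: algebra_simps)

lemma excess_bounds:
  assumes "X \<subseteq> {1..n}"
  shows "\<bar>excess1 z X\<bar> < 2 ^ (h - 1)" "\<bar>excess2 z X\<bar> < 2 ^ (h - 1)"
proof -
  have fin: "finite X" using assms finite_subset by blast
  have div_abs: "\<bar>x div 2 ^ k\<bar> \<le> \<bar>x\<bar>" for x :: int and k by (rule abs_div_le)
  have s: "\<bar>\<Sum>e\<in>X. f e div 2 ^ k\<bar> \<le> (\<Sum>e\<in>X. \<bar>f e\<bar>)" for f :: "nat \<Rightarrow> int" and k
    by (rule order_trans[OF sum_abs]) (intro sum_mono div_abs)
  have m: "0 \<le> int (x mod h)" "int (x mod h) < int h" for x using h_pos by simp_all
  have tri: "\<bar>a - (- b + c)\<bar> < 2 ^ (h - 1)"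
    if "\<bar>a\<bar> < 2 ^ l" "\<bar>b\<bar> < 2 ^ l" "0 \<le> c" "c < int h" for a b c :: int
    using that pow_l_bound by linarith
  have "\<bar>\<Sum>e\<in>X. int (om e) div 2 ^ (z mod h)\<bar> < 2 ^ l"
    by (rule le_less_trans[OF s]) (use size_bounds[OF assms] in simp)
  moreover have "\<bar>(-tt) div 2 ^ (z mod h)\<bar> < 2 ^ l"
    by (rule le_less_trans[OF div_abs]) (use size_bounds[OF assms] in simp)
  ultimately show "\<bar>excess1 z X\<bar> < 2 ^ (h - 1)" unfolding excess1_def
    by (rule tri) (rule m)+
  have "\<bar>\<Sum>e\<in>X. (- int (nv e)) div 2 ^ (z div h mod h)\<bar> < 2 ^ l"
    by (rule le_less_trans[OF s]) (use size_bounds[OF assms] in simp)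
  moreover have "\<bar>bb div 2 ^ (z div h mod h)\<bar> < 2 ^ l"
    by (rule le_less_trans[OF div_abs]) (use size_bounds[OF assms] in simp)
  ultimately show "\<bar>excess2 z X\<bar> < 2 ^ (h - 1)" unfolding excess2_def
    by (rule tri) (rule m)+
qed

text \<open>The low part \<open>excess2\<close> is smaller than \<open>2 ^ h\<close> in absolute
  value, so it cannot cancel a nonzero multiple of \<open>2 ^ h\<close>.\<close>

lemma item_sum_eq_goal_iff:
  assumes "X \<subseteq> {1..n}"
  shows "(\<Sum>e\<in>X. item z e) = goal z \<longleftrightarrow> excess1 z X = 0 \<and> excess2 z X = 0"
proof -
  have "\<bar>excess2 z X\<bar> < 2 ^ h"
    by (rule less_le_trans[OF excess_bounds(2)[OF assms]]) (intro power_increasing, auto)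
  hence "excess1 z X * 2 ^ h + excess2 z X = 0 \<Longrightarrow> excess2 z X = 0"
    using zdvd_not_zless[of "\<bar>excess2 z X\<bar>" "2 ^ h"]
    by (metis abs_dvd_iff abs_ge_zero add.commute dvd_abs_iff dvd_minus_iff dvd_triv_right
        eq_neg_iff_add_eq_0 less_le zero_less_abs_iff)
  hence "excess1 z X * 2 ^ h + excess2 z X = 0 \<longleftrightarrow> excess1 z X = 0 \<and> excess2 z X = 0" by auto
  moreover have "(\<Sum>e\<in>X. item z e) = goal z \<longleftrightarrow> (\<Sum>e\<in>X. item z e) - goal z = 0" by simp
  ultimately show ?thesis unfolding item_sum_minus_goal using h_pos by simp
qed

text \<open>The summand \<open>d\<close> makes room for the carry error in
  \<open>fails_divisor\<close>.\<close>

lemma item_sum_minus_goal_bound: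
  assumes "X \<subseteq> {1..n}" "\<bar>d\<bar> \<le> 2 * int h"
  shows "\<bar>(\<Sum>e\<in>X. item z e) - goal z + d\<bar> < 2 ^ (4 * h)"
proof -
  define x y where "x = excess1 z X" and "y = excess2 z X"
  have 2: "(2::int) ^ h = 2 * 2 ^ (h - 1)" using h_pos by (simp flip: power_Suc)
  have x: "\<bar>x\<bar> \<le> 2 ^ (h - 1) - 1" and y: "\<bar>y\<bar> \<le> 2 ^ (h - 1)"
    using excess_bounds[OF assms(1), of z] by (simp_all add: x_def y_def)
  have "\<bar>x * 2 ^ h + y\<bar> \<le> \<bar>x\<bar> * 2 ^ h + \<bar>y\<bar>" by (rule order_trans[OF abs_triangle_ineq]) (simp add: abs_mult)
  also have "\<dots> \<le> (2 ^ (h - 1) - 1) * 2 ^ h + 2 ^ (h - 1)"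
    using x y by (intro add_mono mult_right_mono) auto
  also have "\<dots> \<le> 2 ^ h * 2 ^ h" unfolding 2 by (simp add: algebra_simps)
  finally have "\<bar>4 * int h * (x * 2 ^ h + y)\<bar> \<le> 2 ^ h * (2 ^ h * 2 ^ h)"
    unfolding abs_mult using h_bound by (intro mult_mono) auto
  hence "\<bar>(\<Sum>e\<in>X. item z e) - goal z\<bar> \<le> 2 ^ (3 * h)"
    unfolding item_sum_minus_goal x_def y_def by (simp add: power_mult power3_eq_cube flip: power_mult_distrib power_add)
  moreover have "2 * int h < 2 ^ (3 * h)"
  proof -
    have "2 * int h < 4 * int h" using h_pos by simp
    also note h_bound
    also have "(2::int) ^ h \<le> 2 ^ (3 * h)" by (intro power_increasing) auto
    finally show ?thesis .
  qed
  moreover have "2 * (2::int) ^ (3 * h) \<le> 2 ^ (4 * h)"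
    using power_increasing[of "Suc (3 * h)" "4 * h" "2::int"] h_pos by simp
  ultimately show ?thesis using assms(2) by linarith
qed

lemma digits:
  assumes "a < h" "b < h" "c < h" "d < h" "i < h"
  obtains z where "z < h ^ 5" "z mod h = a" "z div h mod h = b" "z div h ^ 2 mod h = c"
    "z div h ^ 3 mod h = d" "z div h ^ 4 = i"
proof
  define w where "w = d + h * i"
  define x where "x = c + h * w"
  define y where "y = b + h * x"
  define z where "z = a + h * y"
  have dv: "z div h = y" "y div h = x" "x div h = w" "w div h = i"
    using assms by (simp_all add: z_def y_def x_def w_def)
  have z2: "z div h ^ 2 = x" by (simp only: power2_eq_square div_mult2_eq dv)
  have z3: "z div h ^ 3 = w" by (simp only: power3_eq_cube div_mult2_eq dv)
  have z4: "z div h ^ 4 = i" by (simp only: power4_eq_xxxx div_mult2_eq dv)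
  show "z div h mod h = b" "z div h ^ 2 mod h = c" "z div h ^ 3 mod h = d" "z mod h = a"
    unfolding z2 z3 dv using assms by (simp_all add: z_def y_def x_def w_def)
  show "z div h ^ 4 = i" by (rule z4)
  hence "z div h ^ 4 < h" using assms by simp
  hence "z < h * h ^ 4" using h_pos by (simp add: div_less_iff_less_mult)
  thus "z < h ^ 5" by (simp add: eval_nat_numeral)
qed

text \<open>\<open>sum_ge_iff_rounded\<close> for \<open>om\<close> with the bound \<open>tt\<close>
  and for the negated \<open>nv\<close> with the bound \<open>- bb\<close>. Exponents stop at
  \<open>h - 1\<close>, where rounding makes the quantities in its last two assumptions at most
  0.\<close>

lemma feasible_iff:
  "feasible \<longleftrightarrow> (\<exists>X\<subseteq>{1..n}. \<exists>a<h. \<exists>b<h. \<exists>c<h. \<exists>d<h.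
    (\<Sum>e\<in>X. int (om e) div 2 ^ a) = - ((-tt) div 2 ^ a) + int c \<and>
    (\<Sum>e\<in>X. (- int (nv e)) div 2 ^ b) = - (bb div 2 ^ b) + int d)"
proof -
  have small: "x div 2 ^ (h - 1) \<le> 0" if "\<bar>x\<bar> < 2 ^ l" for x :: int
  proof -
    have "x < 2 ^ (h - 1)" using that pow_l_bound by linarith
    thus ?thesis by (cases "x \<ge> 0") (auto simp: div_nonpos_pos_le0)
  qed
  have ex: "(\<exists>k\<le>h - 1. \<exists>j\<le>h - 1. P k j) \<longleftrightarrow> (\<exists>k<h. \<exists>j<h. P k j)" for P
    using h_pos by (metis One_nat_def Suc_leI Suc_pred less_Suc_eq_le)
  have *: "int (\<Sum>e\<in>X. om e) \<ge> tt \<longleftrightarrow>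
         (\<exists>a<h. \<exists>c<h. (\<Sum>e\<in>X. int (om e) div 2 ^ a) = - ((-tt) div 2 ^ a) + int c)"
      "int (\<Sum>e\<in>X. nv e) \<le> bb \<longleftrightarrow>
         (\<exists>b<h. \<exists>d<h. (\<Sum>e\<in>X. (- int (nv e)) div 2 ^ b) = - (bb div 2 ^ b) + int d)"
    if X: "X \<subseteq> {1..n}" for X
  proof -
    have fin: "finite X" using X finite_subset by blast
    have card: "card X \<le> h - 1" using card_mono[OF _ X] n_less_h by simp
    have e: "\<bar>int (om e)\<bar> < 2 ^ l" "\<bar>- int (nv e)\<bar> < 2 ^ l" if "e \<in> X" for e
      using size_bounds(1,2)[of "{e}"] that X by auto
    have "int (\<Sum>e\<in>X. om e) = (\<Sum>e\<in>X. int (om e))" by simp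
    moreover have "(\<Sum>e\<in>X. int (om e) div 2 ^ (h - 1)) \<le> 0" using e by (intro sum_nonpos small) auto
    moreover have "(-tt) div 2 ^ (h - 1) \<le> 0" using size_bounds(3)[OF X] by (intro small) auto
    ultimately show "int (\<Sum>e\<in>X. om e) \<ge> tt \<longleftrightarrow>
         (\<exists>a<h. \<exists>c<h. (\<Sum>e\<in>X. int (om e) div 2 ^ a) = - ((-tt) div 2 ^ a) + int c)"
      using sum_ge_iff_rounded[OF fin card, of "\<lambda>e. int (om e)" "h - 1" tt] unfolding ex by simp
    have "int (\<Sum>e\<in>X. nv e) \<le> bb \<longleftrightarrow> (\<Sum>e\<in>X. - int (nv e)) \<ge> - bb" by (simp add: sum_negf)
    moreover have "(\<Sum>e\<in>X. (- int (nv e)) div 2 ^ (h - 1)) \<le> 0" using e by (intro sum_nonpos small) auto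
    moreover have "(- (- bb)) div 2 ^ (h - 1) \<le> 0" using size_bounds(4)[OF X] by (intro small) auto
    ultimately show "int (\<Sum>e\<in>X. nv e) \<le> bb \<longleftrightarrow>
         (\<exists>b<h. \<exists>d<h. (\<Sum>e\<in>X. (- int (nv e)) div 2 ^ b) = - (bb div 2 ^ b) + int d)"
      using sum_ge_iff_rounded[OF fin card, of "\<lambda>e. - int (nv e)" "h - 1" "- bb"] unfolding ex by simp
  qed
  show ?thesis unfolding feasible_def by (simp only: * cong: conj_cong) blast
qed

section \<open>Bins, feasibility, and the primes that leave the question open\<close>

lemma mem_bin_iff:
  assumes "1 < q"
  shows "X \<in> bin q z \<longleftrightarrow> X \<subseteq> {1..n} \<and>
    (int q - 1) dvd (\<Sum>e\<in>X. item z e mod int q) - (goal z mod int q + int (z div h ^ 4))"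
proof -
  define s where "s = - (goal z mod int q + int (z div h ^ 4))"
  have sh: "int (shift q z) = s mod (int q - 1)"
    unfolding shift_def s_def using assms by (subst int_nat_eq) auto
  have c: "int (\<Sum>e\<in>X. nat (item z e mod int q)) = (\<Sum>e\<in>X. item z e mod int q)"
    using assms by simp
  have i: "int (shift q z + (\<Sum>e\<in>X. nat (item z e mod int q))) = s mod (int q - 1) + (\<Sum>e\<in>X. item z e mod int q)"
    by (simp only: of_nat_add sh c)
  have q: "int (q - 1) = int q - 1" using assms by (simp add: of_nat_diff)
  have "(q - 1) dvd shift q z + (\<Sum>e\<in>X. nat (item z e mod int q)) \<longleftrightarrow>
      int (q - 1) dvd int (shift q z + (\<Sum>e\<in>X. nat (item z e mod int q)))"
    by (rule of_nat_dvd_iff[symmetric])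
  also have "\<dots> \<longleftrightarrow> (int q - 1) dvd s + (\<Sum>e\<in>X. item z e mod int q)"
    by (simp only: i q dvd_eq_mod_eq_0 mod_add_left_eq)
  also have "s + (\<Sum>e\<in>X. item z e mod int q) = (\<Sum>e\<in>X. item z e mod int q) - (goal z mod int q + int (z div h ^ 4))"
    by (simp add: s_def)
  finally show ?thesis by (simp add: bin_def)
qed

text \<open>The residues of a solution add up to \<open>goal z mod q + r * q\<close> with a carry
  \<open>r < h\<close>. As \<open>r * q\<close> is congruent to \<open>r\<close> modulo
  \<open>q - 1\<close>, the solution lies in the bin of the query with carry digit \<open>r\<close>,
  which is thus nonempty.\<close>

lemma feasible_accepts_or_fails:
  assumes "prime q" feasible
  shows "\<exists>z<h ^ 5. accepts q z \<or> fails q z"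
proof -
  have q: "q > 0" using assms prime_gt_0_nat by blast
  from assms(2) obtain X a b c d where X: "X \<subseteq> {1..n}" and dig: "a < h" "b < h" "c < h" "d < h"
    and 1: "(\<Sum>e\<in>X. int (om e) div 2 ^ a) = - ((-tt) div 2 ^ a) + int c"
    and 2: "(\<Sum>e\<in>X. (- int (nv e)) div 2 ^ b) = - (bb div 2 ^ b) + int d"
    unfolding feasible_iff by blast
  have fin: "finite X" using X finite_subset by blast
  have cX: "card X < h" using card_mono[OF _ X] n_less_h by simp
  \<comment> \<open>The carry depends on the items, but the items do not depend on the carry digit:
    \<open>z0\<close> serves to determine \<open>r\<close>.\<close>
  from digits[OF dig h_pos] obtain z0 where
    z0: "z0 mod h = a" "z0 div h mod h = b" "z0 div h ^ 2 mod h = c" "z0 div h ^ 3 mod h = d" by metis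
  from sum_mod_eq[OF fin, of "int q" "item z0"] q obtain r where
    r: "r \<le> card X" "(\<Sum>e\<in>X. item z0 e mod int q) = (\<Sum>e\<in>X. item z0 e) mod int q + int r * int q" by auto
  hence "r < h" using cX by simp
  from digits[OF dig this] obtain z where
    z: "z < h ^ 5" "z mod h = a" "z div h mod h = b" "z div h ^ 2 mod h = c" "z div h ^ 3 mod h = d" "z div h ^ 4 = r"
    by metis
  have zz: "item z0 = item z" unfolding item_def z z0 by simp
  have hit: "(\<Sum>e\<in>X. item z e) = goal z"
    unfolding item_sum_eq_goal_iff[OF X] excess1_def excess2_def z using 1 2 by simp
  have "(\<Sum>e\<in>X. item z e mod int q) - (goal z mod int q + int r) = (int q - 1) * int r"
    using r(2) unfolding zz hit by (simp add: algebra_simps)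
  hence "X \<in> bin q z"
    using X prime_gt_1_nat[OF assms(1)] by (simp add: mem_bin_iff z(6))
  thus ?thesis using z(1) unfolding accepts_def fails_def by blast
qed

lemma accepts_feasible:
  assumes "accepts q z"
  shows feasible
proof -
  from assms obtain X where X: "X \<subseteq> {1..n}" "(\<Sum>e\<in>X. item z e) = goal z"
    unfolding accepts_def bin_def by blast
  have "excess1 z X = 0" "excess2 z X = 0" using X item_sum_eq_goal_iff by blast+
  moreover have "x mod h < h" for x using h_pos by simp
  ultimately show ?thesis unfolding feasible_iff excess1_def excess2_def using X(1)
    by (metis eq_iff_diff_eq_0)
qed

lemma conclusive_correct:
  assumes "conclusive q"
  shows "feasible \<longleftrightarrow> (\<exists>z<h ^ 5. accepts q z)"
  using assms accepts_feasible feasible_accepts_or_fails unfolding conclusive_def by blast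

text \<open>Membership in a bin is a congruence of residue sums modulo \<open>q - 1\<close>. Undoing
  the reductions turns it into a congruence of the sums themselves modulo \<open>q\<close>, up to a
  small error \<open>d\<close> that collects the carries and the quotient \<open>m\<close>.\<close>

lemma fails_divisor:
  assumes "prime q" "X \<in> bin q z" "z < h ^ 5"
  obtains d where "\<bar>d\<bar> \<le> 2 * int h" "int q dvd (\<Sum>e\<in>X. item z e) - goal z + d"
proof -
  have q: "q > 1" using assms prime_gt_1_nat by blast
  have X: "X \<subseteq> {1..n}" using assms(2) by (auto simp: bin_def)
  have fin: "finite X" using X finite_subset by blast
  have cX: "card X < h" using card_mono[OF _ X] n_less_h by simp
  define u where "u = (\<Sum>e\<in>X. item z e)"
  define i where "i = z div h ^ 4"
  have i: "i < h" using assms(3) h_pos by (simp add: i_def div_less_iff_less_mult eval_nat_numeral)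
  from sum_mod_eq[OF fin, of "int q" "item z"] q obtain r where
    r: "r \<le> card X" "(\<Sum>e\<in>X. item z e mod int q) = u mod int q + int r * int q" by (auto simp: u_def)
  have q0: "0 \<le> x mod int q" "x mod int q < int q" for x using q by simp_all
  have "(int q - 1) dvd u mod int q + int r * int q - (goal z mod int q + int i)"
    using assms(2) unfolding mem_bin_iff[OF q] r(2) i_def by blast
  hence "(int q - 1) dvd u mod int q + int r * int q - (goal z mod int q + int i) - int r * (int q - 1)"
    by (rule dvd_diff) simp
  also have "u mod int q + int r * int q - (goal z mod int q + int i) - int r * (int q - 1)
      = u mod int q - goal z mod int q + (int r - int i)"
    by (simp add: algebra_simps)
  finally obtain m where m: "u mod int q - goal z mod int q + (int r - int i) = (int q - 1) * m"
    by (elim dvdE)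
  \<comment> \<open>Two residues modulo \<open>q\<close> differ by at most \<open>q - 1\<close>, and
    two carries by less than \<open>h\<close>; so \<open>m\<close> is bounded in terms of
    \<open>h\<close> alone.\<close>
  have "\<bar>(int q - 1) * m\<bar> \<le> (int q - 1) + (int h - 1)"
    unfolding m[symmetric] using q0[of u] q0[of "goal z"] r(1) cX i by linarith
  also have "\<dots> \<le> (int q - 1) + (int q - 1) * (int h - 1)"
    using q h_pos mult_right_mono[of 1 "int q - 1" "int h - 1"] by simp
  also have "\<dots> = (int q - 1) * int h" by (simp add: algebra_simps)
  finally have "(int q - 1) * \<bar>m\<bar> \<le> (int q - 1) * int h" using q by (simp add: abs_mult)
  hence "\<bar>m\<bar> \<le> int h" using q by (simp add: mult_le_cancel_left)
  moreover have "\<bar>int r - int i\<bar> \<le> int h" using r(1) cX i by linarith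
  ultimately have "\<bar>m + (int r - int i)\<bar> \<le> 2 * int h" by linarith
  moreover have "int q dvd u - goal z + (m + (int r - int i))"
  proof -
    have "u - goal z + (m + (int r - int i)) =
        (u - u mod int q) - (goal z - goal z mod int q) + (int q * m)"
      using m by (simp add: algebra_simps)
    thus ?thesis by (simp only: dvd_add dvd_diff dvd_minus_mod dvd_triv_left)
  qed
  ultimately show ?thesis using that by (simp add: u_def)
qed

text \<open>Rounding the summands instead of the sum loses less than \<open>h\<close> in either
  coordinate. So the exact pair of weights together with the two losses determines the item
  sum.\<close>

lemma card_item_sums_le:
  "card ((\<lambda>X. \<Sum>e\<in>X. item z e) ` Pow {1..n}) \<le> num_pairs * h ^ 2"
proof -
  define P where "P = {(\<Sum>e\<in>X. om e, \<Sum>e\<in>X. nv e) | X. X \<subseteq> {1..n}}"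
  have P: "P = (\<lambda>X. (\<Sum>e\<in>X. om e, \<Sum>e\<in>X. nv e)) ` Pow {1..n}" unfolding P_def by blast
  define G where "G = (\<lambda>((p1 :: nat, p2 :: nat), r1 :: nat, r2 :: nat).
    4 * int h * ((int p1 div 2 ^ (z mod h) - int r1) * 2 ^ h + ((- int p2) div 2 ^ (z div h mod h) - int r2)))"
  have "(\<lambda>X. \<Sum>e\<in>X. item z e) ` Pow {1..n} \<subseteq> G ` (P \<times> ({..<h} \<times> {..<h}))"
  proof safe
    fix X assume X: "X \<subseteq> {1..n}"
    have fin: "finite X" using X finite_subset by blast
    have cX: "card X < h" using card_mono[OF _ X] n_less_h by simp
    from sum_div_eq[OF fin, of "2 ^ (z mod h)" "\<lambda>e. int (om e)"] obtain r1 where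
      r1: "r1 \<le> card X" "(\<Sum>x\<in>X. int (om x) div 2 ^ (z mod h)) = (\<Sum>x\<in>X. int (om x)) div 2 ^ (z mod h) - int r1"
      by auto
    from sum_div_eq[OF fin, of "2 ^ (z div h mod h)" "\<lambda>e. - int (nv e)"] obtain r2 where
      r2: "r2 \<le> card X" "(\<Sum>x\<in>X. (- int (nv x)) div 2 ^ (z div h mod h)) = (\<Sum>x\<in>X. - int (nv x)) div 2 ^ (z div h mod h) - int r2"
      by auto
    have "(\<Sum>e\<in>X. item z e) = G ((\<Sum>e\<in>X. om e, \<Sum>e\<in>X. nv e), r1, r2)"
      unfolding item_sum r1 r2 G_def by (simp add: sum_negf)
    thus "(\<Sum>e\<in>X. item z e) \<in> G ` (P \<times> ({..<h} \<times> {..<h}))"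
      using X r1(1) r2(1) cX unfolding P by (intro image_eqI[where x = "((\<Sum>e\<in>X. om e, \<Sum>e\<in>X. nv e), r1, r2)"]) auto
  qed
  moreover have "finite P" unfolding P by simp
  ultimately have "card ((\<lambda>X. \<Sum>e\<in>X. item z e) ` Pow {1..n}) \<le> card (P \<times> ({..<h} \<times> {..<h}))"
    by (intro surj_card_le) auto
  also have "\<dots> = num_pairs * h ^ 2" by (simp add: num_pairs_def P_def card_cartesian_product power2_eq_square)
  finally show "card ((\<lambda>X. \<Sum>e\<in>X. item z e) ` Pow {1..n}) \<le> num_pairs * h ^ 2" .
qed

text \<open>A union bound over queries \<open>z\<close>, wrong sums \<open>u\<close> and errors
  \<open>d\<close>: by \<open>fails_divisor\<close>, each inconclusive prime divides some
  \<open>u - goal z + d\<close>.\<close>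

lemma card_inconclusive_primes_le:
  "finite {q. prime q \<and> \<not> conclusive q}"
  "card {q. prime q \<and> \<not> conclusive q} \<le> 20 * h ^ 9 * num_pairs"
proof -
  define V where "V = (\<lambda>z. (\<lambda>X. \<Sum>e\<in>X. item z e) ` Pow {1..n} - {goal z})"
  define D where "D = {- (2 * int h)..2 * int h}"
  define E where "E = (\<lambda>z u d. {q :: nat. prime q \<and> int q dvd u - goal z + d})"
  have finV: "finite (V z)" for z unfolding V_def by simp
  have cV: "card (V z) \<le> num_pairs * h ^ 2" for z
  proof -
    have "card (V z) \<le> card ((\<lambda>X. \<Sum>e\<in>X. item z e) ` Pow {1..n})" unfolding V_def by (intro card_mono) auto
    thus ?thesis using card_item_sums_le[of z] by simp
  qed
  have cD: "card D = 4 * h + 1" by (simp add: D_def)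
  have E: "finite (E z u d)" "card (E z u d) \<le> 4 * h" if "u \<in> V z" "d \<in> D" for z u d
  proof -
    from that obtain X where X: "X \<subseteq> {1..n}" "u = (\<Sum>e\<in>X. item z e)" "u \<noteq> goal z" by (auto simp: V_def)
    have d: "\<bar>d\<bar> \<le> 2 * int h" using that by (auto simp: D_def)
    define m where "m = excess1 z X * 2 ^ h + excess2 z X"
    have um: "u - goal z = 4 * int h * m" using item_sum_minus_goal[of z X] X by (simp add: m_def)
    hence "m \<noteq> 0" using X by auto
    \<comment> \<open>The factor \<open>4 * h\<close> of \<open>item\<close> is used here: the error
      \<open>d\<close> of at most \<open>2 * h\<close> cannot cancel a nonzero multiple of
      \<open>4 * h\<close>.\<close>
    hence "4 * int h * 1 \<le> 4 * int h * \<bar>m\<bar>" by (intro mult_left_mono) auto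
    hence "4 * int h \<le> \<bar>u - goal z\<bar>" unfolding um by (simp add: abs_mult)
    hence "u - goal z + d \<noteq> 0" using d h_pos by linarith
    moreover have "\<bar>u - goal z + d\<bar> < 2 ^ (4 * h)" using item_sum_minus_goal_bound[OF X(1) d] X(2) by simp
    ultimately show "finite (E z u d)" "card (E z u d) \<le> 4 * h"
      unfolding E_def by (rule card_prime_divisors_le)+
  qed
  have sub: "{q. prime q \<and> \<not> conclusive q} \<subseteq> (\<Union>z<h ^ 5. \<Union>u\<in>V z. \<Union>d\<in>D. E z u d)"
  proof safe
    fix q assume q: "prime q" "\<not> conclusive q"
    then obtain z X where z: "z < h ^ 5" "X \<in> bin q z" "(\<Sum>e\<in>X. item z e) \<noteq> goal z"
      unfolding conclusive_def fails_def by blast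
    from fails_divisor[OF q(1) z(2,1)] obtain d where
      d: "\<bar>d\<bar> \<le> 2 * int h" "int q dvd (\<Sum>e\<in>X. item z e) - goal z + d" by blast
    have "(\<Sum>e\<in>X. item z e) \<in> V z" using z by (auto simp: V_def bin_def)
    moreover have "d \<in> D" using d by (auto simp: D_def)
    ultimately show "q \<in> (\<Union>z<h ^ 5. \<Union>u\<in>V z. \<Union>d\<in>D. E z u d)" using q(1) d(2) z(1) by (auto simp: E_def)
  qed
  have fin: "finite (\<Union>z<h ^ 5. \<Union>u\<in>V z. \<Union>d\<in>D. E z u d)"
    using finV E(1) by (auto simp: D_def)
  show "finite {q. prime q \<and> \<not> conclusive q}" by (rule finite_subset[OF sub fin])
  have "card {q. prime q \<and> \<not> conclusive q} \<le> card (\<Union>z<h ^ 5. \<Union>u\<in>V z. \<Union>d\<in>D. E z u d)"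
    by (rule card_mono[OF fin sub])
  also have "\<dots> \<le> (\<Sum>z<h ^ 5. card (\<Union>u\<in>V z. \<Union>d\<in>D. E z u d))" by (rule card_UN_le) simp
  also have "\<dots> \<le> (\<Sum>z<h ^ 5. num_pairs * h ^ 2 * ((4 * h + 1) * (4 * h)))"
  proof (rule sum_mono)
    fix z
    have "card (\<Union>u\<in>V z. \<Union>d\<in>D. E z u d) \<le> (\<Sum>u\<in>V z. card (\<Union>d\<in>D. E z u d))" by (rule card_UN_le[OF finV])
    also have "\<dots> \<le> (\<Sum>u\<in>V z. (4 * h + 1) * (4 * h))"
    proof (rule sum_mono)
      fix u assume u: "u \<in> V z"
      have "card (\<Union>d\<in>D. E z u d) \<le> (\<Sum>d\<in>D. card (E z u d))" by (rule card_UN_le) (simp add: D_def)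
      also have "\<dots> \<le> (\<Sum>d\<in>D. 4 * h)" by (intro sum_mono E u)
      finally show "card (\<Union>d\<in>D. E z u d) \<le> (4 * h + 1) * (4 * h)" by (simp only: sum_constant cD of_nat_id)
    qed
    also have "\<dots> = card (V z) * ((4 * h + 1) * (4 * h))" by simp
    also have "\<dots> \<le> num_pairs * h ^ 2 * ((4 * h + 1) * (4 * h))" by (intro mult_right_mono cV) simp
    finally show "card (\<Union>u\<in>V z. \<Union>d\<in>D. E z u d) \<le> num_pairs * h ^ 2 * ((4 * h + 1) * (4 * h))" .
  qed
  also have "\<dots> = h ^ 5 * (num_pairs * h ^ 2 * ((4 * h + 1) * (4 * h)))" by simp
  also have "\<dots> \<le> h ^ 5 * (num_pairs * h ^ 2 * ((5 * h) * (4 * h)))"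
    using h_pos by (intro mult_left_mono mult_right_mono) auto
  also have "\<dots> = 20 * h ^ (5 + 2 + 1 + 1) * num_pairs"
  proof -
    have "a * (s * b * ((5 * h) * (4 * h))) = 20 * (a * b * h * h) * s" for a b s :: nat by simp
    thus ?thesis by (simp only: power_add power_one_right)
  qed
  also have "\<dots> = 20 * h ^ 9 * num_pairs" by simp
  finally show "card {q. prime q \<and> \<not> conclusive q} \<le> 20 * h ^ 9 * num_pairs" .
qed

lemma num_pairs_bounds: "1 \<le> num_pairs" "num_pairs \<le> 2 ^ n"
proof -
  define P where "P = {(\<Sum>e\<in>X. om e, \<Sum>e\<in>X. nv e) | X. X \<subseteq> {1..n}}"
  have P: "P = (\<lambda>X. (\<Sum>e\<in>X. om e, \<Sum>e\<in>X. nv e)) ` Pow {1..n}" unfolding P_def by blast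
  have "card P \<le> card (Pow {1..n})" unfolding P by (rule card_image_le) simp
  thus "num_pairs \<le> 2 ^ n" by (simp add: num_pairs_def P_def card_Pow)
  have "P \<noteq> {}" "finite P" unfolding P by auto
  hence "card P > 0" by (simp add: card_gt_0_iff)
  thus "1 \<le> num_pairs" by (simp add: num_pairs_def P_def)
qed

text \<open>\<open>Y\<close> is \<open>64 * h\<close> times the bound on inconclusive primes. If
  \<open>2 ^ d\<close> is at least \<open>Y\<close>, these primes are at most half of the
  \<open>2 ^ d / (32 * h)\<close> primes that Chebyshev's bound guarantees. The least such
  \<open>d\<close> keeps \<open>2 ^ d\<close> below \<open>2 * Y\<close>.\<close>

lemma many_conclusive:
  obtains d where "d \<le> 16 * h" "2 ^ d \<le> 2560 * h ^ 10 * num_pairs"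
    "2 ^ d \<le> 64 * h * card {q. q < 2 ^ d \<and> conclusive q}"
proof -
  define Y where "Y = 1280 * h ^ 10 * num_pairs"
  define d where "d = (LEAST d. Y \<le> 2 ^ d)"
  have hp: "h \<le> 2 ^ h" by (simp add: less_imp_le)
  \<comment> \<open>Since there are at most \<open>2 ^ n\<close> pairs, primes of
    \<open>16 * h\<close> bits always suffice; this is the cap on the length of \<open>q\<close> in
    the program.\<close>
  have big: "Y \<le> 2 ^ (16 * h)"
  proof -
    have "Y \<le> 2 ^ 11 * (2 ^ h) ^ 10 * 2 ^ n" unfolding Y_def
      using hp num_pairs_bounds(2) by (intro mult_mono power_mono) auto
    also have "\<dots> = 2 ^ (11 + h * 10 + n)" by (simp only: power_add power_mult)
    also have "\<dots> \<le> 2 ^ (16 * h)" by (intro power_increasing) (auto simp: h_def)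
    finally show ?thesis .
  qed
  have d: "Y \<le> 2 ^ d" unfolding d_def by (rule LeastI[of "\<lambda>d. Y \<le> 2 ^ d", OF big])
  have d16: "d \<le> 16 * h" unfolding d_def by (rule Least_le[of "\<lambda>d. Y \<le> 2 ^ d", OF big])
  have "1 \<le> h ^ 10" using h_pos by simp
  hence "1280 * 1 * 1 \<le> Y" unfolding Y_def using num_pairs_bounds(1) by (intro mult_mono) auto
  hence Y2: "Y \<ge> 1280" by simp
  have d2: "d \<ge> 2"
  proof (rule ccontr)
    assume "\<not> d \<ge> 2"
    hence "d = 0 \<or> d = 1" by auto
    with d Y2 show False by auto
  qed
  have up: "2 ^ d \<le> 2 * Y"
  proof -
    have "\<not> Y \<le> 2 ^ (d - 1)" unfolding d_def
      using not_less_Least[of "d - 1" "\<lambda>d. Y \<le> 2 ^ d"] d2 unfolding d_def by auto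
    hence "2 * 2 ^ (d - 1) \<le> 2 * Y" by simp
    also have "2 * 2 ^ (d - 1) = (2::nat) ^ d" using d2 by (simp flip: power_Suc)
    finally show ?thesis .
  qed
  define A where "A = {q::nat. prime q \<and> q < 2 ^ d}"
  define G where "G = {q. q < 2 ^ d \<and> conclusive q}"
  have finG: "finite G" by (simp add: G_def)
  have "A \<subseteq> G \<union> {q. prime q \<and> \<not> conclusive q}" by (auto simp: A_def G_def)
  hence "card A \<le> card (G \<union> {q. prime q \<and> \<not> conclusive q})"
    using card_inconclusive_primes_le(1) finG by (intro card_mono) auto
  also have "\<dots> \<le> card G + 20 * h ^ 9 * num_pairs"
    using card_Un_le[of G "{q. prime q \<and> \<not> conclusive q}"] card_inconclusive_primes_le(2) by linarith
  finally have A: "card A \<le> card G + 20 * h ^ 9 * num_pairs" .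
  have "2 ^ d \<le> 2 * d * card A" unfolding A_def by (rule card_primes_less_power_2[OF d2])
  also have "\<dots> \<le> 32 * h * (card G + 20 * h ^ 9 * num_pairs)"
    by (rule mult_mono[OF _ A]) (use d16 in simp_all)
  finally have "2 * 2 ^ d \<le> 64 * h * card G + Y" 
    using power_Suc[of h 9] by (simp add: Y_def algebra_simps)
  hence "2 ^ d \<le> 64 * h * card G" using d by linarith
  moreover have "2 ^ d \<le> 2560 * h ^ 10 * num_pairs" using up by (simp add: Y_def)
  ultimately show ?thesis using d16 that by (simp add: G_def)
qed

end

subsection \<open>The program\<close>

abbreviation V :: "vname \<Rightarrow> expr" where "V x \<equiv> Read x (Const 0)"
abbreviation plus_expr (infixl "[+]" 65) where "a [+] b \<equiv> Bin Plus a b"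
abbreviation minus_expr (infixl "[-]" 65) where "a [-] b \<equiv> Bin Minus a b"
abbreviation times_expr (infixl "[*]" 70) where "a [*] b \<equiv> Bin Times a b"
abbreviation div_expr (infixl "[div]" 70) where "a [div] b \<equiv> Bin Div a b"
abbreviation mod_expr (infixl "[mod]" 70) where "a [mod] b \<equiv> Bin binop.Mod a b"
abbreviation less_expr (infix "[<]" 50) where "a [<] b \<equiv> Bin Less a b"

text \<open>The reduction is there for the space bound (\<open>guarded\<close>). The values meant to
  be stored lie below \<open>''G''\<close>, so it leaves them unchanged, except for a modulus equal
  to \<open>''G''\<close> in \<open>powmod\<close>.\<close>

definition asg :: "vname \<Rightarrow> expr \<Rightarrow> com" where
  "asg x e = Assign x (Const 0) (e [mod] V ''G'')"

fun seqs :: "com list \<Rightarrow> com" where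
  "seqs [] = Skip"
| "seqs (c # cs) = Seq c (seqs cs)"

text \<open>
  The number of rounds is always the length of \<open>''G''\<close>: with counted loops only, all running times
  are explicit.
\<close>

definition powmod :: "expr \<Rightarrow> expr \<Rightarrow> expr \<Rightarrow> com" where
  "powmod b e md = seqs [
     asg ''pb'' b,
     asg ''pe'' e,
     asg ''pm'' md,
     asg ''r'' (Const 1 [mod] V ''pm''),
     asg ''pc'' (Const 0),
     While (V ''pc'' [<] (Const 256 [*] V ''h'' [*] V ''h'')) (seqs [
       Cond (V ''pe'' [mod] Const 2) (asg ''r'' (V ''r'' [*] V ''pb'' [mod] V ''pm'')) Skip,
       asg ''pb'' (V ''pb'' [*] V ''pb'' [mod] V ''pm''),
       asg ''pe'' (V ''pe'' [div] Const 2),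
       asg ''pc'' (V ''pc'' [+] Const 1)])]"

text \<open>The moments are updated in decreasing order, since each recurrence uses the old values
  of the lower orders.\<close>

definition item_body :: com where
  "item_body = seqs [
     asg ''a'' (Const 4 [*] V ''h'' [*] (Read ''omega'' (V ''e'') [div] V ''k'' [*] V ''B''
        [+] (Const 0 [-] Read ''nu'' (V ''e'')) [div] V ''k2'') [mod] V ''M''),
     powmod (V ''w'') (V ''a'' [mod] V ''q'') (V ''M''),
     asg ''p2'' ((V ''p2'' [+] V ''r'' [*] (V ''p2'' [+] Const 2 [*] V ''a'' [*] V ''p1''
        [+] V ''a'' [*] V ''a'' [*] V ''p0'')) [mod] V ''M''),
     asg ''p1'' ((V ''p1'' [+] V ''r'' [*] (V ''p1'' [+] V ''a'' [*] V ''p0'')) [mod] V ''M''),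
     asg ''p0'' ((V ''p0'' [+] V ''r'' [*] V ''p0'') [mod] V ''M''),
     asg ''e'' (V ''e'' [+] Const 1)]"

definition item_loop :: com where
  "item_loop = While (V ''e'' [<] V ''n'' [+] Const 1) item_body"

text \<open>
  The cells \<open>p0\<close>, \<open>p1\<close>, \<open>p2\<close> hold the moments of order 0, 1, 2 at the root of unity \<open>w\<close>; the
  sums over all roots are accumulated in \<open>s0\<close> and \<open>s2\<close>.
\<close>

definition point_body :: com where
  "point_body = seqs [
     powmod (V ''x'') (V ''E'') (V ''M''),
     asg ''w'' (V ''r''),
     powmod (V ''w'') (V ''s'') (V ''M''),
     asg ''p0'' (V ''r''),
     asg ''p1'' ((Const 0 [-] V ''v'') [*] V ''r'' [mod] V ''M''),
     asg ''p2'' (V ''v'' [*] V ''v'' [*] V ''r'' [mod] V ''M''),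
     asg ''e'' (Const 1),
     item_loop,
     asg ''s0'' ((V ''s0'' [+] V ''p0'') [mod] V ''M''),
     asg ''s2'' ((V ''s2'' [+] V ''p2'') [mod] V ''M''),
     asg ''x'' (V ''x'' [+] Const 1)]"

definition point_loop :: com where
  "point_loop = While (V ''x'' [<] V ''q'') point_body"

definition query :: com where
  "query = seqs [
     powmod (Const 2) (V ''z'' [mod] V ''h'') (V ''G''),
     asg ''k'' (V ''r''),
     powmod (Const 2) (V ''z'' [div] V ''h'' [mod] V ''h'') (V ''G''),
     asg ''k2'' (V ''r''),
     asg ''v'' (Const 4 [*] V ''h'' [*]
       (((Const 0 [-] (Const 0 [-] V ''t'') [div] V ''k'') [+] V ''z'' [div] (V ''h'' [*] V ''h'') [mod] V ''h'') [*] V ''B''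
        [+] ((Const 0 [-] V ''b'' [div] V ''k2'') [+] V ''z'' [div] (V ''h'' [*] V ''h'' [*] V ''h'') [mod] V ''h''))
       [mod] V ''M''),
     asg ''s'' ((Const 0 [-] (V ''v'' [mod] V ''q'' [+] V ''z'' [div] (V ''h'' [*] V ''h'' [*] V ''h'' [*] V ''h'')))
       [mod] (V ''q'' [-] Const 1)),
     asg ''s0'' (Const 0),
     asg ''s2'' (Const 0),
     asg ''x'' (Const 1),
     point_loop,
     Cond (V ''s0'') (Cond (V ''s2'') (asg ''fail'' (Const 1)) (asg ''yes'' (Const 1))) Skip,
     asg ''z'' (V ''z'' [+] Const 1)]"

definition query_loop :: com where
  "query_loop = While (V ''z'' [<] (V ''h'' [*] V ''h'' [*] V ''h'' [*] V ''h'' [*] V ''h'')) query"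

text \<open>The divisor starts at 0, so that it coincides with the round number. The values 0 and 1
  are harmless: \<open>q mod 0 = q\<close> is nonzero inside the loop, and 1 is excluded by the
  second test.\<close>

definition divisor_body :: com where
  "divisor_body = seqs [
     Cond (V ''q'' [mod] V ''d'') Skip (Cond (V ''d'' [<] Const 2) Skip (asg ''pr'' (Const 0))),
     asg ''d'' (V ''d'' [+] Const 1)]"

definition prime_test :: com where
  "prime_test = seqs [
     asg ''pr'' (Const 1 [<] V ''q''),
     asg ''d'' (Const 0),
     While (V ''d'' [<] V ''q'') divisor_body]"

text \<open>Raising to the power \<open>E = q ^ (16 * h - 1)\<close> lifts residues modulo
  \<open>q\<close> to roots of unity modulo \<open>M = q ^ (16 * h)\<close>. Trial division costs no
  more than the order of the summation over \<open>x\<close>. An accepting query settles the answer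
  even if others fail.\<close>

definition trial :: com where
  "trial = seqs [
     prime_test,
     Cond (V ''pr'') (seqs [
       powmod (V ''q'') (Const 16 [*] V ''h'' [-] Const 1) (V ''G''),
       asg ''E'' (V ''r''),
       asg ''M'' (V ''E'' [*] V ''q''),
       powmod (Const 2) (V ''h'') (V ''G''),
       asg ''B'' (V ''r''),
       asg ''yes'' (Const 0),
       asg ''fail'' (Const 0),
       asg ''z'' (Const 0),
       query_loop,
       Cond (V ''yes'') (seqs [asg ''out'' (Const 1), asg ''done'' (Const 1)])
         (Cond (V ''fail'') Skip (asg ''done'' (Const 1)))]) Skip]"

subsection \<open>Correctness of the deterministic parts\<close>

abbreviation htrue :: "mem \<Rightarrow> bool" where "htrue \<equiv> \<lambda>_. True"

definition upd :: "mem \<Rightarrow> vname \<Rightarrow> int \<Rightarrow> mem" where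
  "upd m x v = update m x 0 v"

lemma upd_same [simp]: "upd m x v x 0 = v"
  by (simp add: upd_def update_def)

lemma upd_other [simp]: "y \<noteq> x \<Longrightarrow> upd m x v y = m y"
  by (simp add: upd_def update_def)

lemma wp_asg:
  "m ''G'' 0 = g \<Longrightarrow> eval_expr m e mod g = v \<Longrightarrow> Q (upd m x v) \<Longrightarrow> wp htrue (asg x e) 1 Q m"
  unfolding asg_def by (rule wp_Assign) (simp_all add: upd_def)

lemma wp_seqs_Nil: "Q m \<Longrightarrow> wp htrue (seqs []) 1 Q m"
  unfolding seqs.simps by (rule wp_Skip) simp_all

lemma wp_seqs_Cons:
  "wp htrue c T1 (wp htrue (seqs cs) T2 Q) m \<Longrightarrow> wp htrue (seqs (c # cs)) (1 + T1 + T2) Q m"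
  unfolding seqs.simps by (rule wp_Seq) simp_all

lemma wp_seqs_asg:
  "m ''G'' 0 = g \<Longrightarrow> eval_expr m e mod g = v \<Longrightarrow> wp htrue (seqs cs) T Q (upd m x v) \<Longrightarrow>
   wp htrue (seqs (asg x e # cs)) (2 + T) Q m"
  using wp_seqs_Cons[OF wp_asg[where Q = "wp htrue (seqs cs) T Q"]] by simp

lemma wp_seqs_use:
  assumes "wp htrue c T1 R m"
    and "\<And>m'. R m' \<Longrightarrow> (\<And>x. x \<notin> mods c \<Longrightarrow> m' x = m x) \<Longrightarrow> wp htrue (seqs cs) T2 Q m'"
  shows "wp htrue (seqs (c # cs)) (1 + T1 + T2) Q m"
  by (rule wp_seqs_Cons, rule wp_use[OF assms(1) order_refl], rule assms(2)) auto

lemma wp_le: "wp G c T Q m \<Longrightarrow> T \<le> T' \<Longrightarrow> wp G c T' Q m"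
  by (rule wp_mono)

lemma mods_asg [simp]: "mods (asg x e) = {x}"
  by (simp add: asg_def)

lemma mods_powmod [simp]: "mods (powmod b e md) = {''pb'', ''pe'', ''pm'', ''r'', ''pc''}"
  by (auto simp: powmod_def)

definition big :: "nat \<Rightarrow> int" where
  "big h = 2 ^ (256 * h ^ 2)"

lemma big_pos: "big h > 0" by (simp add: big_def)

lemmas wp_step = wp_seqs_asg[where g = "big h" for h]

text \<open>
  A modulus equal to \<open>big h\<close> is stored as 0, which makes the inner reduction void and leaves
  the one performed by the assignment.
\<close>

lemma mod_mod_big: "0 < mv \<Longrightarrow> mv \<le> big h \<Longrightarrow> x mod (mv mod big h) mod big h = x mod mv"
proof (cases "mv = big h")
  case False
  assume mv: "0 < mv" "mv \<le> big h"
  hence "x mod mv < big h" "0 \<le> x mod mv" using pos_mod_bound[of mv x] by (simp_all del: pos_mod_bound)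
  thus ?thesis using mv False by simp
qed simp

text \<open>The expressions \<open>e\<close> and \<open>md\<close> are evaluated after
  \<open>''pb''\<close> and \<open>''pe''\<close> have been overwritten, hence the updated memories
  in the assumptions.\<close>

lemma wp_powmod:
  fixes h :: nat
  assumes G: "m ''G'' 0 = big h" and h: "m ''h'' 0 = int h"
    and b: "eval_expr m b = bv" "0 \<le> bv" "bv < big h"
    and e: "eval_expr (upd m ''pb'' bv) e = int xv" "int xv < big h"
    and md: "eval_expr (upd (upd m ''pb'' bv) ''pe'' (int xv)) md = mv"
    and mv: "0 < mv" "mv \<le> big h"
  shows "wp htrue (powmod b e md) (20 + 20 * (256 * h ^ 2)) (\<lambda>m'. m' ''r'' 0 = bv ^ xv mod mv) m"
proof -
  define H where "H = 256 * h ^ 2"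
  \<comment> \<open>Square and multiply keeps \<open>r * pb ^ pe\<close> constant modulo
    \<open>mv\<close>. The bound on \<open>pe\<close> forces it to 0 after \<open>H\<close> rounds;
    rounds with \<open>pe = 0\<close> do not change \<open>r\<close>.\<close>
  define I where "I = (\<lambda>i (m' :: mem). m' ''pc'' 0 = int i \<and> m' ''pm'' 0 = mv mod big h \<and> 0 \<le> m' ''pe'' 0 \<and>
    m' ''pe'' 0 < 2 ^ (H - i) \<and> m' ''r'' 0 mod mv = m' ''r'' 0 \<and>
    (m' ''r'' 0 * m' ''pb'' 0 ^ nat (m' ''pe'' 0)) mod mv = bv ^ xv mod mv)"
  define body where "body = seqs [
       Cond (V ''pe'' [mod] Const 2) (asg ''r'' (V ''r'' [*] V ''pb'' [mod] V ''pm'')) Skip,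
       asg ''pb'' (V ''pb'' [*] V ''pb'' [mod] V ''pm''),
       asg ''pe'' (V ''pe'' [div] Const 2),
       asg ''pc'' (V ''pc'' [+] Const 1)]"
  have mods: "mods body = {''r'', ''pb'', ''pe'', ''pc''}" by (auto simp: body_def)
  have H: "256 * int h * int h = int H" by (simp add: H_def power2_eq_square)
  have Hbig: "int H < big h" unfolding big_def H_def[symmetric]
    by (metis less_exp of_nat_less_iff of_nat_numeral of_nat_power)
  have bigH: "big h = 2 ^ H" by (simp add: big_def H_def)
  have step: "wp htrue body 14 (I (Suc i)) m'" 
    if i: "i < H" and I: "I i m'" and G': "m' ''G'' 0 = big h" for i m'
  proof -
    define E R P where "E = m' ''pe'' 0" and "R = m' ''r'' 0" and "P = m' ''pb'' 0"
    have E: "0 \<le> E" "E < 2 ^ (H - i)" using I by (auto simp: I_def E_def)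
    have pm: "m' ''pm'' 0 = mv mod big h" and pc: "m' ''pc'' 0 = int i" using I by (auto simp: I_def)
    have R: "R mod mv = R" and inv: "(R * P ^ nat E) mod mv = bv ^ xv mod mv"
      using I by (auto simp: I_def E_def R_def P_def)
    define R' where "R' = (if E mod 2 = 0 then R else (R * P) mod mv)"
    have E2: "E div 2 mod big h = E div 2"
    proof -
      have "(2::int) ^ (H - i) \<le> big h" unfolding bigH by (intro power_increasing) auto
      thus ?thesis using E by (intro mod_pos_pos_trivial) linarith+
    qed
    have i1: "(int i + 1) mod big h = int i + 1" using i Hbig by (intro mod_pos_pos_trivial) linarith+
    have E3: "E div 2 < 2 ^ (H - Suc i)"
    proof -
      have "(2::int) ^ (H - i) = 2 * 2 ^ (H - Suc i)" using i by (simp add: Suc_diff_Suc flip: power_Suc)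
      thus ?thesis using E by linarith
    qed
    have new: "(R' * ((P * P) mod mv) ^ nat (E div 2)) mod mv = bv ^ xv mod mv"
    proof -
      have nE: "nat E = 2 * nat (E div 2) + nat (E mod 2)" using E(1)
        by (metis nat_add_distrib nat_mult_distrib nat_numeral mult_div_mod_eq pos_mod_sign
            pos_imp_zdiv_nonneg_iff zero_le_mult_iff zero_le_numeral zero_less_numeral)
      have "(R' * ((P * P) mod mv) ^ nat (E div 2)) mod mv = (R' * (P * P) ^ nat (E div 2)) mod mv"
        by (metis mod_mult_right_eq power_mod)
      also have "\<dots> = (R * P ^ nat E) mod mv"
      proof (cases "E mod 2 = 0")
        case True
        thus ?thesis unfolding nE R'_def by (simp add: power_mult power2_eq_square)
      next
        case False
        hence "E mod 2 = 1" by presburger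
        thus ?thesis unfolding nE R'_def
          by (simp add: power_mult power2_eq_square mod_mult_left_eq power_mult_distrib algebra_simps)
      qed
      finally show ?thesis using inv by simp
    qed
    have R'm: "R' mod mv = R'" using R by (simp add: R'_def)
    show ?thesis unfolding body_def
      apply (rule wp_le)
       apply (rule wp_seqs_use[where R = "\<lambda>m1. m1 ''r'' 0 = R'"])
        apply (rule wp_Cond)
          apply simp
         apply (rule wp_asg[where m = m' and g = "big h"], rule G', rule refl)
         apply (simp add: R'_def pm mod_mod_big[OF mv] flip: E_def R_def P_def)
        apply (rule wp_Skip)
         apply simp
        apply (simp add: R'_def flip: E_def R_def P_def)
       apply (rule wp_step[where v = "(P * P) mod mv"], simp add: G')
        apply (simp add: pm mod_mod_big[OF mv] flip: P_def)
       apply (rule wp_step[where v = "E div 2"], simp add: G')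
        apply (simp add: E2 flip: E_def)
       apply (rule wp_step[where v = "int i + 1"], simp add: G')
        apply (simp add: pc i1)
       apply (rule wp_seqs_Nil)
      unfolding I_def
      using E E3 new R'm
       apply (simp add: pm pos_imp_zdiv_nonneg_iff)
      apply simp
      done
  qed
  have I0: "I 0 m'" if "m' ''pc'' 0 = 0" "m' ''pm'' 0 = mv mod big h" "m' ''pe'' 0 = int xv"
    "m' ''r'' 0 = 1 mod mv" "m' ''pb'' 0 = bv" for m'
    using that e(2) unfolding I_def bigH by (simp add: mod_mult_left_eq)
  have loop: "wp htrue (While (V ''pc'' [<] Const 256 [*] V ''h'' [*] V ''h'') body)
      (H * (14 + 1) + 1) (\<lambda>m'. m' ''r'' 0 = bv ^ xv mod mv) m'"
    if "I 0 m'" "m' ''G'' 0 = big h" "m' ''h'' 0 = int h" for m'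
  proof (rule wp_While[where I = I])
    show "I 0 m'" by fact
  next
    fix i m1 assume 1: "i < H" "I i m1" "\<And>x. x \<notin> mods body \<Longrightarrow> m1 x = m' x"
    have "m1 ''G'' 0 = big h" "m1 ''h'' 0 = int h" using 1(3)[of "''G''"] 1(3)[of "''h''"] that
      by (simp_all add: mods)
    thus "htrue m1 \<and> eval_expr m1 (V ''pc'' [<] Const 256 [*] V ''h'' [*] V ''h'') \<noteq> 0 \<and> wp htrue body 14 (I (Suc i)) m1"
      using step[OF 1(1,2)] 1(1,2) by (simp add: I_def H)
  next
    fix m1 assume 1: "I H m1" "\<And>x. x \<notin> mods body \<Longrightarrow> m1 x = m' x"
    have "m1 ''h'' 0 = int h" using 1(2)[of "''h''"] that by (simp_all add: mods)
    moreover have "m1 ''pe'' 0 = 0" using 1(1) by (simp add: I_def)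
    hence "m1 ''r'' 0 = bv ^ xv mod mv" using 1(1) by (simp add: I_def)
    ultimately show "htrue m1 \<and> eval_expr m1 (V ''pc'' [<] Const 256 [*] V ''h'' [*] V ''h'') = 0 \<and> m1 ''r'' 0 = bv ^ xv mod mv"
      using 1(1) by (simp add: I_def H)
  qed
  have evb: "int xv mod big h = int xv" "bv mod big h = bv" using e b by simp_all
  have one: "1 mod (mv mod big h) mod big h = 1 mod mv" by (rule mod_mod_big[OF mv])
  show ?thesis unfolding powmod_def body_def[symmetric]
    apply (rule wp_le)
     apply (rule wp_step[where v = bv], simp add: G)
      apply (simp add: b evb)
     apply (rule wp_step[where v = "int xv"], simp add: G)
      apply (simp add: e evb)
     apply (rule wp_step[where v = "mv mod big h"], simp add: G)
      apply (simp add: md)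
     apply (rule wp_step[where v = "1 mod mv"], simp add: G)
      apply (simp add: one)
     apply (rule wp_step[where v = 0], simp add: G)
      apply simp
     apply (rule wp_seqs_Cons)
     apply (rule wp_use[OF loop order_refl])
        apply (rule I0)
            apply (simp_all add: G h)
     apply (rule wp_Skip, simp, simp)
    apply (simp add: H_def)
    done
qed

section \<open>Evaluation of the moments by the program\<close>

definition t_pow :: "nat \<Rightarrow> nat" where "t_pow h = 20 + 20 * (256 * h ^ 2)"
definition t_item :: "nat \<Rightarrow> nat" where "t_item h = h * (t_pow h + 31) + 1"
definition t_point :: "nat \<Rightarrow> nat" where "t_point h = 2 * t_pow h + t_item h + 40"

lemma mods_loops [simp]:
  "mods item_body = {''a'', ''pb'', ''pe'', ''pm'', ''r'', ''pc'', ''p2'', ''p1'', ''p0'', ''e''}"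
  "mods item_loop = mods item_body"
  "mods point_body = mods item_body \<union> {''w'', ''s0'', ''s2'', ''x''}"
  "mods point_loop = mods point_body"
  "mods query = mods point_body \<union> {''k'', ''k2'', ''v'', ''s'', ''fail'', ''yes'', ''z''}"
  "mods query_loop = mods query"
  "mods divisor_body = {''pr'', ''d''}"
  "mods prime_test = {''pr'', ''d''}"
  by (auto simp: item_body_def item_loop_def point_body_def point_loop_def query_def query_loop_def
      divisor_body_def prime_test_def)

lemma moment_cong:
  assumes "[w = w'] (mod m)"
  shows "[moment c w a v s q A = moment c w' a v s q A] (mod m)"
  unfolding moment_def by (intro cong_sum cong_mult cong_pow assms cong_refl)

text \<open>Connects the assignments to \<open>p0\<close>, \<open>p1\<close> and \<open>p2\<close>,
  which operate on reduced values, with the recurrences of \<open>moment_insert\<close>.\<close>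

lemma mod_moment_steps:
  fixes a M t u x y :: int
  shows "(t mod M + y mod M * (t mod M)) mod M = (t + y * t) mod M"
    and "(u mod M + y mod M * (u mod M + a mod M * (t mod M))) mod M = (u + y * (u + a * t)) mod M"
    and "(x mod M + y mod M * (x mod M + 2 * (a mod M) * (u mod M) + a mod M * (a mod M) * (t mod M))) mod M =
      (x + y * (x + 2 * a * u + a * a * t)) mod M"
  unfolding cong_def[symmetric] by (intro cong_add cong_mult; simp add: cong_def)+

context instance_data
begin

definition env :: "mem \<Rightarrow> bool" where
  "env m \<longleftrightarrow> m ''G'' 0 = big h \<and> m ''h'' 0 = int h \<and> m ''n'' 0 = int n \<and> m ''t'' 0 = tt \<and>
     m ''b'' 0 = bb \<and> (\<forall>e\<in>{1..n}. m ''omega'' (int e) = int (om e) \<and> m ''nu'' (int e) = int (nv e))"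

lemma env_item:
  assumes "env m" "i < n"
  shows "m ''omega'' (int i + 1) = int (om (Suc i)) \<and> m ''nu'' (int i + 1) = int (nv (Suc i))"
proof -
  have "\<forall>e\<in>{1..n}. m ''omega'' (int e) = int (om e) \<and> m ''nu'' (int e) = int (nv e)"
    using assms(1) unfolding env_def by blast
  from bspec[OF this, of "Suc i"] assms(2) show ?thesis by (simp add: add.commute)
qed

definition modulus :: "nat \<Rightarrow> int" where
  "modulus q = int q ^ (16 * h)"

definition env_mod :: "nat \<Rightarrow> mem \<Rightarrow> bool" where
  "env_mod q m \<longleftrightarrow> env m \<and> m ''q'' 0 = int q \<and> m ''M'' 0 = modulus q \<and> m ''B'' 0 = 2 ^ h \<and>
     m ''E'' 0 = int (q ^ (16 * h - 1))"

definition env_query :: "nat \<Rightarrow> nat \<Rightarrow> mem \<Rightarrow> bool" where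
  "env_query q z m \<longleftrightarrow> env_mod q m \<and> m ''z'' 0 = int z \<and> m ''k'' 0 = 2 ^ (z mod h) \<and>
     m ''k2'' 0 = 2 ^ (z div h mod h) \<and> m ''v'' 0 = goal z mod modulus q \<and>
     m ''s'' 0 = int (shift q z)"

lemma h_power_less_big: "int (h ^ 5) + 1 < big h"
proof -
  have "h ^ 5 < (2 ^ h) ^ 5" by (intro power_strict_mono less_exp) simp_all
  hence "h ^ 5 < 2 ^ (h * 5)" by (simp only: power_mult)
  hence 1: "int (h ^ 5) < 2 ^ (h * 5)" by (metis of_nat_less_iff of_nat_numeral of_nat_power)
  have "(2::int) ^ (h * 5) + 2 ^ (h * 5) = 2 ^ Suc (h * 5)" by simp
  also have "\<dots> \<le> big h" unfolding big_def
  proof (intro power_increasing)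
    have "Suc (h * 5) \<le> 256 * h" using h_pos by simp
    also have "\<dots> \<le> 256 * h ^ 2" using h_pos by (simp add: power2_eq_square)
    finally show "Suc (h * 5) \<le> 256 * h ^ 2" .
  qed simp
  finally show ?thesis using 1 by (smt (verit) one_le_power)
qed

lemma h_less_big: "int h + 1 < big h"
proof -
  have "h \<le> h ^ 5" using h_pos by (intro self_le_power) auto
  hence "int h \<le> int (h ^ 5)" by (simp only: of_nat_le_iff)
  thus ?thesis using h_power_less_big by linarith
qed

text \<open>\<open>big h\<close> is \<open>(2 ^ (16 * h)) ^ (16 * h)\<close>, which gives the upper
  bound. The lower bound \<open>2 ^ (16 * h)\<close> holds already because \<open>q\<close> is at
  least 2; it makes the sums exact for small primes as well.\<close>

lemma modulus_bounds:
  assumes "1 < q" "q < 2 ^ (16 * h)"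
  shows "modulus q < big h" "0 < modulus q" "int q \<le> modulus q" "2 ^ (16 * h) \<le> modulus q"
    "int (q ^ (16 * h - 1)) < big h" "int (q ^ (16 * h - 1)) * int q = modulus q" "int q dvd modulus q"
proof -
  have "int q < 2 ^ (16 * h)" using assms(2) by (metis of_nat_less_iff of_nat_numeral of_nat_power)
  hence "modulus q < (2 ^ (16 * h)) ^ (16 * h)" unfolding modulus_def using h_pos
    by (intro power_strict_mono) auto
  also have "\<dots> = big h" unfolding power_mult[symmetric] big_def by (simp add: power2_eq_square algebra_simps)
  finally show M: "modulus q < big h" .
  show "0 < modulus q" using assms by (simp add: modulus_def)
  show "int q \<le> modulus q" using assms h_pos unfolding modulus_def by (intro self_le_power) auto
  show "2 ^ (16 * h) \<le> modulus q" using assms unfolding modulus_def by (intro power_mono) auto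
  show e: "int (q ^ (16 * h - 1)) * int q = modulus q" unfolding modulus_def using h_pos
    by (metis (no_types, lifting) mult_is_0 neq0_conv of_nat_power power_minus_mult zero_neq_numeral)
  have "int (q ^ (16 * h - 1)) * 1 \<le> int (q ^ (16 * h - 1)) * int q" using assms by (intro mult_left_mono) auto
  thus "int (q ^ (16 * h - 1)) < big h" using e M by simp
  show "int q dvd modulus q" using e by (metis dvd_triv_right)
qed

lemma wp_item_loop:
  assumes q: "1 < q" "q < 2 ^ (16 * h)" and env: "env_query q z m" and W: "m ''w'' 0 = W" "0 \<le> W" "W < modulus q"
    and e: "m ''e'' 0 = 1"
    and p: "m ''p0'' 0 = moment 0 W (item z) (goal z) (shift q z) q {} mod modulus q"
      "m ''p1'' 0 = moment 1 W (item z) (goal z) (shift q z) q {} mod modulus q"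
      "m ''p2'' 0 = moment 2 W (item z) (goal z) (shift q z) q {} mod modulus q"
  shows "wp htrue item_loop (t_item h) (\<lambda>m'.
      m' ''p0'' 0 = moment 0 W (item z) (goal z) (shift q z) q {1..n} mod modulus q \<and>
      m' ''p2'' 0 = moment 2 W (item z) (goal z) (shift q z) q {1..n} mod modulus q) m"
proof -
  note mb = modulus_bounds[OF q]
  define M where "M = modulus q"
  define P where "P = (\<lambda>c i. moment c W (item z) (goal z) (shift q z) q {1..i})"
  define I where "I = (\<lambda>i (m' :: mem). m' ''e'' 0 = int i + 1 \<and> m' ''p0'' 0 = P 0 i mod M \<and>
    m' ''p1'' 0 = P 1 i mod M \<and> m' ''p2'' 0 = P 2 i mod M)"
  have M: "0 < M" "M < big h" "int q dvd M" using mb by (simp_all add: M_def)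
  have mM: "x mod M mod big h = x mod M" for x
    using M pos_mod_bound[of M x] pos_mod_sign[of M x] by (intro mod_pos_pos_trivial) linarith+
  show ?thesis unfolding item_loop_def
  proof (rule wp_le, rule wp_While[where I = I and N = n and T = "t_pow h + 30"])
    show "I 0 m" using e p by (simp add: I_def P_def M_def)
  next
    fix i m1
    assume i: "i < n" and I: "I i m1" and fr: "\<And>x. x \<notin> mods item_body \<Longrightarrow> m1 x = m x"
    have m1: "m1 ''G'' 0 = big h" "m1 ''h'' 0 = int h" "m1 ''n'' 0 = int n" "m1 ''M'' 0 = M"
      "m1 ''q'' 0 = int q" "m1 ''w'' 0 = W" "m1 ''B'' 0 = 2 ^ h" "m1 ''k'' 0 = 2 ^ (z mod h)"
      "m1 ''k2'' 0 = 2 ^ (z div h mod h)"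
      using env W by (simp_all add: fr env_query_def env_mod_def env_def M_def)
    have m2: "m1 ''omega'' (int i + 1) = int (om (Suc i))" "m1 ''nu'' (int i + 1) = int (nv (Suc i))"
      using env env_item[OF _ i] by (simp_all add: fr env_query_def env_mod_def)
    define a where "a = item z (Suc i)"
    define y where "y = W ^ nat (a mod int q)"
    have ie: "m1 ''e'' 0 = int i + 1" "m1 ''p0'' 0 = P 0 i mod M" "m1 ''p1'' 0 = P 1 i mod M" "m1 ''p2'' 0 = P 2 i mod M"
      using I by (simp_all add: I_def)
    have aval: "4 * int h * (int (om (Suc i)) div 2 ^ (z mod h) * 2 ^ h + (- int (nv (Suc i))) div 2 ^ (z div h mod h)) = a"
      by (simp add: a_def item_def)
    have ins: "{1..Suc i} = insert (Suc i) {1..i}" by auto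
    have P: "P 0 (Suc i) = P 0 i + y * P 0 i" "P 1 (Suc i) = P 1 i + y * (P 1 i + a * P 0 i)"
      "P 2 (Suc i) = P 2 i + y * (P 2 i + 2 * a * P 1 i + a * a * P 0 i)"
      unfolding P_def ins y_def a_def by (rule moment_insert; simp)+
    have amod: "a mod M mod int q = int (nat (a mod int q))"
      using M(3) q by (simp add: mod_mod_cancel)
    have aq: "a mod int q < big h" "0 \<le> a mod int q"
      using q mb(1,3) pos_mod_bound[of "int q" a] pos_mod_sign[of "int q" a] by linarith+
    have e2: "(2 + int i) mod big h = int i + 2"
    proof -
      have "0 \<le> 2 + int i" "2 + int i < big h" using i n_less_h h_less_big by linarith+
      thus ?thesis by simp
    qed
    have wb: "W < big h" using W mb by simp
    have "wp htrue item_body (t_pow h + 30) (I (Suc i)) m1" unfolding item_body_def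
      apply (rule wp_le)
       apply (rule wp_step[where v = "a mod M"], simp add: m1)
        apply (simp add: m1 m2 ie aval mM)
       apply (rule wp_seqs_use)
        apply (rule wp_powmod[where h = h and bv = W and xv = "nat (a mod int q)" and mv = M]; simp add: m1 W wb amod aq M less_imp_le[OF M(2)])
      apply (rule wp_step[where v = "P 2 (Suc i) mod M"], simp add: m1)
       apply (simp add: m1 ie mM P P(2)[unfolded One_nat_def] mod_moment_steps flip: y_def)
      apply (rule wp_step[where v = "P 1 (Suc i) mod M"], simp add: m1)
       apply (simp add: m1 ie mM P P(2)[unfolded One_nat_def] mod_moment_steps flip: y_def)
      apply (rule wp_step[where v = "P 0 (Suc i) mod M"], simp add: m1)
       apply (simp add: m1 ie mM P P(2)[unfolded One_nat_def] mod_moment_steps flip: y_def)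
      apply (rule wp_step[where v = "int i + 2"], simp add: m1)
       apply (simp add: m1 ie e2)
      apply (rule wp_seqs_Nil)
      apply (simp add: I_def)
      apply (simp add: t_pow_def)
      done
    thus "htrue m1 \<and> eval_expr m1 (V ''e'' [<] V ''n'' [+] Const 1) \<noteq> 0 \<and> wp htrue item_body (t_pow h + 30) (I (Suc i)) m1"
      using i by (simp add: m1 ie)
  next
    fix m1 assume "I n m1" and fr: "\<And>x. x \<notin> mods item_body \<Longrightarrow> m1 x = m x"
    thus "htrue m1 \<and> eval_expr m1 (V ''e'' [<] V ''n'' [+] Const 1) = 0 \<and>
      m1 ''p0'' 0 = moment 0 W (item z) (goal z) (shift q z) q {1..n} mod modulus q \<and>
      m1 ''p2'' 0 = moment 2 W (item z) (goal z) (shift q z) q {1..n} mod modulus q"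
      using env by (simp add: I_def P_def M_def fr env_query_def env_mod_def env_def)
  next
    have e: "t_pow h + 30 + 1 = t_pow h + 31" by simp
    show "n * (t_pow h + 30 + 1) + 1 \<le> t_item h"
      unfolding t_item_def e using n_less_h by (intro add_mono mult_right_mono) auto
  qed
qed

lemma env_query_frame:
  assumes "env_query q z m" "\<And>x. x \<in> {''G'', ''h'', ''n'', ''t'', ''b'', ''omega'', ''nu'', ''q'', ''M'', ''B'', ''E'',
      ''z'', ''k'', ''k2'', ''v'', ''s''} \<Longrightarrow> m' x = m x"
  shows "env_query q z m'"
  using assms(1) unfolding env_query_def env_mod_def env_def by (simp add: assms(2))

lemma env_mod_frame:
  assumes "env_mod q m" "\<And>x. x \<in> {''G'', ''h'', ''n'', ''t'', ''b'', ''omega'', ''nu'', ''q'', ''M'', ''B'', ''E''} \<Longrightarrow> m' x = m x"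
  shows "env_mod q m'"
  using assms(1) unfolding env_mod_def env_def by (simp add: assms(2))

lemma env_frame:
  assumes "env m" "\<And>x. x \<in> {''G'', ''h'', ''n'', ''t'', ''b'', ''omega'', ''nu''} \<Longrightarrow> m' x = m x"
  shows "env m'"
  using assms(1) unfolding env_def by (simp add: assms(2))

definition point_sum :: "nat \<Rightarrow> nat \<Rightarrow> nat \<Rightarrow> nat \<Rightarrow> int" where
  "point_sum c q z i = (\<Sum>x\<in>{1..<Suc i}. moment c (int x ^ (q ^ (16 * h - 1))) (item z) (goal z) (shift q z) q {1..n})"

lemma shift_less: "1 < q \<Longrightarrow> shift q z < q"
proof -
  assume "1 < q"
  hence "(- (goal z mod int q + int (z div h ^ 4))) mod (int q - 1) < int q - 1" by simp
  thus "shift q z < q" using \<open>1 < q\<close> unfolding shift_def by linarith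
qed

lemma wp_point_loop:
  assumes q: "1 < q" "q < 2 ^ (16 * h)" and env: "env_query q z m"
    and x: "m ''x'' 0 = 1" "m ''s0'' 0 = 0" "m ''s2'' 0 = 0"
  shows "wp htrue point_loop ((q - 1) * (t_point h + 1) + 1) (\<lambda>m'.
      m' ''s0'' 0 = point_sum 0 q z (q - 1) mod modulus q \<and> m' ''s2'' 0 = point_sum 2 q z (q - 1) mod modulus q) m"
proof -
  note mb = modulus_bounds[OF q]
  define M where "M = modulus q"
  define I where "I = (\<lambda>i (m' :: mem). m' ''x'' 0 = int i + 1 \<and> m' ''s0'' 0 = point_sum 0 q z i mod M \<and>
    m' ''s2'' 0 = point_sum 2 q z i mod M)"
  have M: "0 < M" "M < big h" "int q dvd M" "int q \<le> M" using mb by (simp_all add: M_def)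
  have mM: "x mod M mod big h = x mod M" for x
    using M pos_mod_bound[of M x] pos_mod_sign[of M x] by (intro mod_pos_pos_trivial) linarith+
  show ?thesis unfolding point_loop_def
  proof (rule wp_While[where I = I])
    show "I 0 m" using x by (simp add: I_def point_sum_def)
  next
    fix i m1
    assume i: "i < q - 1" and I: "I i m1" and fr: "\<And>x. x \<notin> mods point_body \<Longrightarrow> m1 x = m x"
    have env1: "env_query q z m1" by (rule env_query_frame[OF env]) (auto simp: fr)
    have m1: "m1 ''G'' 0 = big h" "m1 ''h'' 0 = int h" "m1 ''M'' 0 = M" "m1 ''q'' 0 = int q"
      "m1 ''E'' 0 = int (q ^ (16 * h - 1))" "m1 ''s'' 0 = int (shift q z)" "m1 ''v'' 0 = goal z mod M"
      using env1 by (simp_all add: env_query_def env_mod_def env_def M_def)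
    have ie: "m1 ''x'' 0 = int i + 1" "m1 ''s0'' 0 = point_sum 0 q z i mod M" "m1 ''s2'' 0 = point_sum 2 q z i mod M"
      using I by (simp_all add: I_def)
    define U where "U = (int i + 1) ^ (q ^ (16 * h - 1))"
    define W where "W = U mod M"
    define F where "F = (\<lambda>c A. moment c W (item z) (goal z) (shift q z) q A)"
    have W: "0 \<le> W" "W < M" using M by (simp_all add: W_def)
    have S: "point_sum c q z (Suc i) mod M = (point_sum c q z i mod M + F c {1..n} mod M) mod M" for c
    proof -
      have "{1..<Suc (Suc i)} = insert (Suc i) {1..<Suc i}" by auto
      hence "point_sum c q z (Suc i) = moment c U (item z) (goal z) (shift q z) q {1..n} + point_sum c q z i"
        unfolding point_sum_def U_def by (simp add: add.commute)
      moreover have "moment c U (item z) (goal z) (shift q z) q {1..n} mod M = F c {1..n} mod M"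
        unfolding F_def W_def cong_def[symmetric] by (intro moment_cong) (simp add: cong_def)
      ultimately show ?thesis by (metis add.commute mod_add_eq)
    qed
    have F: "F 0 {} mod M = W ^ shift q z mod M" "F 1 {} mod M = (- (goal z mod M)) * (W ^ shift q z mod M) mod M"
      "F 2 {} mod M = (goal z mod M) * (goal z mod M) * (W ^ shift q z mod M) mod M"
      unfolding F_def moment_empty power_one_right power2_eq_square minus_mult_minus cong_def[symmetric]
      by (simp, (intro cong_mult; simp add: cong_def mod_minus_eq)+)
    have sb: "int (shift q z) < big h" using shift_less[OF q(1), of z] M by linarith
    have i2: "(2 + int i) mod big h = int i + 2" "int i + 1 < big h"
    proof -
      have "2 + int i < big h" using i M by linarith
      thus "(2 + int i) mod big h = int i + 2" "int i + 1 < big h" by simp_all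
    qed
    have Wb: "W < big h" "W mod big h = W" using W M by simp_all
    have one: "1 mod big h = 1" using h_less_big by simp
    have "wp htrue point_body (t_point h) (I (Suc i)) m1" unfolding point_body_def
      apply (rule wp_le)
       apply (rule wp_seqs_use)
        apply (rule wp_powmod[where h = h and bv = "int i + 1" and xv = "q ^ (16 * h - 1)" and mv = M]; simp add: m1 ie i2 mb(5)[simplified] M less_imp_le[OF M(2)])
      apply (rule wp_step[where v = W], simp add: m1)
       apply (simp add: mM U_def W_def)
      apply (rule wp_seqs_use)
       apply (rule wp_powmod[where h = h and bv = W and xv = "shift q z" and mv = M]; simp add: m1 W Wb sb M less_imp_le[OF M(2)])
      apply (rule wp_step[where v = "F 0 {} mod M"], simp add: m1)
       apply (simp add: mM F)
      apply (rule wp_step[where v = "F 1 {} mod M"], simp add: m1)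
       apply (simp add: m1 mM F F(2)[unfolded One_nat_def])
      apply (rule wp_step[where v = "F 2 {} mod M"], simp add: m1)
       apply (simp add: m1 mM F F(2)[unfolded One_nat_def])
      apply (rule wp_step[where v = 1], simp add: m1)
       apply (simp add: one)
      apply (rule wp_seqs_use)
       apply (rule wp_item_loop[OF q, where z = z and W = W])
             apply (rule env_query_frame[OF env1]) 
             apply (elim insertE emptyE; simp)
            apply simp
           apply (simp add: W)
          apply (use W in \<open>simp add: M_def\<close>)
         apply simp
        apply (simp add: F_def M_def)
       apply (simp add: F_def M_def)
      apply (simp add: F_def M_def)
      apply (rule wp_step[where v = "point_sum 0 q z (Suc i) mod M"], simp add: m1)
       apply (simp add: m1 ie mM S F_def flip: M_def)
      apply (rule wp_step[where v = "point_sum 2 q z (Suc i) mod M"], simp add: m1)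
       apply (simp add: m1 ie mM S F_def flip: M_def)
      apply (rule wp_step[where v = "int i + 2"], simp add: m1)
       apply (simp add: m1 ie i2)
      apply (rule wp_seqs_Nil)
      apply (simp add: I_def)
      apply (simp add: t_point_def t_pow_def)
      done
    thus "htrue m1 \<and> eval_expr m1 (V ''x'' [<] V ''q'') \<noteq> 0 \<and> wp htrue point_body (t_point h) (I (Suc i)) m1"
      using i by (simp add: m1 ie)
  next
    fix m1 assume I: "I (q - 1) m1" and fr: "\<And>x. x \<notin> mods point_body \<Longrightarrow> m1 x = m x"
    have env1: "env_query q z m1" by (rule env_query_frame[OF env]) (auto simp: fr)
    show "htrue m1 \<and> eval_expr m1 (V ''x'' [<] V ''q'') = 0 \<and>
      m1 ''s0'' 0 = point_sum 0 q z (q - 1) mod modulus q \<and> m1 ''s2'' 0 = point_sum 2 q z (q - 1) mod modulus q"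
      using env1 I q by (simp add: I_def M_def env_query_def env_mod_def of_nat_diff)
  qed
qed

end

definition t_queries :: "nat \<Rightarrow> nat \<Rightarrow> nat" where
  "t_queries h q = h ^ 5 * (q * (t_point h + 1) + 2 * t_pow h + 61) + 1"

definition t_prime :: "nat \<Rightarrow> nat" where "t_prime q = q * 20 + 20"

context instance_data
begin

section \<open>Exactness of the zero tests, and the outcome of a trial\<close>

lemma point_sum_cong:
  assumes "prime q"
  shows "point_sum c q z (q - 1) mod modulus q = ((int q - 1) * (\<Sum>X\<in>bin q z. ((\<Sum>e\<in>X. item z e) - goal z) ^ c)) mod modulus q"
proof -
  have "Suc (q - 1) = q" "Suc (16 * h - 1) = 16 * h" using prime_gt_0_nat[OF assms] h_pos by simp_all
  thus ?thesis
    using sum_moment[OF assms, of "{1..n}" c "16 * h - 1" "item z" "goal z" "shift q z"]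
    by (simp add: point_sum_def bin_def cong_def modulus_def del: One_nat_def)
qed

text \<open>A bin has at most \<open>2 ^ n\<close> members with squared deviations of at most
  \<open>2 ^ (8 * h)\<close>, so its size and its second moment are below the modulus. A vanishing
  second moment means that each square vanishes.\<close>

lemma sums_zero_iff:
  assumes q: "prime q" "q < 2 ^ (16 * h)"
  shows "point_sum 0 q z (q - 1) mod modulus q = 0 \<longleftrightarrow> bin q z = {}"
    and "point_sum 2 q z (q - 1) mod modulus q = 0 \<longleftrightarrow> \<not> fails q z"
proof -
  have q1: "1 < q" using q prime_gt_1_nat by blast
  have fin: "finite (bin q z)" by (simp add: bin_def)
  have "card (bin q z) \<le> card (Pow {1..n})" by (intro card_mono) (auto simp: bin_def)
  hence card: "int (card (bin q z)) \<le> 2 ^ n" by (simp add: card_Pow)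
  have less: "x < modulus q" if "x \<le> 2 ^ (n + 8 * h)" for x
  proof -
    have "(2::int) ^ (n + 8 * h) < 2 ^ (16 * h)" using n_less_h by (intro power_strict_increasing) auto
    thus ?thesis using that modulus_bounds(4)[OF q1 q(2)] by linarith
  qed
  have "(2::int) ^ n \<le> 2 ^ (n + 8 * h)" by (intro power_increasing) auto
  hence c: "int (card (bin q z)) < modulus q" using card by (intro less) linarith
  have "point_sum 0 q z (q - 1) mod modulus q = ((int q - 1) * int (card (bin q z))) mod modulus q"
    using point_sum_cong[OF q(1), of 0 z] by simp
  also have "\<dots> = 0 \<longleftrightarrow> int (card (bin q z)) = 0" using c unfolding modulus_def
    by (intro mult_pred_mod_prime_power_eq_0_iff[OF q(1)]) auto
  finally show "point_sum 0 q z (q - 1) mod modulus q = 0 \<longleftrightarrow> bin q z = {}" using fin by simp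
  define D where "D = (\<lambda>X. (\<Sum>e\<in>X. item z e) - goal z)"
  define Y where "Y = (\<Sum>X\<in>bin q z. D X ^ 2)"
  have D: "D X ^ 2 \<le> 2 ^ (8 * h)" if "X \<in> bin q z" for X
  proof -
    have "\<bar>D X\<bar> \<le> 2 ^ (4 * h)" 
      using item_sum_minus_goal_bound[of X 0 z] that by (auto simp: D_def bin_def)
    hence "\<bar>D X\<bar> ^ 2 \<le> (2 ^ (4 * h)) ^ 2" by (intro power_mono) auto
    thus ?thesis by (simp add: mult.commute flip: power_mult)
  qed
  have "Y \<le> (\<Sum>X\<in>bin q z. 2 ^ (8 * h))" unfolding Y_def by (intro sum_mono D)
  also have "\<dots> = int (card (bin q z)) * 2 ^ (8 * h)" by simp
  also have "\<dots> \<le> 2 ^ n * 2 ^ (8 * h)" by (intro mult_right_mono card) auto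
  finally have Y: "Y < modulus q" by (intro less) (simp add: power_add)
  have Y0: "0 \<le> Y" unfolding Y_def by (intro sum_nonneg) auto
  have "point_sum 2 q z (q - 1) mod modulus q = ((int q - 1) * Y) mod modulus q"
    unfolding Y_def D_def by (rule point_sum_cong[OF q(1)])
  also have "\<dots> = 0 \<longleftrightarrow> Y = 0" using Y Y0 unfolding modulus_def
    by (intro mult_pred_mod_prime_power_eq_0_iff[OF q(1)])
  also have "Y = 0 \<longleftrightarrow> (\<forall>X\<in>bin q z. D X = 0)" unfolding Y_def using fin by (subst sum_nonneg_eq_0_iff) auto
  finally show "point_sum 2 q z (q - 1) mod modulus q = 0 \<longleftrightarrow> \<not> fails q z"
    by (simp add: fails_def D_def)
qed

lemma int_shift:
  assumes "1 < q"
  shows "int (shift q z) = (- (goal z mod int q + int z div (int h * int h * int h * int h))) mod (int q - 1)"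
proof -
  have "0 \<le> (- (goal z mod int q + int (z div h ^ 4))) mod (int q - 1)" using assms by simp
  thus ?thesis unfolding shift_def by (simp add: of_nat_div power4_eq_xxxx mult.assoc)
qed

lemma pow_less_big: "i \<le> h \<Longrightarrow> 2 ^ i < big h" "i \<le> h \<Longrightarrow> 2 ^ i mod big h = 2 ^ i"
proof -
  assume "i \<le> h"
  moreover have "h \<le> h ^ 2" using h_pos by (intro self_le_power) auto
  ultimately have "i < 256 * h ^ 2" using h_pos by linarith
  thus "2 ^ i < big h" unfolding big_def by (intro power_strict_increasing) auto
  thus "2 ^ i mod big h = 2 ^ i" by simp
qed

lemma wp_query:
  assumes q: "prime q" "q < 2 ^ (16 * h)" and env: "env_mod q m" and z: "m ''z'' 0 = int z" "z < h ^ 5"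
    and yf: "m ''yes'' 0 = of_bool A" "m ''fail'' 0 = of_bool F"
  shows "wp htrue query (q * (t_point h + 1) + 2 * t_pow h + 60) (\<lambda>m'. m' ''z'' 0 = int z + 1 \<and>
      m' ''yes'' 0 = of_bool (A \<or> accepts q z) \<and> m' ''fail'' 0 = of_bool (F \<or> fails q z)) m"
proof -
  have q1: "1 < q" using q prime_gt_1_nat by blast
  note mb = modulus_bounds[OF q1 q(2)]
  define M where "M = modulus q"
  have M: "0 < M" "M < big h" "int q dvd M" "int q \<le> M" using mb by (simp_all add: M_def)
  have mM: "x mod M mod big h = x mod M" for x
    using M pos_mod_bound[of M x] pos_mod_sign[of M x] by (intro mod_pos_pos_trivial) linarith+
  have m: "m ''G'' 0 = big h" "m ''h'' 0 = int h" "m ''M'' 0 = M" "m ''q'' 0 = int q" "m ''B'' 0 = 2 ^ h"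
    "m ''t'' 0 = tt" "m ''b'' 0 = bb"
    using env by (simp_all add: env_mod_def env_def M_def)
  have dg: "z mod h < h" "z div h mod h < h" using h_pos by simp_all
  have dgb: "int (z mod h) < big h" "int (z div h mod h) < big h" using dg h_less_big by linarith+
  have pw: "2 ^ (z mod h) mod big h = 2 ^ (z mod h)" "2 ^ (z div h mod h) mod big h = 2 ^ (z div h mod h)"
    using dg by (auto intro!: pow_less_big)
  have two: "2 < big h" using h_less_big h_def by linarith
  have sb: "int (shift q z) mod big h = int (shift q z)" using shift_less[OF q1, of z] M by simp
  have zb: "(int z + 1) mod big h = int z + 1"
  proof -
    have "int z < int (h ^ 5)" using z(2) by (simp only: of_nat_less_iff)
    hence "int z + 1 < big h" using h_power_less_big by linarith
    thus ?thesis by simp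
  qed
  have one: "1 mod big h = 1" using h_less_big by simp
  have gv: "(4 * int h * ((0 - (0 - tt) div 2 ^ (z mod h) + int z div (int h * int h) mod int h) * 2 ^ h
      + (0 - bb div 2 ^ (z div h mod h) + int z div (int h * int h * int h) mod int h))) = goal z"
    by (simp add: goal_def of_nat_mod of_nat_div power2_eq_square power3_eq_cube)
  have gq: "goal z mod M mod int q = goal z mod int q" using M by (simp add: mod_mod_cancel)
  have acc: "accepts q z \<longleftrightarrow> bin q z \<noteq> {} \<and> \<not> fails q z" by (auto simp: accepts_def fails_def)
  have qq: "(q - 1) * (t_point h + 1) \<le> q * (t_point h + 1)" by (intro mult_right_mono) auto
  note zero = sums_zero_iff[OF q] sums_zero_iff[OF q, unfolded One_nat_def]
  \<comment> \<open>Justifies testing \<open>s0\<close> first: an empty bin neither accepts nor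
    fails.\<close>
  have fb: "fails q z \<Longrightarrow> bin q z \<noteq> {}" by (auto simp: fails_def)
  show ?thesis unfolding query_def
    apply (rule wp_le)
     apply (rule wp_seqs_use)
      apply (rule wp_powmod[where h = h and bv = 2 and xv = "z mod h" and mv = "big h"]; simp add: m z two of_nat_mod dgb[unfolded of_nat_mod] big_pos)
    apply (rule wp_step[where v = "2 ^ (z mod h)"], simp add: m)
     apply (simp add: pw)
    apply (rule wp_seqs_use)
     apply (rule wp_powmod[where h = h and bv = 2 and xv = "z div h mod h" and mv = "big h"]; simp add: m z two of_nat_mod of_nat_div dgb[unfolded of_nat_mod of_nat_div] big_pos)
    apply (rule wp_step[where v = "2 ^ (z div h mod h)"], simp add: m)
     apply (simp add: pw)
    apply (rule wp_step[where v = "goal z mod M"], simp add: m)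
     apply (simp only: eval_expr.simps apply_binop.simps)
     apply (subst gv[symmetric])
     apply (simp add: m z mM)
    apply (rule wp_step[where v = "int (shift q z)"], simp add: m)
     apply (subst sb[symmetric])
     apply (simp add: m z gq int_shift[OF q1])
    apply (rule wp_step[where v = 0], simp add: m)
     apply simp
    apply (rule wp_step[where v = 0], simp add: m)
     apply simp
    apply (rule wp_step[where v = 1], simp add: m)
     apply (simp add: one)
    apply (rule wp_seqs_use)
     apply (rule wp_point_loop[OF q1 q(2), where z = z])
        apply (unfold env_query_def)[1]
        apply (intro conjI)
             apply (rule env_mod_frame[OF env])
             apply (elim insertE emptyE; simp)
            apply (simp add: z)
           apply simp
          apply simp
         apply (simp add: M_def)
        apply simp
       apply simp
      apply simp
     apply simp
    apply (rule wp_seqs_use[where R = "\<lambda>m1. m1 ''yes'' 0 = of_bool (A \<or> accepts q z) \<and> m1 ''fail'' 0 = of_bool (F \<or> fails q z)"])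
     apply (rule wp_Cond[where T = 2])
       apply simp
      apply (rule wp_le, rule wp_Cond[where T = 1])
         apply simp
        apply (rule wp_asg[where g = "big h" and v = 1])
          apply (simp add: m)
         apply (simp add: one)
        apply (simp add: yf zero acc)
       apply (rule wp_asg[where g = "big h" and v = 1])
         apply (simp add: m)
        apply (simp add: one)
       apply (simp add: yf zero acc)
      apply simp
     apply (rule wp_le, rule wp_Skip)
       apply simp
      apply (use fb in \<open>auto simp: yf zero acc\<close>)[1]
     apply simp
    apply (rule wp_step[where v = "int z + 1"], simp add: m)
     apply (simp add: z zb)
    apply (rule wp_seqs_Nil)
    apply simp
    apply (unfold t_pow_def)
    apply (rule order_trans[OF _ add_mono[OF add_mono[OF qq order_refl] order_refl]])
    apply simp
    done
qed

lemma wp_query_loop: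
  assumes q: "prime q" "q < 2 ^ (16 * h)" and env: "env_mod q m" and z: "m ''z'' 0 = 0"
    and yf: "m ''yes'' 0 = 0" "m ''fail'' 0 = 0"
  shows "wp htrue query_loop (t_queries h q) (\<lambda>m'.
      m' ''yes'' 0 = of_bool (\<exists>z<h ^ 5. accepts q z) \<and> m' ''fail'' 0 = of_bool (\<exists>z<h ^ 5. fails q z)) m"
proof -
  define I where "I = (\<lambda>i (m' :: mem). m' ''z'' 0 = int i \<and>
    m' ''yes'' 0 = of_bool (\<exists>z<i. accepts q z) \<and> m' ''fail'' 0 = of_bool (\<exists>z<i. fails q z))"
  have guard: "eval_expr m1 (V ''z'' [<] (V ''h'' [*] V ''h'' [*] V ''h'' [*] V ''h'' [*] V ''h'')) = of_bool (i < h ^ 5)"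
    if "I i m1" "m1 ''h'' 0 = int h" for i m1
  proof -
    have "int h * int h * int h * int h * int h = int (h ^ 5)" by (simp add: eval_nat_numeral)
    thus ?thesis using that by (simp add: I_def del: of_nat_power)
  qed
  show ?thesis unfolding query_loop_def
  proof (rule wp_le, rule wp_While[where I = I and N = "h ^ 5"])
    show "I 0 m" using z yf by (simp add: I_def)
  next
    fix i m1
    assume i: "i < h ^ 5" and I: "I i m1" and fr: "\<And>x. x \<notin> mods query \<Longrightarrow> m1 x = m x"
    have env1: "env_mod q m1" by (rule env_mod_frame[OF env]) (auto simp: fr)
    have h1: "m1 ''h'' 0 = int h" using env1 by (simp add: env_mod_def env_def)
    have "wp htrue query (q * (t_point h + 1) + 2 * t_pow h + 60) (I (Suc i)) m1"
      apply (rule wp_mono)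
        apply (rule wp_query[OF q env1])
           apply (use I in \<open>simp add: I_def\<close>)
          apply (rule i)
         apply (use I in \<open>simp only: I_def\<close>)
        apply (use I in \<open>simp only: I_def\<close>)
       apply (rule order_refl)
      apply (simp add: I_def less_Suc_eq ex_disj_distrib conj_disj_distribR)
      done
    thus "htrue m1 \<and> eval_expr m1 (V ''z'' [<] (V ''h'' [*] V ''h'' [*] V ''h'' [*] V ''h'' [*] V ''h'')) \<noteq> 0 \<and>
        wp htrue query (q * (t_point h + 1) + 2 * t_pow h + 60) (I (Suc i)) m1"
      using guard[OF I h1] i by simp
  next
    fix m1 assume I: "I (h ^ 5) m1" and fr: "\<And>x. x \<notin> mods query \<Longrightarrow> m1 x = m x"
    have env1: "env_mod q m1" by (rule env_mod_frame[OF env]) (auto simp: fr)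
    have h1: "m1 ''h'' 0 = int h" using env1 by (simp add: env_mod_def env_def)
    show "htrue m1 \<and> eval_expr m1 (V ''z'' [<] (V ''h'' [*] V ''h'' [*] V ''h'' [*] V ''h'' [*] V ''h'')) = 0 \<and>
      m1 ''yes'' 0 = of_bool (\<exists>z<h ^ 5. accepts q z) \<and> m1 ''fail'' 0 = of_bool (\<exists>z<h ^ 5. fails q z)"
      using guard[OF I h1] I by (simp add: I_def)
  next
    show "h ^ 5 * (q * (t_point h + 1) + 2 * t_pow h + 60 + 1) + 1 \<le> t_queries h q"
      by (simp add: t_queries_def)
  qed
qed

lemma wp_prime_test:
  assumes q: "q < 2 ^ (16 * h)" and env: "env m" "m ''q'' 0 = int q"
  shows "wp htrue prime_test (t_prime q) (\<lambda>m'. m' ''pr'' 0 = of_bool (prime q)) m"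
proof -
  define I where "I = (\<lambda>i (m' :: mem). m' ''d'' 0 = int i \<and>
    m' ''pr'' 0 = of_bool (1 < q \<and> (\<forall>d\<in>{2..<i}. \<not> d dvd q)))"
  have one: "of_bool P mod big h = of_bool P" "1 mod big h = 1" for P using h_less_big by (cases P; simp)+
  have qb: "int q < big h"
  proof -
    have "int q < 2 ^ (16 * h)" using q by (metis of_nat_less_iff of_nat_numeral of_nat_power)
    also have "\<dots> \<le> big h" unfolding big_def
    proof (intro power_increasing)
      have "h \<le> h ^ 2" using h_pos by (intro self_le_power) auto
      thus "16 * h \<le> 256 * h ^ 2" by linarith
    qed simp
    finally show ?thesis .
  qed
  have m: "m ''G'' 0 = big h" using env by (simp add: env_def)
  have loop: "wp htrue (While (V ''d'' [<] V ''q'') divisor_body) (q * (10 + 1) + 1) (\<lambda>m'. m' ''pr'' 0 = of_bool (prime q)) m0"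
    if I0: "I 0 m0" and m0: "m0 ''G'' 0 = big h" "m0 ''q'' 0 = int q" for m0
  proof (rule wp_While[where I = I and N = q])
    show "I 0 m0" by fact
  next
    fix i m1 assume i: "i < q" and I: "I i m1" and fr: "\<And>x. x \<notin> mods divisor_body \<Longrightarrow> m1 x = m0 x"
    have m1: "m1 ''G'' 0 = big h" "m1 ''q'' 0 = int q" using m0 by (simp_all add: fr)
    have ie: "m1 ''d'' 0 = int i" "m1 ''pr'' 0 = of_bool (1 < q \<and> (\<forall>d\<in>{2..<i}. \<not> d dvd q))"
      using I by (simp_all add: I_def)
    have dv: "int q mod int i = 0 \<longleftrightarrow> i dvd q" by (metis dvd_eq_mod_eq_0 of_nat_dvd_iff)
    have set: "{2..<Suc i} = (if 2 \<le> i then insert i {2..<i} else {})" by auto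
    have i0: "\<not> 2 \<le> i \<Longrightarrow> {2..<i} = {}" by simp
    have ib: "(1 + int i) mod big h = int i + 1" "(int i + 1) mod big h = int i + 1" using i qb by simp_all
    have "wp htrue divisor_body 10 (I (Suc i)) m1" unfolding divisor_body_def
      apply (rule wp_le)
       apply (rule wp_seqs_use[where R = "\<lambda>m2. m2 ''pr'' 0 = of_bool (1 < q \<and> (\<forall>d\<in>{2..<Suc i}. \<not> d dvd q))"])
        apply (rule wp_Cond[where T = 2])
          apply simp
         apply (rule wp_le, rule wp_Skip)
           apply simp
          apply (use i0 in \<open>simp add: ie m1 dv set\<close>)
         apply simp
        apply (rule wp_le, rule wp_Cond[where T = 1])
           apply simp
          apply (rule wp_Skip)
           apply simp
          apply (use i0 in \<open>simp add: ie m1 dv set\<close>)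
         apply (rule wp_asg[where g = "big h" and v = 0])
           apply (simp add: m1)
          apply simp
         apply (simp add: ie m1 dv set)
        apply simp
       apply (rule wp_step[where v = "int i + 1"], simp add: m1)
        apply (simp add: ie ib)
       apply (rule wp_seqs_Nil)
       apply (simp add: I_def)
      apply simp
      done
    thus "htrue m1 \<and> eval_expr m1 (V ''d'' [<] V ''q'') \<noteq> 0 \<and> wp htrue divisor_body 10 (I (Suc i)) m1"
      using i by (simp add: m1 ie)
  next
    fix m1 assume I: "I q m1" and fr: "\<And>x. x \<notin> mods divisor_body \<Longrightarrow> m1 x = m0 x"
    have "m1 ''q'' 0 = int q" using m0 by (simp_all add: fr)
    thus "htrue m1 \<and> eval_expr m1 (V ''d'' [<] V ''q'') = 0 \<and> m1 ''pr'' 0 = of_bool (prime q)"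
      using I prime_nat_iff'[of q] by (simp add: I_def)
  qed
  show ?thesis unfolding prime_test_def
    apply (rule wp_le)
     apply (rule wp_step[where v = "of_bool (1 < q)"], simp add: m)
      apply (simp add: env one)
     apply (rule wp_step[where v = 0], simp add: m)
      apply simp
     apply (rule wp_seqs_use)
      apply (rule loop)
        apply (simp add: I_def)
       apply (simp add: m)
      apply (simp add: env)
     apply (rule wp_seqs_Nil)
     apply simp
    apply (simp add: t_prime_def)
    done
qed

lemma wp_trial:
  assumes q: "q < 2 ^ (16 * h)" and env: "env m" "m ''q'' 0 = int q" and out: "m ''out'' 0 = 0" "m ''done'' 0 = 0"
  shows "wp htrue trial (t_prime q + t_queries h q + 2 * t_pow h + 60) (\<lambda>m'. env m' \<and>
      m' ''done'' 0 = of_bool (conclusive q) \<and> m' ''out'' 0 = of_bool (conclusive q \<and> feasible)) m"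
proof -
  have m: "m ''G'' 0 = big h" "m ''h'' 0 = int h" using env by (simp_all add: env_def)
  have one: "1 mod big h = 1" using h_less_big by simp
  define R where "R = (\<lambda>m' :: mem. m' ''done'' 0 = of_bool (conclusive q) \<and> m' ''out'' 0 = of_bool (conclusive q \<and> feasible))"
  define core where "core = seqs [
       powmod (V ''q'') (Const 16 [*] V ''h'' [-] Const 1) (V ''G''),
       asg ''E'' (V ''r''),
       asg ''M'' (V ''E'' [*] V ''q''),
       powmod (Const 2) (V ''h'') (V ''G''),
       asg ''B'' (V ''r''),
       asg ''yes'' (Const 0),
       asg ''fail'' (Const 0),
       asg ''z'' (Const 0),
       query_loop,
       Cond (V ''yes'') (seqs [asg ''out'' (Const 1), asg ''done'' (Const 1)])
         (Cond (V ''fail'') Skip (asg ''done'' (Const 1)))]"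
  have core: "wp htrue core (t_queries h q + 2 * t_pow h + 40) R m1"
    if p: "prime q" and fr: "\<And>x. x \<notin> mods prime_test \<Longrightarrow> m1 x = m x" for m1
  proof -
    have q1: "1 < q" using p prime_gt_1_nat by blast
    note mb = modulus_bounds[OF q1 q]
    have m1: "m1 ''G'' 0 = big h" "m1 ''h'' 0 = int h" "m1 ''q'' 0 = int q" "m1 ''out'' 0 = 0" "m1 ''done'' 0 = 0"
      using m env out by (simp_all add: fr)
    have env1: "env m1" by (rule env_frame[OF env(1)]) (auto simp: fr)
    have two: "2 < big h" using h_less_big h_def by linarith
    have h16: "16 * int h - 1 = int (16 * h - 1)" using h_pos by (simp add: of_nat_diff)
    have h16b: "int (16 * h - 1) < big h"
    proof -
      have "h \<ge> 16" by (simp add: h_def)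
      hence "16 * h \<le> h * h" by simp
      also have "\<dots> \<le> h ^ 5" using h_pos power_increasing[of 2 5 h] by (simp add: power2_eq_square)
      finally have "int (16 * h - 1) \<le> int (h ^ 5)" by (simp only: of_nat_le_iff)
      thus ?thesis using h_power_less_big by linarith
    qed
    have qb: "int q < big h" and hb: "int h < big h" using mb h_less_big by linarith+
    have qE: "int q ^ (16 * h - 1) mod big h = int (q ^ (16 * h - 1))" using mb by simp
    have EM: "int (q ^ (16 * h - 1)) * int q mod big h = modulus q" using mb by simp
    have yes: "(\<exists>z<h ^ 5. accepts q z) \<Longrightarrow> conclusive q \<and> feasible"
      using p conclusive_correct unfolding conclusive_def by blast
    have no: "\<not> (\<exists>z<h ^ 5. accepts q z) \<Longrightarrow> conclusive q \<longleftrightarrow> \<not> (\<exists>z<h ^ 5. fails q z)"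
      "\<not> (\<exists>z<h ^ 5. accepts q z) \<Longrightarrow> \<not> (conclusive q \<and> feasible)"
      using p conclusive_correct unfolding conclusive_def by blast+
    show ?thesis unfolding core_def
      apply (rule wp_le)
       apply (rule wp_seqs_use)
        apply (rule wp_powmod[where h = h and bv = "int q" and xv = "16 * h - 1" and mv = "big h"]; simp add: m1 qb h16[unfolded One_nat_def] h16b[unfolded One_nat_def] big_pos)
      apply (rule wp_step[where v = "int (q ^ (16 * h - 1))"], simp add: m1)
       apply (simp add: qE[unfolded One_nat_def])
      apply (rule wp_step[where v = "modulus q"], simp add: m1)
       apply (use EM in \<open>simp add: m1\<close>)
      apply (rule wp_seqs_use)
       apply (rule wp_powmod[where h = h and bv = 2 and xv = h and mv = "big h"]; simp add: m1 two hb big_pos)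
      apply (rule wp_step[where v = "2 ^ h"], simp add: m1)
       apply (simp add: pow_less_big)
      apply (rule wp_step[where v = 0], simp add: m1)
       apply simp
      apply (rule wp_step[where v = 0], simp add: m1)
       apply simp
      apply (rule wp_step[where v = 0], simp add: m1)
       apply simp
      apply (rule wp_seqs_use)
       apply (rule wp_query_loop[OF p q])
          apply (unfold env_mod_def)[1]
          apply (intro conjI)
              apply (rule env_frame[OF env1])
              apply (elim insertE emptyE; simp)
             apply (simp add: m1)
            apply simp
           apply simp
          apply simp
         apply simp
        apply simp
       apply simp
      apply (rule wp_seqs_use[where R = R])
       apply (rule wp_Cond[where T = 5])
         apply simp
        apply (rule wp_le)
         apply (rule wp_step[where v = 1], simp add: m1)
          apply (simp add: one)
         apply (rule wp_step[where v = 1], simp add: m1)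
          apply (simp add: one)
         apply (rule wp_seqs_Nil)
         apply (use yes in \<open>auto simp: R_def\<close>)[1]
        apply simp
       apply (rule wp_le, rule wp_Cond[where T = 1])
          apply simp
         apply (rule wp_Skip)
          apply simp
         apply (use no in \<open>auto simp: R_def m1\<close>)[1]
        apply (rule wp_asg[where g = "big h" and v = 1])
          apply (simp add: m1)
         apply (simp add: one)
        apply (use no in \<open>auto simp: R_def m1\<close>)[1]
       apply simp
      apply (rule wp_seqs_Nil)
      apply simp
      apply (simp add: t_pow_def)
      done
  qed
  have "wp htrue trial (t_prime q + t_queries h q + 2 * t_pow h + 60) R m"
    unfolding trial_def core_def[symmetric]
    apply (rule wp_le)
     apply (rule wp_seqs_use)
      apply (rule wp_prime_test[OF q env])
     apply (rule wp_seqs_use[where R = R])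
      apply (rule wp_Cond[where T = "t_queries h q + 2 * t_pow h + 40"])
        apply simp
       apply (rule core)
        apply (simp split: if_splits)
       apply simp
      apply (rule wp_le, rule wp_Skip)
        apply simp
       apply (use out in \<open>simp add: R_def conclusive_def\<close>)
      apply simp
     apply (rule wp_seqs_Nil)
     apply simp
    apply simp
    done
  thus ?thesis
  proof (rule wp_use[OF _ order_refl])
    fix m' assume R: "R m'" and fr: "\<And>x. x \<notin> mods trial \<Longrightarrow> m' x = m x"
    have "mods trial \<inter> {''G'', ''h'', ''n'', ''t'', ''b'', ''omega'', ''nu''} = {}"
      by (simp add: trial_def)
    hence "env m'" by (intro env_frame[OF env(1)] fr) blast
    thus "env m' \<and> m' ''done'' 0 = of_bool (conclusive q) \<and> m' ''out'' 0 = of_bool (conclusive q \<and> feasible)"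
      using R by (simp add: R_def)
  qed
qed

end

subsection \<open>The randomised loop\<close>

text \<open>
  Leading zeros are allowed: after \<open>d\<close> rounds \<open>q\<close> is uniform below \<open>2 ^ d\<close>, and the loop ends
  after exactly \<open>d\<close> rounds with probability \<open>2 ^ (-d - 1)\<close>, except for the last possible \<open>d\<close>.
\<close>

definition bit_body :: com where
  "bit_body = Seq (Flip ''g'' (Const 0)) (Seq (asg ''q'' (Const 2 [*] V ''q'' [+] V ''g''))
     (Seq (asg ''K'' (V ''K'' [+] Const 1)) (Flip ''f'' (Const 0))))"

definition bit_loop :: com where
  "bit_loop = While (V ''f'' [*] (V ''K'' [<] Const 16 [*] V ''h'')) bit_body"

definition attempt :: com where
  "attempt = Seq (asg ''q'' (Const 0)) (Seq (asg ''K'' (Const 0))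
     (Seq (Seq (Flip ''f'' (Const 0)) bit_loop) trial))"

definition main_loop :: com where
  "main_loop = While (Bin Eq (V ''done'') (Const 0)) attempt"

lemma steps_upto_le:
  assumes "\<And>\<sigma>. w \<sigma> \<ge> 0"
  shows steps_upto_Seq:
      "steps_upto w N (c1 # c2 # cs, m) \<le> y \<Longrightarrow> steps_upto w N (Seq c1 c2 # cs, m) \<le> 1 + y"
    and steps_upto_asg: "eval_expr m e mod m ''G'' 0 = v \<Longrightarrow> steps_upto w N (cs, upd m x v) \<le> y \<Longrightarrow>
      steps_upto w N (asg x e # cs, m) \<le> 1 + y"
    and steps_upto_coin: "(steps_upto w N (cs, upd m x 1) + steps_upto w N (cs, upd m x 0)) / 2 \<le> y \<Longrightarrow>
      steps_upto w N (Flip x (Const 0) # cs, m) \<le> 1 + y"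
    and steps_upto_While: "eval_expr m e \<noteq> 0 \<Longrightarrow> steps_upto w N (c # While e c # cs, m) \<le> y \<Longrightarrow>
      steps_upto w N (While e c # cs, m) \<le> 1 + y"
    and steps_upto_exit: "eval_expr m e = 0 \<Longrightarrow> steps_upto w N (cs, m) \<le> y \<Longrightarrow>
      steps_upto w N (While e c # cs, m) \<le> 1 + y"
proof -
  note det = steps_upto_det[where w = w and N = N, OF assms]
  show "steps_upto w N (c1 # c2 # cs, m) \<le> y \<Longrightarrow> steps_upto w N (Seq c1 c2 # cs, m) \<le> 1 + y"
    using det[of "Seq c1 c2" cs m "(c1 # c2 # cs, m)"] by simp
  show "eval_expr m e mod m ''G'' 0 = v \<Longrightarrow> steps_upto w N (cs, upd m x v) \<le> y \<Longrightarrow>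
      steps_upto w N (asg x e # cs, m) \<le> 1 + y"
    using det[of "asg x e" cs m "(cs, upd m x v)"] by (simp add: asg_def upd_def)
  show "steps_upto w N (Flip x (Const 0) # cs, m) \<le> 1 + y"
    if "(steps_upto w N (cs, upd m x 1) + steps_upto w N (cs, upd m x 0)) / 2 \<le> y"
    using steps_upto_Flip[where w = w and N = N and x = x and i = "Const 0" and cs = cs and m = m, OF assms] that
    unfolding upd_def eval_expr.simps by linarith
  show "eval_expr m e \<noteq> 0 \<Longrightarrow> steps_upto w N (c # While e c # cs, m) \<le> y \<Longrightarrow>
      steps_upto w N (While e c # cs, m) \<le> 1 + y"
    using det[of "While e c" cs m "(c # While e c # cs, m)"] by simp
  show "eval_expr m e = 0 \<Longrightarrow> steps_upto w N (cs, m) \<le> y \<Longrightarrow>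
      steps_upto w N (While e c # cs, m) \<le> 1 + y"
    using det[of "While e c" cs m "(cs, m)"] by simp
qed

definition trial_bound :: "nat \<Rightarrow> nat" where
  "trial_bound h = h ^ 5 * (t_point h + 2 * t_pow h + 62) + 2 * t_pow h + 140"

text \<open>The first factor bounds the expected steps of an attempt; the second, multiplied by
  \<open>num_pairs\<close>, bounds the reciprocal of its success probability
  (\<open>success_prob\<close>).\<close>

definition loop_bound :: "nat \<Rightarrow> nat" where
  "loop_bound h = (8 + (trial_bound h + 5) * (16 * h + 1)) * (128 * 2560 * h ^ 11)"

context instance_data
begin

lemma trial_time_le: "t_prime q + t_queries h q + 2 * t_pow h + 62 \<le> trial_bound h * (q + 1)"
proof -
  have "q * (t_point h + 1) + 2 * t_pow h + 61 \<le> (t_point h + 2 * t_pow h + 62) * (q + 1)"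
    by (simp add: algebra_simps)
  hence "h ^ 5 * (q * (t_point h + 1) + 2 * t_pow h + 61) \<le> h ^ 5 * (t_point h + 2 * t_pow h + 62) * (q + 1)"
    unfolding mult.assoc by (rule mult_left_mono) simp
  thus ?thesis unfolding trial_bound_def t_queries_def t_prime_def by (simp add: algebra_simps)
qed

text \<open>
  The probability that an attempt that has produced the number \<open>q\<close> and may still append \<open>r\<close>
  bits is conclusive.
\<close>

primrec success :: "nat \<Rightarrow> nat \<Rightarrow> real" where
  "success 0 q = of_bool (conclusive q)"
| "success (Suc r) q = of_bool (conclusive q) / 2 + (success r (2 * q) + success r (2 * q + 1)) / 4"

lemma success_nonneg: "0 \<le> success r q"
  by (induction r arbitrary: q) (simp_all add: add_nonneg_nonneg)

text \<open>Only the outcomes with exactly \<open>d\<close> further bits are kept: stopping there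
  has probability at least \<open>1 / (2 * 2 ^ d)\<close>, and each of the \<open>2 ^ d\<close>
  continuations of \<open>q\<close> is equally likely.\<close>

lemma success_ge:
  "d \<le> r \<Longrightarrow> (\<Sum>j<2 ^ d. of_bool (conclusive (q * 2 ^ d + j))) / (2 * 4 ^ d) \<le> success r q"
proof (induction d arbitrary: r q)
  case 0
  show ?case
  proof (cases r)
    case (Suc r')
    thus ?thesis using success_nonneg[of r' "2 * q"] success_nonneg[of r' "2 * q + 1"] by simp
  qed simp
next
  case (Suc d)
  then obtain r' where r: "r = Suc r'" "d \<le> r'" by (cases r) auto
  define f where "f = (\<lambda>j. of_bool (conclusive j) :: real)"
  have IH: "(\<Sum>j<2 ^ d. f (p * 2 ^ d + j)) / (2 * 4 ^ d) \<le> success r' p" for p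
    unfolding f_def by (rule Suc.IH[OF r(2)])
  have split: "(\<Sum>j<a + b. g j) = (\<Sum>j<a. g j) + (\<Sum>j<b. g (a + j))" for a b and g :: "nat \<Rightarrow> real"
    by (induction b) simp_all
  have "(\<Sum>j<2 ^ Suc d. f (q * 2 ^ Suc d + j)) = (\<Sum>j<2 ^ d + 2 ^ d. f (q * 2 ^ Suc d + j))"
    by (simp add: mult_2)
  also have "\<dots> = (\<Sum>j<2 ^ d. f (q * 2 ^ Suc d + j)) + (\<Sum>j<2 ^ d. f (q * 2 ^ Suc d + (2 ^ d + j)))"
    by (rule split)
  also have "(\<Sum>j<2 ^ d. f (q * 2 ^ Suc d + j)) = (\<Sum>j<2 ^ d. f ((2 * q) * 2 ^ d + j))"
    by (simp add: mult.assoc mult.left_commute)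
  also have "(\<Sum>j<2 ^ d. f (q * 2 ^ Suc d + (2 ^ d + j))) = (\<Sum>j<2 ^ d. f ((2 * q + 1) * 2 ^ d + j))"
    by (simp add: algebra_simps)
  finally have e: "(\<Sum>j<2 ^ Suc d. f (q * 2 ^ Suc d + j)) =
      (\<Sum>j<2 ^ d. f ((2 * q) * 2 ^ d + j)) + (\<Sum>j<2 ^ d. f ((2 * q + 1) * 2 ^ d + j))" .
  have "(\<Sum>j<2 ^ Suc d. f (q * 2 ^ Suc d + j)) / (2 * 4 ^ Suc d) =
      ((\<Sum>j<2 ^ d. f ((2 * q) * 2 ^ d + j)) / (2 * 4 ^ d) + (\<Sum>j<2 ^ d. f ((2 * q + 1) * 2 ^ d + j)) / (2 * 4 ^ d)) / 4"
    unfolding e by (simp add: add_divide_distrib)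
  also have "\<dots> \<le> (success r' (2 * q) + success r' (2 * q + 1)) / 4"
    using IH[of "2 * q"] IH[of "2 * q + 1"] by (intro divide_right_mono add_mono) simp_all
  also have "\<dots> \<le> success r q" by (simp add: r)
  finally show ?case unfolding f_def .
qed

text \<open>For the \<open>d\<close> of \<open>many_conclusive\<close> at least one in
  \<open>64 * h\<close> numbers below \<open>2 ^ d\<close> is conclusive, so
  \<open>success_ge\<close> gives \<open>1 / (128 * h * 2 ^ d)\<close>; then \<open>2 ^ d\<close> is
  estimated by \<open>2560 * h ^ 10 * num_pairs\<close>.\<close>

lemma success_prob: "1 \<le> success (16 * h) 0 * real (128 * 2560 * h ^ 11 * num_pairs)"
proof -
  from many_conclusive obtain d where d: "d \<le> 16 * h" "2 ^ d \<le> 2560 * h ^ 10 * num_pairs"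
    "2 ^ d \<le> 64 * h * card {q. q < 2 ^ d \<and> conclusive q}" .
  define c where "c = card {q. q < 2 ^ d \<and> conclusive q}"
  have "(\<Sum>j<2 ^ d. of_bool (conclusive (0 * 2 ^ d + j))) = real c"
    unfolding c_def by (simp add: of_bool_def sum.If_cases Int_def lessThan_def)
  hence p: "real c / (2 * 4 ^ d) \<le> success (16 * h) 0" using success_ge[OF d(1), of 0] by simp
  have "real (2 ^ d) \<le> real (64 * h * c)" using d(3) unfolding c_def by (simp only: of_nat_le_iff)
  hence c: "2 ^ d \<le> 64 * real h * real c" by simp
  have "real (2 ^ d) \<le> real (2560 * h ^ 10 * num_pairs)" using d(2) by (simp only: of_nat_le_iff)
  hence D: "2 ^ d \<le> 2560 * real h ^ 10 * real num_pairs" by simp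
  have "(4::real) ^ d = 2 ^ d * 2 ^ d" by (simp flip: power_mult_distrib)
  also have "\<dots> \<le> (64 * real h * real c) * (2560 * real h ^ 10 * real num_pairs)"
    using c D by (intro mult_mono) auto
  finally have "1 \<le> (64 * real h * real c) * (2560 * real h ^ 10 * real num_pairs) / 4 ^ d"
    by (simp add: field_simps)
  also have "\<dots> = real c / (2 * 4 ^ d) * (128 * 2560 * (real h * real h ^ 10) * real num_pairs)"
    by (simp add: field_simps)
  also have "\<dots> = real c / (2 * 4 ^ d) * real (128 * 2560 * h ^ 11 * num_pairs)"
    using power_Suc[of "real h" 10] by simp
  also have "\<dots> \<le> success (16 * h) 0 * real (128 * 2560 * h ^ 11 * num_pairs)"
    by (intro mult_right_mono p) simp
  finally show ?thesis .
qed

section \<open>Expected steps of an attempt and of the main loop\<close>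

definition ready :: "mem \<Rightarrow> bool" where
  "ready m \<longleftrightarrow> env m \<and> m ''out'' 0 = 0 \<and> m ''done'' 0 = 0"

lemma ready_upd:
  "ready m \<Longrightarrow> x \<in> {''f'', ''g'', ''q'', ''K''} \<Longrightarrow> ready (upd m x v)"
  unfolding ready_def by (auto intro!: env_frame[of m])

text \<open>\<open>L\<close> stands for the expected steps after an inconclusive attempt. It is a
  parameter because \<open>main_loop_steps\<close> supplies its induction hypothesis for it.\<close>

context
  fixes w :: "config \<Rightarrow> real" and N :: nat and L :: real
  assumes w: "\<And>\<sigma>. w \<sigma> \<ge> 0"
    and w0: "\<And>\<sigma>. (snd \<sigma> ''out'' 0 \<noteq> 0 \<longleftrightarrow> feasible) \<Longrightarrow> w \<sigma> = 0"
    and L: "L \<ge> 0" "\<And>m. ready m \<Longrightarrow> steps_upto w N ([main_loop], m) \<le> L"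
begin

lemma trial_steps:
  assumes "ready m" "m ''q'' 0 = int q" "q < 2 ^ (16 * h)"
  shows "steps_upto w N ([trial, main_loop], m) \<le>
    real (trial_bound h) * (real q + 1) + (1 - of_bool (conclusive q)) * L"
proof -
  have "wp htrue trial (t_prime q + t_queries h q + 2 * t_pow h + 60) (\<lambda>m'. env m' \<and>
      m' ''done'' 0 = of_bool (conclusive q) \<and> m' ''out'' 0 = of_bool (conclusive q \<and> feasible)) m"
    using assms by (intro wp_trial) (simp_all add: ready_def)
  from steps_upto_wp[where w = w and N = N and cs = "[main_loop]", OF w this] obtain m' where
    m': "env m'" "m' ''done'' 0 = of_bool (conclusive q)" "m' ''out'' 0 = of_bool (conclusive q \<and> feasible)"
    and le: "steps_upto w N ([trial, main_loop], m) \<le>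
      real (t_prime q + t_queries h q + 2 * t_pow h + 60) + steps_upto w N ([main_loop], m')" by blast
  have "real (t_prime q + t_queries h q + 2 * t_pow h + 62) \<le> real (trial_bound h * (q + 1))"
    using trial_time_le by (simp only: of_nat_le_iff)
  hence T: "real (t_prime q + t_queries h q + 2 * t_pow h + 60) + 2 \<le> real (trial_bound h) * (real q + 1)"
    by (simp add: algebra_simps)
  show ?thesis
  proof (cases "conclusive q")
    case True
    have "steps_upto w N ([], m') = 0" using w0[of "([], m')"] m' True
      by (cases N) (simp_all add: halted_def)
    hence "steps_upto w N ([main_loop], m') \<le> 1 + 0"
      unfolding main_loop_def by (intro steps_upto_exit[OF w]) (simp_all add: m' True)
    thus ?thesis using le T True by simp
  next
    case False
    hence "steps_upto w N ([main_loop], m') \<le> L" using m' by (intro L(2)) (simp add: ready_def)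
    thus ?thesis using le T False by simp
  qed
qed

text \<open>The two memories are the outcomes of the flip of \<open>''f''\<close> that precedes the
  loop test. Appending a bit doubles the cost of the trial but happens with probability one half, so
  each of the \<open>r + 1\<close> remaining lengths costs about \<open>q + 1\<close> trial units in
  expectation.\<close>

lemma bit_loop_steps:
  assumes "ready m1" "ready m0" "m1 ''f'' 0 = 1" "m0 ''f'' 0 = 0"
    "m1 ''q'' 0 = int q" "m0 ''q'' 0 = int q" "m1 ''K'' 0 = int (16 * h - r)" "m0 ''K'' 0 = int (16 * h - r)"
    "q < 2 ^ (16 * h - r)" "r \<le> 16 * h"
  shows "(steps_upto w N ([bit_loop, trial, main_loop], m1) + steps_upto w N ([bit_loop, trial, main_loop], m0)) / 2
    \<le> (real (trial_bound h) + 5) * (real q + 1) * (real r + 1) + (1 - success r q) * L"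
  using assms
proof (induction r arbitrary: q m1 m0)
  case 0
  have stop: "steps_upto w N ([bit_loop, trial, main_loop], m) \<le>
      1 + (real (trial_bound h) * (real q + 1) + (1 - of_bool (conclusive q)) * L)"
    if "ready m" "m ''q'' 0 = int q" "m ''K'' 0 = int (16 * h)" for m
    unfolding bit_loop_def using that 0 by (intro steps_upto_exit[OF w] trial_steps) (simp_all add: ready_def env_def)
  have "1 + real (trial_bound h) * (real q + 1) \<le> (real (trial_bound h) + 5) * (real q + 1)"
    by (simp add: algebra_simps)
  thus ?case using stop[of m1] stop[of m0] 0 by simp
next
  case (Suc r)
  define K where "K = 16 * h - Suc r"
  have K: "16 * h - r = Suc K" "K < 16 * h" using Suc.prems by (simp_all add: K_def)
  have q: "q < 2 ^ K" using Suc.prems by (simp add: K_def)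
  have pK: "(2::nat) ^ Suc K \<le> 2 ^ (16 * h)" using K by (intro power_increasing) auto
  have q16: "q < 2 ^ (16 * h)" using q pK by simp
  have q2: "2 * q + 1 < 2 ^ Suc K" using q by simp
  have big: "2 ^ (16 * h) \<le> big h" unfolding big_def
  proof (intro power_increasing)
    have "h \<le> h ^ 2" using h_pos by (intro self_le_power) auto
    thus "16 * h \<le> 256 * h ^ 2" by linarith
  qed simp
  have "int (2 * q + 1) < int (2 ^ (16 * h))" using q2 pK by (simp only: of_nat_less_iff)
  hence qb: "2 * int q + 1 < big h" using big by simp
  have Kb: "int K + 1 < big h"
  proof -
    have "Suc K < 2 ^ Suc K" by (rule less_exp)
    hence "Suc K < 2 ^ (16 * h)" using pK by (rule less_le_trans)
    hence "int (Suc K) < int (2 ^ (16 * h))" by (simp only: of_nat_less_iff)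
    thus ?thesis using big by simp
  qed
  have zero: "steps_upto w N ([bit_loop, trial, main_loop], m0) \<le>
      1 + (real (trial_bound h) * (real q + 1) + (1 - of_bool (conclusive q)) * L)"
    unfolding bit_loop_def using Suc.prems q16 by (intro steps_upto_exit[OF w] trial_steps) simp_all
  define Y where "Y = (\<lambda>g::nat. (real (trial_bound h) + 5) * (real (2 * q + g) + 1) * (real r + 1) + (1 - success r (2 * q + g)) * L)"
  define rest where "rest = Seq (asg ''q'' (Const 2 [*] V ''q'' [+] V ''g'')) (Seq (asg ''K'' (V ''K'' [+] Const 1)) (Flip ''f'' (Const 0)))"
  have bit: "steps_upto w N ([rest, bit_loop, trial, main_loop], upd m1 ''g'' (int g)) \<le> 5 + Y g" if g: "g \<le> 1" for g
  proof -
    define m2 where "m2 = upd m1 ''g'' (int g)"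
    define m3 where "m3 = upd m2 ''q'' (int (2 * q + g))"
    define m4 where "m4 = upd m3 ''K'' (int (Suc K))"
    have r1: "ready m2" unfolding m2_def by (rule ready_upd[OF Suc.prems(1)]) simp
    have r2: "ready m3" unfolding m3_def by (rule ready_upd[OF r1]) simp
    have r3: "ready m4" unfolding m4_def by (rule ready_upd[OF r2]) simp
    have G: "m2 ''G'' 0 = big h" "m3 ''G'' 0 = big h" using r1 r2 by (simp_all add: ready_def env_def)
    have avg: "(steps_upto w N ([bit_loop, trial, main_loop], upd m4 ''f'' 1) +
        steps_upto w N ([bit_loop, trial, main_loop], upd m4 ''f'' 0)) / 2 \<le> Y g"
      unfolding Y_def
    proof (rule Suc.IH)
      show "ready (upd m4 ''f'' 1)" "ready (upd m4 ''f'' 0)" by (rule ready_upd[OF r3], simp)+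
      show "2 * q + g < 2 ^ (16 * h - r)" using q2 g unfolding K(1) by simp
      show "r \<le> 16 * h" using Suc.prems by simp
    qed (simp_all add: m4_def m3_def K(1))
    have "int (2 * q + g) < big h" using qb g by simp
    hence eq: "eval_expr m2 (Const 2 [*] V ''q'' [+] V ''g'') mod m2 ''G'' 0 = int (2 * q + g)"
      using Suc.prems G by (simp add: m2_def)
    have eK: "eval_expr m3 (V ''K'' [+] Const 1) mod m3 ''G'' 0 = int (Suc K)"
      using Suc.prems(7) G Kb by (simp add: m3_def m2_def K_def[symmetric])
    have "steps_upto w N ([rest, bit_loop, trial, main_loop], m2) \<le> 1 + (1 + (1 + (1 + (1 + Y g))))"
      unfolding rest_def
      by (rule steps_upto_Seq[OF w] steps_upto_asg[OF w eq] steps_upto_asg[OF w eK[unfolded m3_def]]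
          steps_upto_coin[OF w] avg[unfolded m4_def m3_def])+
    thus ?thesis unfolding m2_def by simp
  qed
  have one: "steps_upto w N ([bit_loop, trial, main_loop], m1) \<le> 3 + ((5 + Y 1) + (5 + Y 0)) / 2"
  proof -
    have "eval_expr m1 (V ''f'' [*] (V ''K'' [<] Const 16 [*] V ''h'')) \<noteq> 0"
      using Suc.prems(1,3,7) K(2) by (simp add: ready_def env_def K_def[symmetric])
    moreover have "(steps_upto w N ([rest, bit_loop, trial, main_loop], upd m1 ''g'' 1) +
        steps_upto w N ([rest, bit_loop, trial, main_loop], upd m1 ''g'' 0)) / 2 \<le> ((5 + Y 1) + (5 + Y 0)) / 2"
      using bit[of 1] bit[of 0] by simp
    hence "steps_upto w N ([bit_body, bit_loop, trial, main_loop], m1) \<le> 1 + (1 + ((5 + Y 1) + (5 + Y 0)) / 2)"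
      unfolding bit_body_def rest_def by (intro steps_upto_Seq[OF w] steps_upto_coin[OF w])
    ultimately have "steps_upto w N ([bit_loop, trial, main_loop], m1) \<le> 1 + (1 + (1 + ((5 + Y 1) + (5 + Y 0)) / 2))"
      unfolding bit_loop_def by (intro steps_upto_While[OF w])
    thus ?thesis by simp
  qed
  define a where "a = real (trial_bound h)"
  define s0 where "s0 = success r (2 * q)"
  define s1 where "s1 = success r (2 * q + 1)"
  define c where "c = (of_bool (conclusive q) :: real)"
  define u where "u = (a + 5) * (real q + 1)"
  have a0: "0 \<le> a" by (simp add: a_def)
  have Y: "Y 0 = (a + 5) * (2 * real q + 1) * (real r + 1) + (1 - s0) * L"
     "Y 1 = (a + 5) * (2 * real q + 2) * (real r + 1) + (1 - s1) * L"
    by (simp_all add: Y_def a_def s0_def s1_def)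
  have "(a + 5) * (2 * real q + 1) * (real r + 1) \<le> (a + 5) * (2 * real q + 2) * (real r + 1)"
    using a0 by (intro mult_right_mono mult_left_mono) auto
  also have "\<dots> = 2 * (u * (real r + 1))" by (simp add: u_def algebra_simps)
  finally have Y0: "Y 0 \<le> 2 * (u * (real r + 1)) + (1 - s0) * L" using Y by simp
  have Y1: "Y 1 = 2 * (u * (real r + 1)) + (1 - s1) * L" using Y by (simp add: u_def algebra_simps)
  have u: "a * (real q + 1) + 5 \<le> u" by (simp add: u_def algebra_simps)
  have u0: "0 \<le> a * (real q + 1)" using a0 by simp
  have "(steps_upto w N ([bit_loop, trial, main_loop], m1) + steps_upto w N ([bit_loop, trial, main_loop], m0)) / 2
      \<le> (3 + ((5 + Y 1) + (5 + Y 0)) / 2 + (1 + (a * (real q + 1) + (1 - c) * L))) / 2"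
    unfolding a_def c_def by (intro divide_right_mono add_mono one zero) simp
  also have "\<dots> \<le> u * (real r + 1) + u + (1 - (c / 2 + (s0 + s1) / 4)) * L"
  proof -
    have e: "(1 - x) * L = L - x * L" for x by (simp add: algebra_simps)
    have et: "(c / 2 + (s0 + s1) / 4) * L = c * L / 2 + s0 * L / 4 + s1 * L / 4" by (simp add: field_simps)
    \<comment> \<open>With variables in place of the products, the estimate becomes linear.\<close>
    have "(3 + (5 + y1 + (5 + y0)) / 2 + (1 + (b + (k - z)))) / 2 \<le> x + v + (k - (z / 2 + z0 / 4 + z1 / 4))"
      if "y0 \<le> 2 * x + (k - z0)" "y1 = 2 * x + (k - z1)" "b + 5 \<le> v" "0 \<le> b"
      for y0 y1 b k x v z z0 z1 :: real
      using that by (simp add: field_simps)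
    from this[OF Y0[unfolded e] Y1[unfolded e] u u0] show ?thesis unfolding e et .
  qed
  also have "\<dots> = (real (trial_bound h) + 5) * (real q + 1) * (real (Suc r) + 1) + (1 - success (Suc r) q) * L"
    by (simp add: u_def a_def c_def s0_def s1_def algebra_simps)
  finally show ?case .
qed

lemma attempt_steps:
  assumes "ready m"
  shows "steps_upto w N ([attempt, main_loop], m) \<le>
    7 + (real (trial_bound h) + 5) * (16 * real h + 1) + (1 - success (16 * h) 0) * L"
proof -
  define m2 where "m2 = upd m ''q'' 0"
  define m3 where "m3 = upd m2 ''K'' 0"
  have r1: "ready m2" unfolding m2_def by (rule ready_upd[OF assms]) simp
  have r2: "ready m3" unfolding m3_def by (rule ready_upd[OF r1]) simp
  have avg: "(steps_upto w N ([bit_loop, trial, main_loop], upd m3 ''f'' 1) +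
      steps_upto w N ([bit_loop, trial, main_loop], upd m3 ''f'' 0)) / 2 \<le>
      (real (trial_bound h) + 5) * (real 0 + 1) * (real (16 * h) + 1) + (1 - success (16 * h) 0) * L"
  proof (rule bit_loop_steps)
    show "ready (upd m3 ''f'' 1)" "ready (upd m3 ''f'' 0)" by (rule ready_upd[OF r2], simp)+
  qed (simp_all add: m3_def m2_def)
  have e: "eval_expr m (Const 0) mod m ''G'' 0 = 0" "eval_expr m2 (Const 0) mod m2 ''G'' 0 = 0" by simp_all
  have "steps_upto w N ([attempt, main_loop], m) \<le> 1 + (1 + (1 + (1 + (1 + (1 + (1 +
      ((real (trial_bound h) + 5) * (real 0 + 1) * (real (16 * h) + 1) + (1 - success (16 * h) 0) * L)))))))"
    unfolding attempt_def
    by (rule steps_upto_Seq[OF w] steps_upto_asg[OF w e(1)] steps_upto_asg[OF w e(2)[unfolded m2_def]]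
        steps_upto_coin[OF w] avg[unfolded m3_def m2_def])+
  thus ?thesis by simp
qed

end

text \<open>The bound \<open>L\<close> reproduces itself: an attempt costs \<open>c\<close> and
  fails with probability \<open>1 - p\<close>, and \<open>L\<close> is large enough for
  \<open>c \<le> p * L\<close>. Induction on the cutoff \<open>N\<close> makes this rigorous without
  knowing beforehand that the loop ends.\<close>

lemma main_loop_steps:
  assumes w: "\<And>\<sigma>. w \<sigma> \<ge> 0"
    and w0: "\<And>\<sigma>. (snd \<sigma> ''out'' 0 \<noteq> 0 \<longleftrightarrow> feasible) \<Longrightarrow> w \<sigma> = 0"
    and "ready m"
  shows "steps_upto w N ([main_loop], m) \<le> real (loop_bound h * num_pairs)"
  using assms(3)
proof (induction N arbitrary: m)
  case 0
  show ?case by (simp add: halted_def)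
next
  case (Suc N)
  define L where "L = real (loop_bound h * num_pairs)"
  define c where "c = 8 + (real (trial_bound h) + 5) * (16 * real h + 1)"
  define p where "p = success (16 * h) 0"
  have c0: "0 \<le> c" by (simp add: c_def)
  have "step r ([main_loop], m) = ([attempt, main_loop], m)" for r
    using Suc.prems by (simp add: main_loop_def ready_def)
  hence "steps_upto w (Suc N) ([main_loop], m) = 1 + steps_upto w N ([attempt, main_loop], m)"
    by (simp add: halted_def)
  also have "steps_upto w N ([attempt, main_loop], m) \<le> 7 + (real (trial_bound h) + 5) * (16 * real h + 1) + (1 - p) * L"
    unfolding p_def
  proof (rule attempt_steps[OF w w0])
    show "steps_upto w N ([main_loop], m) \<le> L" if "ready m" for m
      using Suc.IH[OF that] by (simp only: L_def)
  qed (use Suc.prems in \<open>simp_all add: L_def\<close>)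
  also have "1 + (7 + (real (trial_bound h) + 5) * (16 * real h + 1) + (1 - p) * L) = c + L - p * L"
    by (simp add: c_def algebra_simps)
  also have "\<dots> \<le> L"
  proof -
    have "L = c * real (128 * 2560 * h ^ 11 * num_pairs)" by (simp add: L_def loop_bound_def c_def algebra_simps)
    hence "p * L = c * (p * real (128 * 2560 * h ^ 11 * num_pairs))" by simp
    also have "c * 1 \<le> c * (p * real (128 * 2560 * h ^ 11 * num_pairs))"
      using success_prob c0 unfolding p_def by (rule mult_left_mono)
    finally show ?thesis by simp
  qed
  finally show ?case unfolding L_def by simp
qed

end

subsection \<open>The parameters\<close>

text \<open>Unlike \<open>asg\<close>, it does not reduce modulo \<open>''G''\<close>, which is
  still to be computed.\<close>

definition set_var :: "vname \<Rightarrow> expr \<Rightarrow> com" where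
  "set_var x e = Assign x (Const 0) e"

definition sum_body :: com where
  "sum_body = seqs [
     set_var ''R'' (V ''R'' [+] Read ''omega'' (V ''e'') [+] Read ''nu'' (V ''e'')),
     set_var ''e'' (V ''e'' [+] Const 1)]"

definition length_body :: com where
  "length_body = seqs [
     set_var ''pw'' (V ''pw'' [+] V ''pw''),
     set_var ''h'' (V ''h'' [+] Const 1)]"

definition double_body :: com where
  "double_body = seqs [
     set_var ''G'' (V ''G'' [+] V ''G''),
     set_var ''pc'' (V ''pc'' [+] Const 1)]"

text \<open>
  The cell \<open>''G''\<close> becomes \<open>2 ^ (256 * h\<^sup>2)\<close>, which exceeds every modulus \<open>q ^ (16 * h)\<close> for
  \<open>q < 2 ^ (16 * h)\<close>.
\<close>

definition prelude :: com where
  "prelude = seqs [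
     set_var ''R'' (V ''t'' [*] V ''t'' [+] V ''b'' [*] V ''b''),
     set_var ''e'' (Const 1),
     While (V ''e'' [<] V ''n'' [+] Const 1) sum_body,
     set_var ''h'' (V ''n'' [+] Const 16),
     set_var ''pw'' (Const 1),
     While (V ''pw'' [<] V ''R'' [+] Const 1) length_body,
     set_var ''G'' (Const 1),
     set_var ''pc'' (Const 0),
     While (V ''pc'' [<] Const 256 [*] V ''h'' [*] V ''h'') double_body]"

definition program :: com where
  "program = Seq prelude main_loop"

lemma mods_prelude [simp]:
  "mods sum_body = {''R'', ''e''}" "mods length_body = {''pw'', ''h''}" "mods double_body = {''G'', ''pc''}"
  "mods prelude = {''R'', ''e'', ''h'', ''pw'', ''G'', ''pc''}"
  by (auto simp: sum_body_def length_body_def double_body_def prelude_def set_var_def)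

definition scalars :: "vname list" where
  "scalars = [''n'', ''t'', ''b'', ''R'', ''e'', ''h'', ''pw'', ''pc'', ''pb'', ''pe'', ''pm'', ''r'', ''a'',
     ''p0'', ''p1'', ''p2'', ''x'', ''w'', ''s0'', ''s2'', ''k'', ''k2'', ''v'', ''s'', ''fail'', ''yes'',
     ''z'', ''d'', ''pr'', ''E'', ''M'', ''B'', ''out'', ''done'', ''q'', ''K'', ''f'', ''g'']"

lemma guarded_asg [simp]: "guarded S (asg x e) \<longleftrightarrow> x \<in> S"
  by (simp add: asg_def)

lemma guarded_main_loop: "guarded (set scalars) main_loop"
  by (simp add: main_loop_def attempt_def bit_loop_def bit_body_def trial_def prime_test_def divisor_body_def
      query_loop_def query_def point_loop_def point_body_def item_loop_def item_body_def powmod_def scalars_def)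

lemma G_notin_scalars: "''G'' \<notin> set scalars"
  by (simp add: scalars_def)

definition used_cells :: "nat \<Rightarrow> (vname \<times> int) set" where
  "used_cells n = insert ''G'' (set scalars) \<times> {0} \<union> {''omega'', ''nu''} \<times> {1..int n}"

lemma card_used_cells: "finite (used_cells n)" "card (used_cells n) \<le> 39 + 2 * n"
proof -
  show "finite (used_cells n)" by (simp add: used_cells_def)
  have "card (used_cells n) \<le> card (insert ''G'' (set scalars) \<times> {0::int}) + card ({''omega'', ''nu''} \<times> {1..int n})"
    unfolding used_cells_def by (rule card_Un_le)
  also have "card (insert ''G'' (set scalars) \<times> {0::int}) \<le> Suc (card (set scalars))"
    by (simp add: card_cartesian_product card_insert_le_m1)
  also have "card (set scalars) \<le> 38" using card_length[of scalars] by (simp add: scalars_def)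
  also have "card ({''omega'', ''nu''} \<times> {1..int n}) = 2 * n" by (simp add: card_cartesian_product)
  finally show "card (used_cells n) \<le> 39 + 2 * n" by simp
qed

lemma wp_set_var:
  assumes "small_mem W A m" "(x, 0) \<in> A" "eval_expr m e = v" "int_size v \<le> W"
    and "small_mem W A (upd m x v) \<Longrightarrow> wp (small_mem W A) (seqs cs) T Q (upd m x v)"
  shows "wp (small_mem W A) (seqs (set_var x e # cs)) (2 + T) Q m"
proof -
  have "small_mem W A (upd m x v)" unfolding upd_def using assms by (intro small_mem_update)
  hence "wp (small_mem W A) (set_var x e) 1 (wp (small_mem W A) (seqs cs) T Q) m"
    unfolding set_var_def using assms by (intro wp_Assign) (simp_all add: upd_def)
  from wp_Seq[OF assms(1) this] show ?thesis by simp
qed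

lemma wp_seqs_Cons':
  assumes "G m" "wp G c T1 R m" "\<And>m'. R m' \<Longrightarrow> (\<And>x. x \<notin> mods c \<Longrightarrow> m' x = m x) \<Longrightarrow> wp G (seqs cs) T2 Q m'"
  shows "wp G (seqs (c # cs)) (1 + T1 + T2) Q m"
  unfolding seqs.simps by (rule wp_Seq[where G = G and m = m, OF assms(1)], rule wp_use[OF assms(2) order_refl], rule assms(3)) auto

lemma wp_seqs_Nil': "G m \<Longrightarrow> Q m \<Longrightarrow> wp G (seqs []) 1 Q m"
  unfolding seqs.simps by (rule wp_Skip)

definition prelude_steps :: "nat \<Rightarrow> nat" where
  "prelude_steps h = 12 * h + 1536 * h ^ 2 + 40"

text \<open>The length of \<open>big h\<close> itself: \<open>256 * h ^ 2 + 1\<close> binary digits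
  and the sign.\<close>

definition cell_size :: "nat \<Rightarrow> nat" where
  "cell_size h = 256 * h ^ 2 + 2"

lemma int_size_le_cell_size: "\<bar>x\<bar> \<le> big h \<Longrightarrow> int_size x \<le> cell_size h"
proof -
  assume "\<bar>x\<bar> \<le> big h"
  hence "\<bar>x\<bar> < 2 * big h" using big_pos[of h] by linarith
  thus "int_size x \<le> cell_size h"
    using int_size_le_Suc_iff[of x "256 * h ^ 2 + 1"] by (simp add: cell_size_def big_def)
qed

context instance_data
begin

definition "magnitude = tt ^ 2 + bb ^ 2 + (\<Sum>e\<in>{1..n}. int (om e) + int (nv e))"

text \<open>By \<open>least\<close>, the second loop doubles \<open>''pw''\<close> exactly
  \<open>l\<close> times, so that the program arrives at the same \<open>h\<close> as the
  locale.\<close>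

lemma wp_prelude:
  assumes least: "\<And>i. i < l \<Longrightarrow> 2 ^ i \<le> magnitude"
    and sm: "small_mem (cell_size h) (used_cells n) m"
    and inp: "m ''n'' 0 = int n" "m ''t'' 0 = tt" "m ''b'' 0 = bb"
      "\<And>e. e \<in> {1..n} \<Longrightarrow> m ''omega'' (int e) = int (om e) \<and> m ''nu'' (int e) = int (nv e)"
      "m ''out'' 0 = 0" "m ''done'' 0 = 0"
  shows "wp (small_mem (cell_size h) (used_cells n)) prelude (prelude_steps h)
    (\<lambda>m'. small_mem (cell_size h) (used_cells n) m' \<and> ready m') m"
proof -
  define W where "W = cell_size h"
  define A where "A = used_cells n"
  define S where "S = small_mem W A"
  define P where "P = (\<lambda>i. tt ^ 2 + bb ^ 2 + (\<Sum>e\<in>{1..i}. int (om e) + int (nv e)))"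
  have Pn: "P n = magnitude" by (simp add: P_def magnitude_def)
  have l: "magnitude < 2 ^ l" using size by (simp add: magnitude_def)
  have lh: "2 ^ i < big h" if "i \<le> h" for i using pow_less_big(1)[OF that] .
  have Pb: "0 \<le> P i" "P i \<le> big h" if "i \<le> n" for i
  proof -
    show "0 \<le> P i" unfolding P_def by (intro add_nonneg_nonneg sum_nonneg) auto
    have "P i \<le> P n" unfolding P_def using that by (intro add_left_mono sum_mono2) auto
    also have "\<dots> < 2 ^ l" using l Pn by simp
    also have "\<dots> < big h" by (intro lh) (simp add: h_def)
    finally show "P i \<le> big h" by simp
  qed
  have sz: "int_size x \<le> W" if "\<bar>x\<bar> \<le> big h" for x unfolding W_def using that by (rule int_size_le_cell_size)
  have szh: "int_size x \<le> W" if "0 \<le> x" "x \<le> int h" for x using that h_less_big by (intro sz) linarith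
  have A: "(x, 0) \<in> A" if "x \<in> {''R'', ''e'', ''h'', ''pw'', ''G'', ''pc''}" for x
    using that by (auto simp: A_def used_cells_def scalars_def)
  have one: "int_size 1 \<le> W" "int_size 0 \<le> W" using szh[of 1] szh[of 0] h_pos by simp_all
  have loop1: "wp S (While (V ''e'' [<] V ''n'' [+] Const 1) sum_body) (n * (5 + 1) + 1)
      (\<lambda>m'. S m' \<and> m' ''R'' 0 = magnitude) m0"
    if m0: "S m0" "m0 ''e'' 0 = 1" "m0 ''R'' 0 = P 0" "m0 ''n'' 0 = int n" "m0 ''omega'' = m ''omega''" "m0 ''nu'' = m ''nu''" for m0
  proof (rule wp_While[where I = "\<lambda>i m'. S m' \<and> m' ''e'' 0 = int i + 1 \<and> m' ''R'' 0 = P i"])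
    show "S m0 \<and> m0 ''e'' 0 = int 0 + 1 \<and> m0 ''R'' 0 = P 0" using m0 by simp
  next
    fix i m1
    assume i: "i < n" and I: "S m1 \<and> m1 ''e'' 0 = int i + 1 \<and> m1 ''R'' 0 = P i"
      and fr: "\<And>x. x \<notin> mods sum_body \<Longrightarrow> m1 x = m0 x"
    have m1: "m1 ''n'' 0 = int n" "m1 ''omega'' (int i + 1) = int (om (Suc i))" "m1 ''nu'' (int i + 1) = int (nv (Suc i))"
      using m0 i inp(4)[of "Suc i"] by (simp_all add: fr add.commute)
    have P: "P i + int (om (Suc i)) + int (nv (Suc i)) = P (Suc i)" by (simp add: P_def)
    have "wp S sum_body 5 (\<lambda>m'. S m' \<and> m' ''e'' 0 = int (Suc i) + 1 \<and> m' ''R'' 0 = P (Suc i)) m1"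
      unfolding sum_body_def S_def
      apply (rule wp_le)
       apply (rule wp_set_var[where v = "P (Suc i)"])
           apply (use I in \<open>simp add: S_def\<close>)
          apply (rule A, simp)
         apply (use I P in \<open>simp add: m1\<close>)
        apply (rule sz) 
        apply (use Pb[of "Suc i"] i in simp)
       apply (rule wp_set_var[where v = "int i + 2"])
           apply assumption
          apply (rule A, simp)
         apply (use I in simp)
        apply (rule szh)
         apply simp
        apply (use i n_less_h in simp)
       apply (rule wp_seqs_Nil')
        apply assumption
       apply simp
      apply simp
      done
    thus "S m1 \<and> eval_expr m1 (V ''e'' [<] V ''n'' [+] Const 1) \<noteq> 0 \<and>
        wp S sum_body 5 (\<lambda>m'. S m' \<and> m' ''e'' 0 = int (Suc i) + 1 \<and> m' ''R'' 0 = P (Suc i)) m1"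
      using I i m1 by simp
  next
    fix m1 assume I: "S m1 \<and> m1 ''e'' 0 = int n + 1 \<and> m1 ''R'' 0 = P n"
      and fr: "\<And>x. x \<notin> mods sum_body \<Longrightarrow> m1 x = m0 x"
    thus "S m1 \<and> eval_expr m1 (V ''e'' [<] V ''n'' [+] Const 1) = 0 \<and> S m1 \<and> m1 ''R'' 0 = magnitude"
      using m0 Pn by (simp add: fr)
  qed
  have loop2: "wp S (While (V ''pw'' [<] V ''R'' [+] Const 1) length_body) (l * (5 + 1) + 1)
      (\<lambda>m'. S m' \<and> m' ''h'' 0 = int h) m0"
    if m0: "S m0" "m0 ''h'' 0 = int n + 16" "m0 ''pw'' 0 = 1" "m0 ''R'' 0 = magnitude" for m0
  proof (rule wp_While[where I = "\<lambda>i m'. S m' \<and> m' ''h'' 0 = int n + 16 + int i \<and> m' ''pw'' 0 = 2 ^ i"])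
    show "S m0 \<and> m0 ''h'' 0 = int n + 16 + int 0 \<and> m0 ''pw'' 0 = 2 ^ 0" using m0 by simp
  next
    fix i m1
    assume i: "i < l" and I: "S m1 \<and> m1 ''h'' 0 = int n + 16 + int i \<and> m1 ''pw'' 0 = 2 ^ i"
      and fr: "\<And>x. x \<notin> mods length_body \<Longrightarrow> m1 x = m0 x"
    have R: "m1 ''R'' 0 = magnitude" using m0 by (simp add: fr)
    have "wp S length_body 5 (\<lambda>m'. S m' \<and> m' ''h'' 0 = int n + 16 + int (Suc i) \<and> m' ''pw'' 0 = 2 ^ Suc i) m1"
      unfolding length_body_def S_def
      apply (rule wp_le)
       apply (rule wp_set_var[where v = "2 ^ Suc i"])
           apply (use I in \<open>simp add: S_def\<close>)
          apply (rule A, simp)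
         apply (use I in simp)
        apply (rule sz) 
        apply (use lh[of "Suc i"] i in \<open>simp add: h_def\<close>)
       apply (rule wp_set_var[where v = "int n + 17 + int i"])
           apply assumption
          apply (rule A, simp)
         apply (use I in simp)
        apply (rule szh)
         apply simp
        apply (use i in \<open>simp add: h_def\<close>)
       apply (rule wp_seqs_Nil')
        apply assumption
       apply simp
      apply simp
      done
    thus "S m1 \<and> eval_expr m1 (V ''pw'' [<] V ''R'' [+] Const 1) \<noteq> 0 \<and>
        wp S length_body 5 (\<lambda>m'. S m' \<and> m' ''h'' 0 = int n + 16 + int (Suc i) \<and> m' ''pw'' 0 = 2 ^ Suc i) m1"
      using I least[OF i] R by simp
  next
    fix m1 assume I: "S m1 \<and> m1 ''h'' 0 = int n + 16 + int l \<and> m1 ''pw'' 0 = 2 ^ l"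
      and fr: "\<And>x. x \<notin> mods length_body \<Longrightarrow> m1 x = m0 x"
    have "m1 ''R'' 0 = magnitude" using m0 by (simp add: fr)
    thus "S m1 \<and> eval_expr m1 (V ''pw'' [<] V ''R'' [+] Const 1) = 0 \<and> S m1 \<and> m1 ''h'' 0 = int h"
      using I l by (simp add: h_def)
  qed
  define H where "H = 256 * h ^ 2"
  have H: "256 * int h * int h = int H" by (simp add: H_def power2_eq_square)
  have bigH: "big h = 2 ^ H" by (simp add: big_def H_def)
  have Hb: "int H \<le> big h" unfolding bigH by (metis less_exp less_imp_le of_nat_le_iff of_nat_numeral of_nat_power)
  have loop3: "wp S (While (V ''pc'' [<] Const 256 [*] V ''h'' [*] V ''h'') double_body) (H * (5 + 1) + 1)
      (\<lambda>m'. S m' \<and> m' ''G'' 0 = big h) m0"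
    if m0: "S m0" "m0 ''h'' 0 = int h" "m0 ''G'' 0 = 1" "m0 ''pc'' 0 = 0" for m0
  proof (rule wp_While[where I = "\<lambda>i m'. S m' \<and> m' ''G'' 0 = 2 ^ i \<and> m' ''pc'' 0 = int i"])
    show "S m0 \<and> m0 ''G'' 0 = 2 ^ 0 \<and> m0 ''pc'' 0 = int 0" using m0 by simp
  next
    fix i m1
    assume i: "i < H" and I: "S m1 \<and> m1 ''G'' 0 = 2 ^ i \<and> m1 ''pc'' 0 = int i"
      and fr: "\<And>x. x \<notin> mods double_body \<Longrightarrow> m1 x = m0 x"
    have h: "m1 ''h'' 0 = int h" using m0 by (simp add: fr)
    have "(2::int) ^ Suc i \<le> big h" unfolding bigH using i by (intro power_increasing) auto
    hence pb: "\<bar>2 ^ Suc i\<bar> \<le> big h" by simp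
    have "wp S double_body 5 (\<lambda>m'. S m' \<and> m' ''G'' 0 = 2 ^ Suc i \<and> m' ''pc'' 0 = int (Suc i)) m1"
      unfolding double_body_def S_def
      apply (rule wp_le)
       apply (rule wp_set_var[where v = "2 ^ Suc i"])
           apply (use I in \<open>simp add: S_def\<close>)
          apply (rule A, simp)
         apply (use I in simp)
        apply (rule sz[OF pb]) 
       apply (rule wp_set_var[where v = "int i + 1"])
           apply assumption
          apply (rule A, simp)
         apply (use I in simp)
        apply (rule sz)
        apply (use i Hb in simp)
       apply (rule wp_seqs_Nil')
        apply assumption
       apply simp
      apply simp
      done
    thus "S m1 \<and> eval_expr m1 (V ''pc'' [<] Const 256 [*] V ''h'' [*] V ''h'') \<noteq> 0 \<and>
        wp S double_body 5 (\<lambda>m'. S m' \<and> m' ''G'' 0 = 2 ^ Suc i \<and> m' ''pc'' 0 = int (Suc i)) m1"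
      using I i h H by simp
  next
    fix m1 assume I: "S m1 \<and> m1 ''G'' 0 = 2 ^ H \<and> m1 ''pc'' 0 = int H"
      and fr: "\<And>x. x \<notin> mods double_body \<Longrightarrow> m1 x = m0 x"
    have "m1 ''h'' 0 = int h" using m0 by (simp add: fr)
    thus "S m1 \<and> eval_expr m1 (V ''pc'' [<] Const 256 [*] V ''h'' [*] V ''h'') = 0 \<and> S m1 \<and> m1 ''G'' 0 = big h"
      using I H by (simp add: bigH)
  qed
  have time: "2 + (2 + (1 + (n * (5 + 1) + 1) + (2 + (2 + (1 + (l * (5 + 1) + 1) + (2 + (2 + (1 + (H * (5 + 1) + 1) + 1))))))))
      \<le> prelude_steps h"
    using n_less_h unfolding prelude_steps_def H_def by (simp add: h_def)
  have P0: "tt * tt + bb * bb = P 0" by (simp add: P_def power2_eq_square)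
  have "wp S prelude (prelude_steps h) (\<lambda>m'. S m' \<and> m' ''h'' 0 = int h \<and> m' ''G'' 0 = big h) m"
    unfolding prelude_def S_def
    apply (rule wp_le)
     apply (rule wp_set_var[where v = "P 0"])
         apply (rule sm[folded W_def A_def])
        apply (rule A, simp)
       apply (use P0 in \<open>simp add: inp\<close>)
      apply (rule sz)
      apply (use Pb[of 0] in simp)
     apply (rule wp_set_var[where v = 1])
         apply assumption
        apply (rule A, simp)
       apply simp
      apply (rule one)
     apply (rule wp_seqs_Cons')
       apply assumption
      apply (rule loop1[unfolded S_def])
           apply assumption
          apply simp
         apply simp
        apply (simp add: inp)
       apply simp
      apply simp
     apply (erule conjE)
     apply (rule wp_set_var[where v = "int n + 16"])
         apply assumption
        apply (rule A, simp)
       apply (simp add: inp)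
      apply (rule szh, simp, simp add: h_def)
     apply (rule wp_set_var[where v = 1])
         apply assumption
        apply (rule A, simp)
       apply simp
      apply (rule one)
     apply (rule wp_seqs_Cons')
       apply assumption
      apply (rule loop2[unfolded S_def])
         apply assumption
        apply simp
       apply simp
      apply simp
     apply (erule conjE)
     apply (rule wp_set_var[where v = 1])
         apply assumption
        apply (rule A, simp)
       apply simp
      apply (rule one)
     apply (rule wp_set_var[where v = 0])
         apply assumption
        apply (rule A, simp)
       apply simp
      apply (rule one)
     apply (rule wp_seqs_Cons')
       apply assumption
      apply (rule loop3[unfolded S_def])
         apply assumption
        apply simp
       apply simp
      apply simp
     apply (erule conjE)
     apply (rule wp_seqs_Nil')
      apply assumption
     apply simp
    apply (rule time)
    done
  thus ?thesis
    unfolding W_def[symmetric] A_def[symmetric] S_def[symmetric]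
    by (rule wp_use[OF _ order_refl]) (use inp in \<open>simp add: ready_def env_def\<close>)
qed

end

subsection \<open>The bounds in terms of the input size\<close>

lemma is_poly_mono: "is_poly f \<Longrightarrow> x \<le> y \<Longrightarrow> f x \<le> f y"
proof -
  assume "is_poly f" and xy: "x \<le> y"
  then obtain p where p: "\<And>x. f x = poly p x" unfolding is_poly_def by blast
  have "poly p x \<le> poly p y" using xy by (induction p) (simp_all add: mult_le_mono)
  thus "f x \<le> f y" by (simp add: p)
qed

definition step_bound :: "nat \<Rightarrow> nat" where
  "step_bound h = 1 + com_weight program ^ 2 * cell_size h"

definition space_bound :: "nat \<Rightarrow> nat" where
  "space_bound h = (39 + 2 * h) * (2 * cell_size h) + step_bound h"

definition time_bound :: "nat \<Rightarrow> nat" where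
  "time_bound h = step_bound h *
     (1 + prelude_steps h + loop_bound h)"

lemma is_poly_bounds: "is_poly space_bound" "is_poly time_bound"
proof -
  have s: "is_poly step_bound" unfolding step_bound_def cell_size_def by (intro is_poly_intros)
  have "is_poly cell_size" unfolding cell_size_def by (intro is_poly_intros)
  thus "is_poly space_bound" unfolding space_bound_def by (intro is_poly_intros s)
  have p: "is_poly t_pow" unfolding t_pow_def by (intro is_poly_intros)
  have "is_poly t_item" unfolding t_item_def by (intro is_poly_intros p)
  hence t: "is_poly t_point" unfolding t_point_def by (intro is_poly_intros p)
  have b: "is_poly trial_bound" unfolding trial_bound_def by (intro is_poly_intros p t)
  have b: "is_poly loop_bound" unfolding loop_bound_def by (intro is_poly_intros b)
  have r: "is_poly prelude_steps" unfolding prelude_steps_def by (intro is_poly_intros)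
  show "is_poly time_bound" unfolding time_bound_def by (intro is_poly_intros s b r)
qed

lemma int_size_sum: "finite A \<Longrightarrow> int_size (\<Sum>x\<in>A. f x) \<le> 1 + (\<Sum>x\<in>A. int_size (f x))"
proof (induction A rule: finite_induct)
  case empty
  show ?case using int_size_le_Suc_iff[of 0 0] by simp
next
  case (insert x A)
  thus ?case using int_size_add[of "f x" "\<Sum>x\<in>A. f x"] by simp
qed

definition weight_magnitude :: "knapsack \<Rightarrow> int" where
  "weight_magnitude K = target K ^ 2 + budget K ^ 2 + (\<Sum>e\<in>{1..num K}. int (omega K e) + int (nu K e))"

text \<open>This makes \<open>l\<close>, and with it \<open>h\<close>, linear in the input
  size.\<close>

lemma int_size_weight_magnitude: "int_size (weight_magnitude K) \<le> 2 * input_size K + 1"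
proof -
  have 1: "int_size (weight_magnitude K) \<le> int_size (target K ^ 2) + int_size (budget K ^ 2)
      + int_size (\<Sum>e\<in>{1..num K}. int (omega K e) + int (nu K e))"
    unfolding weight_magnitude_def by (meson add_mono int_size_add order_refl order_trans)
  have 2: "int_size (target K ^ 2) \<le> 2 * int_size (target K)" "int_size (budget K ^ 2) \<le> 2 * int_size (budget K)"
    using int_size_mult[of "target K" "target K"] int_size_mult[of "budget K" "budget K"]
    by (simp_all add: power2_eq_square)
  have 3: "int_size (\<Sum>e\<in>{1..num K}. int (omega K e) + int (nu K e)) \<le>
      1 + (\<Sum>e\<in>{1..num K}. int_size (int (omega K e) + int (nu K e)))" by (rule int_size_sum) simp
  have 4: "(\<Sum>e\<in>{1..num K}. int_size (int (omega K e) + int (nu K e))) \<le>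
      (\<Sum>e\<in>{1..num K}. int_size (int (omega K e)) + int_size (int (nu K e)))"
    by (intro sum_mono int_size_add)
  have "a \<le> 2 * (f + t + u) + 1"
    if "a \<le> b + c + d" "b \<le> 2 * t" "c \<le> 2 * u" "d \<le> 1 + e" "e \<le> f" for a b c d e f t u :: nat
  proof -
    have "b + c + d \<le> 2 * t + 2 * u + (1 + f)" using that by (intro add_mono) auto
    thus ?thesis using that(1) by simp
  qed
  from this[OF 1 2 3 4] show ?thesis unfolding input_size_def universe_def .
qed

lemma num_le_input_size: "num K \<le> input_size K"
proof -
  have "num K = (\<Sum>e\<in>universe K. 1)" by (simp add: universe_def)
  also have "\<dots> \<le> (\<Sum>e\<in>universe K. int_size (int (omega K e)) + int_size (int (nu K e)))"
    by (intro sum_mono trans_le_add1 int_size_ge_1)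
  finally show ?thesis unfolding input_size_def by simp
qed

lemma program_bounds:
  "decides (start program K) (solvable K)"
  "expected_time (start program K) \<le> of_nat (time_bound (3 * input_size K + 20) * num_weight_pairs K)"
  "config_space (run k \<rho> (start program K)) \<le> space_bound (3 * input_size K + 20)"
proof -
  define s where "s = input_size K"
  have ex: "weight_magnitude K < 2 ^ (2 * s)"
    using int_size_le_Suc_iff[of "weight_magnitude K" "2 * s"] int_size_weight_magnitude[of K] by (simp add: s_def)
  \<comment> \<open>The locale accepts every sufficiently large \<open>l\<close>, but
    \<open>wp_prelude\<close> and the polynomial bounds ask for the least one.\<close>
  define l where "l = (LEAST l. weight_magnitude K < 2 ^ l)"
  have l: "weight_magnitude K < 2 ^ l" unfolding l_def by (rule LeastI[of "\<lambda>l. weight_magnitude K < 2 ^ l", OF ex])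
  have l_le: "l \<le> 2 * s" unfolding l_def by (rule Least_le[of "\<lambda>l. weight_magnitude K < 2 ^ l", OF ex])
  have least: "2 ^ i \<le> weight_magnitude K" if "i < l" for i
    using not_less_Least[of i "\<lambda>l. weight_magnitude K < 2 ^ l"] that unfolding l_def by simp
  interpret instance_data "num K" "omega K" "nu K" "target K" "budget K" l
    by unfold_locales (use l in \<open>simp add: weight_magnitude_def\<close>)
  have mag: "magnitude = weight_magnitude K" by (simp add: magnitude_def weight_magnitude_def)
  have feas: "feasible \<longleftrightarrow> solvable K" by (simp add: feasible_def solvable_def universe_def)
  have pairs: "num_pairs = num_weight_pairs K" by (simp add: num_pairs_def num_weight_pairs_def universe_def)
  have h_le: "h \<le> 3 * s + 20" using l_le num_le_input_size[of K] by (simp add: h_def s_def)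
  define m where "m = input_mem K"
  define W where "W = cell_size h"
  define A where "A = used_cells (num K)"
  have W2: "2 \<le> W" by (simp add: W_def cell_size_def)
  have inp: "m ''n'' 0 = int (num K)" "m ''t'' 0 = target K" "m ''b'' 0 = budget K"
    "\<And>e. e \<in> {1..num K} \<Longrightarrow> m ''omega'' (int e) = int (omega K e) \<and> m ''nu'' (int e) = int (nu K e)"
    "m ''out'' 0 = 0" "m ''done'' 0 = 0"
    by (simp_all add: m_def input_mem_def)
  have lb: "2 ^ l < big h" by (rule pow_less_big) (simp add: h_def)
  have sm: "small_mem W A m"
    unfolding small_mem_def
  proof (intro allI conjI impI)
    fix x i
    have "\<bar>m x i\<bar> \<le> big h"
    proof -
      have "\<bar>target K\<bar> \<le> big h" "\<bar>budget K\<bar> \<le> big h" using size_bounds(3,4)[of "{}"] lb by simp_all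
      moreover have "\<bar>int (num K)\<bar> \<le> big h" using h_less_big n_less_h by linarith
      moreover have "\<bar>int (omega K (nat i))\<bar> \<le> big h" "\<bar>int (nu K (nat i))\<bar> \<le> big h" if "1 \<le> i" "i \<le> int (num K)"
      proof -
        have "{nat i} \<subseteq> {1..num K}" using that by auto
        from size_bounds(1,2)[OF this]
        have "int (omega K (nat i)) < 2 ^ l" "int (nu K (nat i)) < 2 ^ l" by simp_all
        thus "\<bar>int (omega K (nat i))\<bar> \<le> big h" "\<bar>int (nu K (nat i))\<bar> \<le> big h" using lb by linarith+
      qed
      moreover have "0 \<le> big h" using big_pos[of h] by simp
      ultimately show ?thesis unfolding m_def input_mem_def by simp
    qed
    thus "int_size (m x i) \<le> W" unfolding W_def by (rule int_size_le_cell_size)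
    assume "m x i \<noteq> 0"
    thus "(x, i) \<in> A" unfolding m_def A_def used_cells_def input_mem_def scalars_def
      by (auto split: if_splits)
  qed
  have pre: "wp (small_mem W A) prelude (prelude_steps h) (\<lambda>m'. small_mem W A m' \<and> ready m') m"
    using wp_prelude[OF _ sm[unfolded W_def A_def] inp] least unfolding mag W_def A_def by blast
  have st: "start program K = ([Seq prelude main_loop], m)" by (simp add: start_def program_def m_def)
  have small: "small_mem W A (snd (run k \<rho> (start program K)))" for k \<rho>
    unfolding st
  proof (rule run_small_mem[where V = "set scalars"])
    show "wp (small_mem W A) prelude (prelude_steps h) (\<lambda>m'. small_mem W A m' \<and> 0 < m' ''G'' 0) m"
      by (rule wp_mono[OF pre order_refl]) (simp add: ready_def env_def big_pos)
    show "set scalars \<times> {0} \<subseteq> A" by (auto simp: A_def used_cells_def)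
  qed (use sm W2 guarded_main_loop G_notin_scalars in auto)
  have cost: "step_cost (run k \<rho> (start program K)) \<le> step_bound h" for k \<rho>
  proof -
    obtain cs m' where r: "run k \<rho> (start program K) = (cs, m')" by fastforce
    have "\<forall>c\<in>set cs. com_weight c \<le> com_weight program"
      using run_com_weight[of "[program]" "com_weight program" k \<rho> m] r by (simp add: st flip: program_def)
    moreover have "small_mem W A m'" using small[of k \<rho>] r by simp
    ultimately show ?thesis unfolding r step_bound_def W_def[symmetric] by (intro step_cost_le)
  qed
  show "config_space (run k \<rho> (start program K)) \<le> space_bound (3 * input_size K + 20)"
  proof -
    have "int_size i \<le> W" if "(x, i) \<in> A" for x i
    proof -
      have "\<bar>i\<bar> \<le> int (num K)" using that by (auto simp: A_def used_cells_def)
      hence "\<bar>i\<bar> \<le> big h" using h_less_big n_less_h by linarith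
      thus ?thesis unfolding W_def by (rule int_size_le_cell_size)
    qed
    hence "mem_size (snd (run k \<rho> (start program K))) \<le> card A * (2 * W)"
      using small card_used_cells(1) by (intro mem_size_le) (auto simp: A_def)
    also have "\<dots> \<le> (39 + 2 * h) * (2 * W)"
      using card_used_cells(2)[of "num K"] n_less_h by (intro mult_right_mono) (auto simp: A_def)
    finally have "config_space (run k \<rho> (start program K)) \<le> space_bound h"
      unfolding config_space_def space_bound_def W_def using cost[of k \<rho>] by simp
    also have "\<dots> \<le> space_bound (3 * s + 20)" by (rule is_poly_mono[OF is_poly_bounds(1) h_le])
    finally show ?thesis by (simp add: s_def)
  qed
  define T where "T = real (1 + prelude_steps h + loop_bound h * num_pairs)"
  have steps: "steps_upto (\<lambda>\<sigma>. if snd \<sigma> ''out'' 0 \<noteq> 0 \<longleftrightarrow> solvable K then 0 else B) N (start program K) \<le> T"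
    if B: "B \<ge> 0" for B N
  proof -
    define w where "w = (\<lambda>\<sigma> :: config. if snd \<sigma> ''out'' 0 \<noteq> 0 \<longleftrightarrow> solvable K then 0 else B)"
    have w: "w \<sigma> \<ge> 0" for \<sigma> using B by (simp add: w_def)
    obtain m' where m': "ready m'" and le:
      "steps_upto w N ([prelude, main_loop], m) \<le> real (prelude_steps h) + steps_upto w N ([main_loop], m')"
      using steps_upto_wp[where w = w and N = N and cs = "[main_loop]", OF w pre] by blast
    have "steps_upto w N ([main_loop], m') \<le> real (loop_bound h * num_pairs)"
      using m' by (intro main_loop_steps w) (simp_all add: w_def feas)
    hence "steps_upto w N (start program K) \<le> 1 + (real (prelude_steps h) + real (loop_bound h * num_pairs))"
      unfolding st using le by (intro steps_upto_Seq[OF w]) linarith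
    thus ?thesis unfolding w_def[symmetric] T_def by simp
  qed
  show "decides (start program K) (solvable K)"
    by (rule decides_and_expected_time(1)[OF steps cost])
  have "expected_time (start program K) \<le> ennreal (real (step_bound h) * T)"
    by (rule decides_and_expected_time(2)[OF steps cost])
  also have "\<dots> = of_nat (step_bound h * (1 + prelude_steps h + loop_bound h * num_pairs))"
    unfolding T_def ennreal_of_nat_eq_real_of_nat by (simp only: of_nat_mult)
  also have "\<dots> \<le> of_nat (time_bound h * num_pairs)"
  proof -
    \<comment> \<open>The empty set contributes a pair, so \<open>num_pairs\<close> is positive and
      the factor can absorb the time of the prelude.\<close>
    have "1 + prelude_steps h \<le> (1 + prelude_steps h) * num_pairs"
      using mult_le_mono2[OF num_pairs_bounds(1), of "1 + prelude_steps h"] by (simp only: mult_1_right)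
    hence "1 + prelude_steps h + loop_bound h * num_pairs \<le> (1 + prelude_steps h + loop_bound h) * num_pairs"
      by (simp add: algebra_simps)
    hence "step_bound h * (1 + prelude_steps h + loop_bound h * num_pairs) \<le>
        step_bound h * ((1 + prelude_steps h + loop_bound h) * num_pairs)" by (rule mult_left_mono) simp
    also have "\<dots> = time_bound h * num_pairs"
      by (simp only: time_bound_def mult.assoc)
    finally show ?thesis by (rule of_nat_mono)
  qed
  also have "\<dots> \<le> of_nat (time_bound (3 * s + 20) * num_pairs)"
    by (intro of_nat_mono mult_right_mono is_poly_mono[OF is_poly_bounds(2) h_le]) simp
  finally show "expected_time (start program K) \<le> of_nat (time_bound (3 * input_size K + 20) * num_weight_pairs K)"
    by (simp add: s_def pairs)
qed

theorem theorem4: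
  shows "\<exists>(P :: com) (p :: nat poly). \<forall>N K. knapsack_instance N K \<longrightarrow>
    decides (start P K) (solvable K) \<and>
    expected_time (start P K) \<le> of_nat (poly p (input_size K) * num_weight_pairs K) \<and>
    (\<forall>\<rho> k. config_space (run k \<rho> (start P K)) \<le> poly p (input_size K))"
proof -
  have "is_poly (\<lambda>s. time_bound (3 * s + 20) + space_bound (3 * s + 20))"
    by (intro is_poly_add is_poly_compose[OF is_poly_bounds(1)] is_poly_compose[OF is_poly_bounds(2)] is_poly_intros)
  then obtain p where p: "\<And>s. time_bound (3 * s + 20) + space_bound (3 * s + 20) = poly p s"
    unfolding is_poly_def by blast
  show ?thesis
  proof (intro exI[of _ program] exI[of _ p] allI impI conjI)
    fix K
    show "decides (start program K) (solvable K)" by (rule program_bounds)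
    have "time_bound (3 * input_size K + 20) * num_weight_pairs K \<le> poly p (input_size K) * num_weight_pairs K"
      unfolding p[symmetric] by (intro mult_right_mono) auto
    thus "expected_time (start program K) \<le> of_nat (poly p (input_size K) * num_weight_pairs K)"
      by (intro order_trans[OF program_bounds(2)] of_nat_mono)
    fix \<rho> k
    show "config_space (run k \<rho> (start program K)) \<le> poly p (input_size K)"
      unfolding p[symmetric] by (rule order_trans[OF program_bounds(3)]) simp
  qed
qed

end
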